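(* Let $m\ge2$ be an integer. Let $g:[0,2\pi]\to\mathbb{R}$ be a continuous function which is three times continuously differentiable in neighborhoods of the points $\frac{2\pi s}{m}$ for all $s\in\{1,\dots,m-1\}$ and satisfies $g(x)=g(2\pi-x)$. Let $f:(S^1)^m\to\mathbb{R}$ be defined by $$f(U_1,\dots,U_m)=\sum_{0\le i<j\le m-1}g(|\beta_j-\beta_i|),$$ where $\beta_0=0$ and, for $i=1,\dots,m-1$, $\beta_i\in[0,2\pi)$ is the counterclockwise angle from $OU_1$ to $OU_{i+1}$; suppose that $f$ attains its maximum only at the vertices of a regular $m$-gon. Let $U_1,U_2,\dots$ be independent points on $S^1$ with a common continuous density $p(x)$ such that $\int_0^{2\pi}\prod_{l=0}^{m-1}p\left(x+\frac{2\pi l}{m}\right)dx>0$, and for $n\ge m$ let $H_n=\max_{1\le i_1<\dots<i_m\le n}f(U_{i_1},\dots,U_{i_m})$. Consider the symmetric matrix $G=(g_{i,j})_{i,j=1}^{m-1}$ with $$g_{i,j}=\begin{cases}-g''\left(\frac{2\pi|i-j|}{m}\right),& i\ne j,\\ \sum_{s=1}^{m-1}g''\left(\frac{2\pi s}{m}\right),& i=j.\end{cases}$$ If $\det G\ne0$, then for every $t>0$ $$\lim_{n\to\infty}\mathbb{P}\left\{n^{\frac{2m}{m-1}}\left(\frac12\sum_{s=1}^{m-1}m\,g\left(\frac{2\pi s}{m}\right)-H_n\right)\le t\right\}=1-\exp\left(-\frac{t^{\frac{m-1}{2}}K}{m}\right),$$ where $$K=\frac{(2\pi)^{\frac{m-1}{2}}\left[\int_0^{2\pi}\prod_{l=0}^{m-1}p\left(x+\frac{2\pi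 l}{m}\right)dx\right]}{\sqrt{\det(-G)}\,\Gamma\left(\frac{m+1}{2}\right)}.$$
   Context: $S^1$ is the unit circle with center $O$; points are identified with polar angles modulo $2\pi$, and a density $p$ on $S^1$ is regarded as a $2\pi$-periodic non-negative function on $\mathbb{R}$ with $\int_0^{2\pi}p(x)\,dx=1$. "$f$ attains its maximum only at the vertices of a regular $m$-gon" means that $(U_1,\dots,U_m)$ is a maximum point of $f$ if and only if $U_1,\dots,U_m$ are, in some order, the vertices of a regular $m$-gon inscribed in $S^1$ (an antipodal pair if $m=2$). *)

theory Defs
  imports "HOL-Probability.Probability" "Jordan_Normal_Form.Determinant"
begin

definition unit_circle :: "complex set" where
  "unit_circle = sphere 0 1"

text \<open>The space of this measure is the unit circle, so random variables with values in it are
  everywhere (not just almost surely) points of the circle.\<close>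

definition arc_length :: "complex measure" where
  "arc_length = distr (restrict_space lborel {0..<2 * pi}) (restrict_space borel unit_circle) cis"

text \<open>Throughout, an \<open>m\<close>-tuple of points is a function on \<open>{1..m}\<close>; its values elsewhere are
  irrelevant. The counterclockwise angle in \<open>[0, 2\<pi>)\<close> from \<open>Ou\<close> to \<open>Ov\<close> is the argument of \<open>v / u\<close>.\<close>

definition beta :: "(nat \<Rightarrow> complex) \<Rightarrow> nat \<Rightarrow> real" where
  "beta u i = (if i = 0 then 0 else Arg2pi (u (i + 1) / u 1))"

definition pair_sum :: "nat \<Rightarrow> (real \<Rightarrow> real) \<Rightarrow> (nat \<Rightarrow> complex) \<Rightarrow> real" where
  "pair_sum m g u = (\<Sum>j<m. \<Sum>i<j. g \<bar>beta u j - beta u i\<bar>)"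

definition regular_polygon :: "nat \<Rightarrow> (nat \<Rightarrow> complex) \<Rightarrow> bool" where
  "regular_polygon m u \<longleftrightarrow>
    (\<exists>z\<in>unit_circle. \<exists>\<sigma>. bij_betw \<sigma> {1..m} {..<m} \<and>
      (\<forall>i\<in>{1..m}. u i = z * cis (2 * pi * real (\<sigma> i) / real m)))"

definition max_only_at_regular_polygons :: "nat \<Rightarrow> ((nat \<Rightarrow> complex) \<Rightarrow> real) \<Rightarrow> bool" where
  "max_only_at_regular_polygons m f \<longleftrightarrow>
    (\<forall>u. is_arg_max f (\<lambda>v. v \<in> {1..m} \<rightarrow> unit_circle) u \<longleftrightarrow> regular_polygon m u)"

definition cont_diff_on :: "nat \<Rightarrow> (real \<Rightarrow> real) \<Rightarrow> real set \<Rightarrow> bool" where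
  "cont_diff_on k f S \<longleftrightarrow>
    (\<forall>j<k. \<forall>x\<in>S. (deriv ^^ j) f differentiable (at x)) \<and> continuous_on S ((deriv ^^ k) f)"

text \<open>The maximum over an empty family (\<open>n < m\<close>) is unspecified.\<close>

definition max_stat :: "nat \<Rightarrow> ((nat \<Rightarrow> complex) \<Rightarrow> real) \<Rightarrow> (nat \<Rightarrow> 'a \<Rightarrow> complex) \<Rightarrow> nat \<Rightarrow> 'a \<Rightarrow> real"
  where
  "max_stat m f U n \<omega> =
    Max {f (\<lambda>k. U (\<iota> k) \<omega>) | \<iota>. strict_mono_on {1..m} \<iota> \<and> \<iota> \<in> {1..m} \<rightarrow> {1..n}}"

text \<open>Rows and columns are numbered from \<open>0\<close>; this does not affect the entries, which depend only on
  \<open>\<bar>i - j\<bar>\<close>.\<close>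

definition hess_mat :: "nat \<Rightarrow> (real \<Rightarrow> real) \<Rightarrow> real Matrix.mat" where
  "hess_mat m g = Matrix.mat (m - 1) (m - 1) (\<lambda>(i, j).
     if i \<noteq> j then - (deriv ^^ 2) g (2 * pi * \<bar>real i - real j\<bar> / real m)
     else (\<Sum>s = 1..m - 1. (deriv ^^ 2) g (2 * pi * real s / real m)))"

definition density_overlap :: "nat \<Rightarrow> (real \<Rightarrow> real) \<Rightarrow> real" where
  "density_overlap m p = integral {0..2 * pi} (\<lambda>x. \<Prod>l<m. p (x + 2 * pi * real l / real m))"

definition limit_const :: "nat \<Rightarrow> (real \<Rightarrow> real) \<Rightarrow> (real \<Rightarrow> real) \<Rightarrow> real" where
  "limit_const m g p =
    (2 * pi) powr ((real m - 1) / 2) * density_overlap m p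
      / (sqrt (Determinant.det (- hess_mat m g)) * Gamma ((real m + 1) / 2))"

end

theory Submission
  imports Defs
begin

text \<open>
  Let \<open>\<epsilon> = t n^(-2m/(m-1))\<close>, and call an
  \<open>m\<close>-subset of the indices a hit if its points come within \<open>\<epsilon>\<close> of the maximal value. The event in
  question says that there is a hit, and the number of hits is asymptotically Poisson.

  Up to rotation and labelling, a hit is a small perturbation \<open>v\<close> of a regular polygon, on which the
  deficit from the maximum is half the positive definite form \<open>-G\<close> at \<open>v\<close>, up to smaller order.
  So \<open>v / \<surd>\<epsilon>\<close> ranges over an ellipsoid, whose volume gives the constant \<open>K\<close>. Two hits sharing an
  index are asymptotically negligible: given one point of a hit, every further point must lie within
  \<open>O(\<surd>\<epsilon>)\<close> of one of \<open>m\<close> positions, and \<open>n \<surd>\<epsilon>\<close> tends to \<open>0\<close>.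
\<close>

subsection \<open>Poisson approximation for locally dependent events\<close>

text \<open>The exponent is a balance. The rotation of a hit is free and its other
  \<open>m - 1\<close> offsets are confined to a region of diameter O(sqrt \<epsilon>), so a hit has
  probability of order \<open>\<epsilon> powr ((m - 1) / 2)\<close>. There are about n^m / m!
  subsets, and the expected number of hits stays of order one when \<epsilon> is of order
  n^(-2m/(m-1)); then n * sqrt \<epsilon> is of order n^(-1/(m-1)). The factor 1/m in the limit is
  (m - 1)! / m!: labellings of the vertices other than the root, over the factorial from the
  binomial coefficient. The hypothesis on the maximum enters twice. Regular polygons being maximal
  makes the gradient vanish and -G positive semidefinite, and the determinant condition turns this
  into definiteness. Nothing else being maximal gives, by compactness, a positive deficit away from
  regular polygons. Compactness alone yields no rate; the quadratic lower bound supplies the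
  distance O(sqrt \<epsilon>), which is needed both to bound the rescaled region and to control
  overlapping pairs.\<close>

lemma one_minus_prod_le_sum:
  fixes x :: "'i \<Rightarrow> real"
  assumes "finite A" "\<And>i. i \<in> A \<Longrightarrow> 0 \<le> x i" "\<And>i. i \<in> A \<Longrightarrow> x i \<le> 1"
  shows "1 - (\<Prod>i\<in>A. 1 - x i) \<le> (\<Sum>i\<in>A. x i)"
  using assms
proof (induction A)
  case (insert a A)
  have P: "0 \<le> (\<Prod>i\<in>A. 1 - x i)" "(\<Prod>i\<in>A. 1 - x i) \<le> 1"
    using insert.prems by (auto intro!: prod_nonneg prod_le_1)
  have "1 - (\<Prod>i\<in>insert a A. 1 - x i) = 1 - (\<Prod>i\<in>A. 1 - x i) + x a * (\<Prod>i\<in>A. 1 - x i)"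
    using insert.hyps by (simp add: algebra_simps)
  also have "\<dots> \<le> (\<Sum>i\<in>A. x i) + x a * 1"
    using insert P by (intro add_mono mult_left_mono) auto
  finally show ?case using insert.hyps by simp
qed simp

text \<open>Thinning: \<open>\<psi> s = E (1 - s) ^ W\<close> satisfies \<open>\<psi>' = - \<lambda> \<psi>\<close> up to an error \<open>b\<^sub>1 + b\<^sub>2\<close>, where
  \<open>W\<close> counts the events that occur; \<open>\<psi> 0 = 1\<close> and \<open>\<psi> 1\<close> is the probability that none occurs.\<close>

lemma (in prob_space) poisson_approx_none:
  fixes E :: "'i \<Rightarrow> 'a set"
  assumes A: "finite A"
    and E: "\<And>i. i \<in> A \<Longrightarrow> E i \<in> events"
    and N: "\<And>i. i \<in> A \<Longrightarrow> i \<in> N i \<and> N i \<subseteq> A"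
    and indep: "\<And>i s. i \<in> A \<Longrightarrow> s \<in> {0..1} \<Longrightarrow>
       (\<integral>\<omega>. indicator (E i) \<omega> * (\<Prod>j\<in>A - N i. 1 - s * indicator (E j) \<omega>) \<partial>M)
       = prob (E i) * (\<integral>\<omega>. (\<Prod>j\<in>A - N i. 1 - s * indicator (E j) \<omega>) \<partial>M)"
  shows "\<bar>prob (space M - (\<Union>i\<in>A. E i)) - exp (- (\<Sum>i\<in>A. prob (E i)))\<bar>
    \<le> (\<Sum>i\<in>A. \<Sum>j\<in>N i. prob (E i) * prob (E j)) + (\<Sum>i\<in>A. \<Sum>j\<in>N i - {i}. prob (E i \<inter> E j))"
proof -
  define X where "X i \<omega> = (indicator (E i) \<omega> :: real)" for i \<omega>
  define \<Lambda> where "\<Lambda> = (\<Sum>i\<in>A. prob (E i))"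
  define \<delta> where "\<delta> = (\<Sum>i\<in>A. \<Sum>j\<in>N i. prob (E i) * prob (E j)) + (\<Sum>i\<in>A. \<Sum>j\<in>N i - {i}. prob (E i \<inter> E j))"
  define W where "W \<omega> = card {i\<in>A. \<omega> \<in> E i}" for \<omega>
  define P where "P B s \<omega> = (\<Prod>j\<in>B. 1 - s * X j \<omega>)" for B s \<omega>
  define \<psi> where "\<psi> s = (\<integral>\<omega>. P A s \<omega> \<partial>M)" for s
  have X01: "0 \<le> X i \<omega>" "X i \<omega> \<le> 1" for i \<omega> by (auto simp: X_def indicator_def)
  have sX: "0 \<le> s * X i \<omega>" "s * X i \<omega> \<le> 1" if "s \<in> {0..1}" for s i \<omega>
    using that X01[of i \<omega>] by (auto intro: mult_le_one)
  have Xm[measurable]: "i \<in> A \<Longrightarrow> X i \<in> borel_measurable M" for i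
    unfolding X_def using E by measurable
  have Xi: "i \<in> A \<Longrightarrow> integrable M (X i)" for i
    by (rule integrable_const_bound[where B=1]) (use X01 in auto)
  have P01: "0 \<le> P B s \<omega>" "P B s \<omega> \<le> 1" if "s \<in> {0..1}" for B s \<omega>
    unfolding P_def using sX[OF that] by (auto intro!: prod_nonneg prod_le_1)
  have Pm: "P B s \<in> borel_measurable M" if "B \<subseteq> A" for B s
    unfolding P_def using that by (intro borel_measurable_prod) auto
  have Pi: "integrable M (P B s)" if "B \<subseteq> A" "s \<in> {0..1}" for B s
    by (rule integrable_const_bound[where B=1]) (use P01[OF that(2)] Pm[OF that(1)] in auto)
  have XPi: "integrable M (\<lambda>\<omega>. X i \<omega> * P B s \<omega>)" if "i \<in> A" "B \<subseteq> A" "s \<in> {0..1}" for i B s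
    by (rule integrable_const_bound[where B=1])
      (use P01[OF that(3)] X01 Pm[OF that(2)] that(1) in \<open>auto intro!: mult_le_one simp: abs_mult\<close>)
  have EX: "(\<integral>\<omega>. X i \<omega> \<partial>M) = prob (E i)" if "i \<in> A" for i
    using E[OF that] by (simp add: X_def)
  have XX: "(\<integral>\<omega>. X i \<omega> * X j \<omega> \<partial>M) = prob (E i \<inter> E j)" if "i \<in> A" "j \<in> A" for i j
    using E[OF that(1)] E[OF that(2)] by (simp add: X_def flip: indicator_inter_arith)
  have XXi: "integrable M (\<lambda>\<omega>. X i \<omega> * X j \<omega>)" if "i \<in> A" "j \<in> A" for i j
    by (rule integrable_const_bound[where B=1])
      (use X01 that in \<open>auto intro!: mult_le_one simp: abs_mult\<close>)
  have PW: "P A s \<omega> = (1 - s) ^ W \<omega>" for s \<omega>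
  proof -
    have "P A s \<omega> = (\<Prod>j\<in>A. if \<omega> \<in> E j then 1 - s else 1)"
      unfolding P_def X_def by (intro prod.cong) (auto simp: indicator_def)
    also have "\<dots> = (1 - s) ^ W \<omega>"
      using A by (simp add: prod.If_cases W_def Int_def)
    finally show ?thesis .
  qed
  have W_le: "W \<omega> \<le> card A" for \<omega> unfolding W_def using A by (intro card_mono) auto
  have Wm[measurable]: "{\<omega>\<in>space M. W \<omega> = k} \<in> events" for k
  proof -
    have eq: "real (W \<omega>) = (\<Sum>i\<in>A. X i \<omega>)" for \<omega>
      using A by (simp add: W_def X_def indicator_def sum.If_cases Int_def)
    have "{\<omega>\<in>space M. W \<omega> = k} = {\<omega>\<in>space M. (\<Sum>i\<in>A. X i \<omega>) = real k}"
      by (auto simp flip: eq)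
    also have "\<dots> \<in> events" by measurable
    finally show ?thesis .
  qed
  \<comment> \<open>Grouping by the value of \<open>W\<close> turns \<psi> into a polynomial in
    \<open>s\<close>, so it can be differentiated term by term, without differentiating under the
    integral.\<close>
  have expand: "(\<integral>\<omega>. f (W \<omega>) \<partial>M) = (\<Sum>k\<le>card A. f k * prob {\<omega>\<in>space M. W \<omega> = k})" for f :: "nat \<Rightarrow> real"
  proof -
    have "(\<integral>\<omega>. f (W \<omega>) \<partial>M) = (\<integral>\<omega>. (\<Sum>k\<le>card A. f k * indicator {\<omega>\<in>space M. W \<omega> = k} \<omega>) \<partial>M)"
    proof (intro Bochner_Integration.integral_cong refl)
      fix \<omega> assume "\<omega> \<in> space M"
      then have "(\<Sum>k\<le>card A. f k * indicator {\<omega>\<in>space M. W \<omega> = k} \<omega>) = (\<Sum>k\<le>card A. if W \<omega> = k then f k else 0)"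
        by (intro sum.cong) auto
      also have "\<dots> = f (W \<omega>)" using W_le[of \<omega>] by simp
      finally show "f (W \<omega>) = (\<Sum>k\<le>card A. f k * indicator {\<omega>\<in>space M. W \<omega> = k} \<omega>)" by simp
    qed
    also have "\<dots> = (\<Sum>k\<le>card A. f k * prob {\<omega>\<in>space M. W \<omega> = k})"
      by (subst Bochner_Integration.integral_sum) (auto simp: integrable_indicator_iff emeasure_eq_measure)
    finally show ?thesis .
  qed
  \<comment> \<open>The left side is minus the derivative of \<open>(1 - s) ^ W\<close>; for
    \<open>W = 0\<close> the truncated exponent is harmless because of the factor \<open>W\<close>.
    The right side isolates one occurring event at a time, which is the form to which local
    dependence applies.\<close>
  have pathwise: "real (W \<omega>) * (1 - s) ^ (W \<omega> - 1) = (\<Sum>i\<in>A. X i \<omega> * P (A - {i}) s \<omega>)" for s :: real and \<omega>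
  proof -
    have "X i \<omega> * P (A - {i}) s \<omega> = (if \<omega> \<in> E i then (1 - s) ^ (W \<omega> - 1) else 0)" if "i \<in> A" for i
    proof (cases "\<omega> \<in> E i")
      case True
      have "P (A - {i}) s \<omega> = (\<Prod>j\<in>A - {i}. if \<omega> \<in> E j then 1 - s else 1)"
        unfolding P_def X_def by (intro prod.cong) (auto simp: indicator_def)
      also have "\<dots> = (1 - s) ^ card ((A - {i}) \<inter> {j. \<omega> \<in> E j})"
        using A by (simp add: prod.If_cases)
      also have "(A - {i}) \<inter> {j. \<omega> \<in> E j} = {i\<in>A. \<omega> \<in> E i} - {i}" by auto
      also have "card \<dots> = W \<omega> - 1" using that True A by (simp add: W_def)
      finally show ?thesis using True by (simp add: X_def)
    qed (simp add: X_def)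
    then have "(\<Sum>i\<in>A. X i \<omega> * P (A - {i}) s \<omega>) = (\<Sum>i\<in>A. if \<omega> \<in> E i then (1 - s) ^ (W \<omega> - 1) else 0)"
      by simp
    also have "\<dots> = W \<omega> * (1 - s) ^ (W \<omega> - 1)"
      using A by (simp add: sum.If_cases W_def Int_def)
    finally show ?thesis by simp
  qed
  define D where "D s = (\<Sum>i\<in>A. (\<integral>\<omega>. X i \<omega> * P (A - {i}) s \<omega> \<partial>M))" for s
  have psi_deriv: "(\<psi> has_real_derivative - D s) (at s)" if s: "s \<in> {0..1}" for s
  proof -
    have psi_eq: "\<psi> = (\<lambda>s. \<Sum>k\<le>card A. (1 - s) ^ k * prob {\<omega>\<in>space M. W \<omega> = k})"
      unfolding \<psi>_def PW using expand by (intro ext) simp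
    have "(\<psi> has_real_derivative (\<Sum>k\<le>card A. - (real k * (1 - s) ^ (k - 1)) * prob {\<omega>\<in>space M. W \<omega> = k})) (at s)"
      unfolding psi_eq by (auto intro!: derivative_eq_intros sum.cong)
    also have "(\<Sum>k\<le>card A. - (real k * (1 - s) ^ (k - 1)) * prob {\<omega>\<in>space M. W \<omega> = k})
      = - (\<integral>\<omega>. W \<omega> * (1 - s) ^ (W \<omega> - 1) \<partial>M)"
      by (subst expand[of "\<lambda>k. real k * (1 - s) ^ (k - 1)"]) (simp add: sum_negf)
    also have "(\<integral>\<omega>. W \<omega> * (1 - s) ^ (W \<omega> - 1) \<partial>M) = D s"
      unfolding pathwise D_def by (intro Bochner_Integration.integral_sum XPi s) auto
    finally show ?thesis .
  qed
  \<comment> \<open>For each \<open>i\<close>, the factors of the neighbours in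
    \<open>N i - {i}\<close> are removed at the cost of joint probabilities, independence splits
    what is left, and the factors of \<open>N i\<close> are restored at the cost of products of
    probabilities. \<open>T\<close> below is the product over the indices independent of
    \<open>i\<close>.\<close>
  have main: "\<bar>D s - \<Lambda> * \<psi> s\<bar> \<le> \<delta>" if s: "s \<in> {0..1}" for s
  proof -
    have "\<bar>(\<integral>\<omega>. X i \<omega> * P (A - {i}) s \<omega> \<partial>M) - prob (E i) * \<psi> s\<bar>
      \<le> (\<Sum>j\<in>N i. prob (E i) * prob (E j)) + (\<Sum>j\<in>N i - {i}. prob (E i \<inter> E j))" if i: "i \<in> A" for i
    proof -
      note Ni = N[OF i]
      have fN: "finite (N i)" using Ni A finite_subset by blast
      define T where "T = P (A - N i) s"
      have Tm: "integrable M T" "T \<in> borel_measurable M" unfolding T_def using Pi s Pm by auto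
      have T01: "0 \<le> T \<omega>" "T \<omega> \<le> 1" for \<omega> using P01[OF s] by (auto simp: T_def)
      have split1: "P (A - {i}) s \<omega> = T \<omega> * P (N i - {i}) s \<omega>" for \<omega>
      proof -
        have "A - {i} = (A - N i) \<union> (N i - {i})" using Ni by auto
        then have "P (A - {i}) s \<omega> = P ((A - N i) \<union> (N i - {i})) s \<omega>" by simp
        also have "\<dots> = T \<omega> * P (N i - {i}) s \<omega>"
          unfolding T_def P_def using A fN by (intro prod.union_disjoint) auto
        finally show ?thesis .
      qed
      have split2: "P A s \<omega> = T \<omega> * P (N i) s \<omega>" for \<omega>
      proof -
        have "A = (A - N i) \<union> N i" using Ni by auto
        then have "P A s \<omega> = P ((A - N i) \<union> N i) s \<omega>" by simp
        also have "\<dots> = T \<omega> * P (N i) s \<omega>"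
          unfolding T_def P_def using A fN by (intro prod.union_disjoint) auto
        finally show ?thesis .
      qed
      have bd: "1 - P B s \<omega> \<le> (\<Sum>j\<in>B. X j \<omega>)" if "B \<subseteq> A" for B \<omega>
      proof -
        have "1 - P B s \<omega> \<le> (\<Sum>j\<in>B. s * X j \<omega>)"
          unfolding P_def using sX[OF s] finite_subset[OF that A] by (intro one_minus_prod_le_sum) auto
        also have "\<dots> \<le> (\<Sum>j\<in>B. X j \<omega>)"
          using s X01 by (intro sum_mono mult_left_le_one_le) auto
        finally show ?thesis .
      qed
      have NiA: "N i - {i} \<subseteq> A" "N i \<subseteq> A" using Ni by auto
      have a1: "\<bar>(\<integral>\<omega>. X i \<omega> * P (A - {i}) s \<omega> \<partial>M) - (\<integral>\<omega>. X i \<omega> * T \<omega> \<partial>M)\<bar> \<le> (\<Sum>j\<in>N i - {i}. prob (E i \<inter> E j))"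
      proof -
        have "\<bar>(\<integral>\<omega>. X i \<omega> * P (A - {i}) s \<omega> \<partial>M) - (\<integral>\<omega>. X i \<omega> * T \<omega> \<partial>M)\<bar>
          = \<bar>(\<integral>\<omega>. X i \<omega> * P (A - {i}) s \<omega> - X i \<omega> * T \<omega> \<partial>M)\<bar>"
          unfolding T_def by (subst Bochner_Integration.integral_diff) (auto intro!: XPi i s)
        also have "\<dots> \<le> (\<integral>\<omega>. \<bar>X i \<omega> * P (A - {i}) s \<omega> - X i \<omega> * T \<omega>\<bar> \<partial>M)"
          by (rule integral_abs_bound)
        also have "\<dots> \<le> (\<integral>\<omega>. (\<Sum>j\<in>N i - {i}. X i \<omega> * X j \<omega>) \<partial>M)"
        proof (rule integral_mono)
          show "integrable M (\<lambda>\<omega>. \<bar>X i \<omega> * P (A - {i}) s \<omega> - X i \<omega> * T \<omega>\<bar>)"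
            unfolding T_def by (intro integrable_abs Bochner_Integration.integrable_diff XPi i s) auto
          show "integrable M (\<lambda>\<omega>. \<Sum>j\<in>N i - {i}. X i \<omega> * X j \<omega>)"
            using NiA by (intro Bochner_Integration.integrable_sum XXi i) auto
          fix \<omega>
          have "\<bar>X i \<omega> * P (A - {i}) s \<omega> - X i \<omega> * T \<omega>\<bar> = X i \<omega> * (T \<omega> * (1 - P (N i - {i}) s \<omega>))"
          proof -
            have "X i \<omega> * P (A - {i}) s \<omega> - X i \<omega> * T \<omega> = - (X i \<omega> * (T \<omega> * (1 - P (N i - {i}) s \<omega>)))"
              by (simp add: split1 algebra_simps)
            moreover have "0 \<le> X i \<omega> * (T \<omega> * (1 - P (N i - {i}) s \<omega>))"
              using X01 T01 P01[OF s] by simp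
            ultimately show ?thesis by simp
          qed
          also have "\<dots> \<le> X i \<omega> * (1 * (\<Sum>j\<in>N i - {i}. X j \<omega>))"
            using X01 T01 P01[OF s] bd[OF NiA(1)] by (intro mult_left_mono mult_mono) auto
          finally show "\<bar>X i \<omega> * P (A - {i}) s \<omega> - X i \<omega> * T \<omega>\<bar> \<le> (\<Sum>j\<in>N i - {i}. X i \<omega> * X j \<omega>)"
            by (simp add: sum_distrib_left)
        qed
        also have "\<dots> = (\<Sum>j\<in>N i - {i}. prob (E i \<inter> E j))"
          using NiA i by (subst Bochner_Integration.integral_sum) (auto intro!: XXi sum.cong XX)
        finally show ?thesis .
      qed
      have a2: "\<bar>(\<integral>\<omega>. T \<omega> \<partial>M) - \<psi> s\<bar> \<le> (\<Sum>j\<in>N i. prob (E j))"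
      proof -
        have "\<bar>(\<integral>\<omega>. T \<omega> \<partial>M) - \<psi> s\<bar> = \<bar>\<integral>\<omega>. T \<omega> - P A s \<omega> \<partial>M\<bar>"
          unfolding \<psi>_def by (subst Bochner_Integration.integral_diff) (auto intro!: Pi s Tm)
        also have "\<dots> \<le> (\<integral>\<omega>. \<bar>T \<omega> - P A s \<omega>\<bar> \<partial>M)" by (rule integral_abs_bound)
        also have "\<dots> \<le> (\<integral>\<omega>. (\<Sum>j\<in>N i. X j \<omega>) \<partial>M)"
        proof (rule integral_mono)
          show "integrable M (\<lambda>\<omega>. \<bar>T \<omega> - P A s \<omega>\<bar>)"
            by (intro integrable_abs Bochner_Integration.integrable_diff Tm Pi s) auto
          show "integrable M (\<lambda>\<omega>. \<Sum>j\<in>N i. X j \<omega>)"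
            using NiA by (intro Bochner_Integration.integrable_sum Xi) auto
          fix \<omega>
          have "\<bar>T \<omega> - P A s \<omega>\<bar> = T \<omega> * (1 - P (N i) s \<omega>)"
            using T01[of \<omega>] P01[OF s, of "N i" \<omega>] by (simp add: split2 abs_mult mult_left_le algebra_simps)
          also have "\<dots> \<le> 1 * (\<Sum>j\<in>N i. X j \<omega>)"
            using X01 T01 P01[OF s] bd[OF NiA(2)] by (intro mult_mono) auto
          finally show "\<bar>T \<omega> - P A s \<omega>\<bar> \<le> (\<Sum>j\<in>N i. X j \<omega>)" by simp
        qed
        also have "\<dots> = (\<Sum>j\<in>N i. prob (E j))"
          using NiA by (subst Bochner_Integration.integral_sum) (auto intro!: Xi sum.cong EX)
        finally show ?thesis .
      qed
      have a3: "(\<integral>\<omega>. X i \<omega> * T \<omega> \<partial>M) = prob (E i) * (\<integral>\<omega>. T \<omega> \<partial>M)"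
        unfolding T_def P_def X_def by (rule indep[OF i s])
      have "\<bar>prob (E i) * (\<integral>\<omega>. T \<omega> \<partial>M) - prob (E i) * \<psi> s\<bar> \<le> prob (E i) * (\<Sum>j\<in>N i. prob (E j))"
        using a2 by (simp add: abs_mult mult_left_mono flip: right_diff_distrib)
      with a1 a3 show ?thesis by (simp add: sum_distrib_left)
    qed
    then have "(\<Sum>i\<in>A. \<bar>(\<integral>\<omega>. X i \<omega> * P (A - {i}) s \<omega> \<partial>M) - prob (E i) * \<psi> s\<bar>) \<le> \<delta>"
      unfolding \<delta>_def by (subst sum.distrib[symmetric]) (rule sum_mono)
    moreover have "D s - \<Lambda> * \<psi> s = (\<Sum>i\<in>A. (\<integral>\<omega>. X i \<omega> * P (A - {i}) s \<omega> \<partial>M) - prob (E i) * \<psi> s)"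
      by (simp add: D_def \<Lambda>_def sum_subtractf sum_distrib_right)
    ultimately show ?thesis using sum_abs[of "\<lambda>i. (\<integral>\<omega>. X i \<omega> * P (A - {i}) s \<omega> \<partial>M) - prob (E i) * \<psi> s" A]
      by linarith
  qed
  have \<Lambda>0: "\<Lambda> \<ge> 0" unfolding \<Lambda>_def by (simp add: sum_nonneg)
  \<comment> \<open>The integrating factor \<open>exp (\<Lambda> * s)\<close> removes the main term
    of the differential equation, leaving only the error
    \<open>\<Lambda> * \<psi> z - D z\<close>.\<close>
  have "\<exists>z>0::real. z < 1 \<and> exp (\<Lambda> * 1) * \<psi> 1 - exp (\<Lambda> * 0) * \<psi> 0 = (1 - 0) * (exp (\<Lambda> * z) * (\<Lambda> * \<psi> z - D z))"
    by (rule MVT2) (auto intro!: derivative_eq_intros psi_deriv simp: algebra_simps)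
  then obtain z where z: "0 < z" "z < 1" "exp \<Lambda> * \<psi> 1 - \<psi> 0 = exp (\<Lambda> * z) * (\<Lambda> * \<psi> z - D z)" by auto
  have psi0: "\<psi> 0 = 1" by (simp add: \<psi>_def P_def prob_space)
  have UE: "(\<Union>i\<in>A. E i) \<in> events" using A E by auto
  have psi1: "\<psi> 1 = prob (space M - (\<Union>i\<in>A. E i))"
  proof -
    have "\<psi> 1 = (\<integral>\<omega>. indicator (space M - (\<Union>i\<in>A. E i)) \<omega> \<partial>M)"
      unfolding \<psi>_def PW using A
      by (intro Bochner_Integration.integral_cong) (auto simp: W_def indicator_def power_0_left)
    then show ?thesis using UE by simp
  qed
  have "\<bar>exp \<Lambda> * \<psi> 1 - 1\<bar> \<le> exp \<Lambda> * \<delta>"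
  proof -
    have "\<bar>exp \<Lambda> * \<psi> 1 - 1\<bar> = exp (\<Lambda> * z) * \<bar>D z - \<Lambda> * \<psi> z\<bar>"
      using z psi0 by (simp add: abs_mult abs_minus_commute)
    also have "\<dots> \<le> exp \<Lambda> * \<delta>"
      using main[of z] z \<Lambda>0 by (intro mult_mono) (auto simp: mult_left_le)
    finally show ?thesis .
  qed
  then have "exp (-\<Lambda>) * \<bar>exp \<Lambda> * \<psi> 1 - 1\<bar> \<le> exp (-\<Lambda>) * (exp \<Lambda> * \<delta>)"
    by (intro mult_left_mono) auto
  moreover have "exp (-\<Lambda>) * \<bar>exp \<Lambda> * \<psi> 1 - 1\<bar> = \<bar>exp (-\<Lambda>) * (exp \<Lambda> * \<psi> 1 - 1)\<bar>"
    by (simp add: abs_mult)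
  moreover have "exp (-\<Lambda>) * (exp \<Lambda> * \<psi> 1 - 1) = \<psi> 1 - exp (-\<Lambda>)"
    by (simp add: right_diff_distrib mult.assoc[symmetric] flip: exp_add)
  moreover have "exp (-\<Lambda>) * (exp \<Lambda> * \<delta>) = \<delta>"
    by (simp add: mult.assoc[symmetric] flip: exp_add)
  ultimately show ?thesis unfolding psi1[symmetric] \<Lambda>_def[symmetric] \<delta>_def[symmetric] by simp
qed

subsection \<open>Positive definite quadratic forms\<close>

definition quad_form :: "nat \<Rightarrow> (nat \<Rightarrow> nat \<Rightarrow> real) \<Rightarrow> (nat \<Rightarrow> real) \<Rightarrow> real" where
  "quad_form k a v = (\<Sum>i<k. \<Sum>j<k. a i j * v i * v j)"

definition pos_def_form :: "nat \<Rightarrow> (nat \<Rightarrow> nat \<Rightarrow> real) \<Rightarrow> bool" where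
  "pos_def_form k a \<longleftrightarrow> (\<forall>i<k. \<forall>j<k. a i j = a j i) \<and>
    (\<forall>v. (\<exists>i<k. v i \<noteq> 0) \<longrightarrow> 0 < quad_form k a v)"

lemma quad_form_add_scaled:
  assumes "\<And>i j. i < k \<Longrightarrow> j < k \<Longrightarrow> a i j = a j i"
  shows "quad_form k a (\<lambda>i. v i + s * w i)
    = quad_form k a v + 2 * s * (\<Sum>i<k. w i * (\<Sum>j<k. a i j * v j)) + s\<^sup>2 * quad_form k a w"
proof -
  have sw: "(\<Sum>i<k. \<Sum>j<k. a i j * v i * w j) = (\<Sum>i<k. \<Sum>j<k. a i j * w i * v j)"
    by (subst sum.swap) (auto intro!: sum.cong simp: assms)
  have "quad_form k a (\<lambda>i. v i + s * w i)
    = (\<Sum>i<k. \<Sum>j<k. a i j * v i * v j + s * (a i j * v i * w j) + s * (a i j * w i * v j) + s\<^sup>2 * (a i j * w i * w j))"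
    unfolding quad_form_def by (intro sum.cong refl) (simp add: algebra_simps power2_eq_square)
  also have "\<dots> = quad_form k a v + s * (\<Sum>i<k. \<Sum>j<k. a i j * v i * w j)
      + s * (\<Sum>i<k. \<Sum>j<k. a i j * w i * v j) + s\<^sup>2 * quad_form k a w"
    by (simp add: sum.distrib sum_distrib_left quad_form_def)
  also have "(\<Sum>i<k. \<Sum>j<k. a i j * w i * v j) = (\<Sum>i<k. w i * (\<Sum>j<k. a i j * v j))"
    by (simp add: sum_distrib_left mult_ac)
  finally show ?thesis unfolding sw by (simp add: sum_distrib_left mult_ac)
qed

text \<open>A zero \<open>v\<close> of a semidefinite form is a minimum of it, so the gradient,
  twice \<open>w = a v\<close>, must vanish: moving from \<open>v\<close> slightly against
  \<open>w\<close> would otherwise make the form negative. Then \<open>v\<close> lies in the kernel,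
  which is excluded by the determinant.\<close>

lemma psd_nonsingular_imp_pos_def:
  assumes sym: "\<And>i j. i < k \<Longrightarrow> j < k \<Longrightarrow> a i j = a j i"
    and psd: "\<And>v. 0 \<le> quad_form k a v"
    and det: "Determinant.det (Matrix.mat k k (\<lambda>(i, j). a i j)) \<noteq> 0"
  shows "pos_def_form k a"
proof (rule ccontr)
  assume "\<not> pos_def_form k a"
  then obtain v i where v: "i < k" "v i \<noteq> 0" and "\<not> 0 < quad_form k a v"
    using sym unfolding pos_def_form_def by blast
  with psd[of v] have q0: "quad_form k a v = 0" by linarith
  define w where "w i = (\<Sum>j<k. a i j * v j)" for i
  define S where "S = (\<Sum>i<k. w i * w i)"
  have S0: "S \<ge> 0" unfolding S_def by (intro sum_nonneg) auto
  have ineq: "0 \<le> 2 * s * S + s\<^sup>2 * quad_form k a w" for s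
    using psd[of "\<lambda>i. v i + s * w i"] quad_form_add_scaled[OF sym, where v = v and s = s and w = w] q0
    by (simp add: S_def w_def)
  have "S = 0"
  proof (rule ccontr)
    assume "S \<noteq> 0"
    with S0 have Sp: "S > 0" by simp
    \<comment> \<open>The minimiser of \<open>2 * s * S + s^2 * (quad_form k a w + 1)\<close>; the
      added 1 keeps the denominator positive when the form vanishes at \<open>w\<close>.\<close>
    define s where "s = - (S / (quad_form k a w + 1))"
    have Q: "quad_form k a w + 1 > 0" using psd[of w] by linarith
    have "2 * s * S + s\<^sup>2 * quad_form k a w \<le> 2 * s * S + s\<^sup>2 * (quad_form k a w + 1)"
      by (intro add_left_mono mult_left_mono) auto
    also have "\<dots> = - (S\<^sup>2 / (quad_form k a w + 1))"
    proof -
      have "2 * - (S / c) * S + (- (S / c))\<^sup>2 * c = - (S\<^sup>2 / c)" if "c > 0" for c :: real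
        using that by (simp add: field_simps power2_eq_square)
      from this[OF Q] show ?thesis unfolding s_def .
    qed
    also have "\<dots> < 0" using Sp Q by simp
    finally show False using ineq[of s] by simp
  qed
  then have w0: "w i = 0" if "i < k" for i
    using that unfolding S_def by (subst (asm) sum_nonneg_eq_0_iff) auto
  let ?A = "Matrix.mat k k (\<lambda>(i, j). a i j)"
  have "?A *\<^sub>v Matrix.vec k v = 0\<^sub>v k"
  proof (rule eq_vecI)
    fix i assume "i < dim_vec (0\<^sub>v k)"
    then have i: "i < k" by simp
    then have "vec_index (?A *\<^sub>v Matrix.vec k v) i = (\<Sum>j<k. a i j * v j)"
      by (simp add: scalar_prod_def atLeast0LessThan)
    then show "vec_index (?A *\<^sub>v Matrix.vec k v) i = vec_index (0\<^sub>v k) i" using w0[OF i] i by (simp add: w_def)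
  qed simp
  moreover have "Matrix.vec k v \<noteq> 0\<^sub>v k"
    using v by (metis index_vec index_zero_vec(1))
  ultimately have "Determinant.det ?A = 0"
    by (subst det_0_iff_vec_prod_zero[of _ k]) (auto intro!: exI[of _ "Matrix.vec k v"])
  with det show False by simp
qed

lemma sum_Suc_split:
  fixes f :: "nat \<Rightarrow> nat \<Rightarrow> real"
  shows "(\<Sum>i<Suc k. \<Sum>j<Suc k. f i j) = (\<Sum>i<k. \<Sum>j<k. f i j) + (\<Sum>i<k. f i k) + (\<Sum>j<k. f k j) + f k k"
  by (simp add: sum.distrib)

text \<open>Elimination of the last variable: the Schur complement of the last pivot is again
  positive definite, and the induction continues on it. The factorisation \<open>L^T D L\<close>
  with unit lower triangular \<open>L\<close> serves the determinant, the coercivity bound and the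
  volume of the ellipsoid alike.\<close>

lemma LDL_decomposition:
  assumes "pos_def_form k a"
  shows "\<exists>L d. (\<forall>i. L i i = 1) \<and> (\<forall>i j. i < j \<longrightarrow> L i j = 0) \<and> (\<forall>i<k. d i > 0) \<and>
    (\<forall>i<k. \<forall>j<k. a i j = (\<Sum>l<k. d l * L l i * L l j))"
  using assms
proof (induction k arbitrary: a)
    case 0
    show ?case by (intro exI[of _ "\<lambda>i j. if i = j then 1 else 0"] exI[of _ "\<lambda>_. 1"]) auto
  next
    case (Suc k a)
    have sym: "a i j = a j i" if "i \<le> k" "j \<le> k" for i j
      using Suc.prems that by (simp add: pos_def_form_def)
    have pd: "0 < quad_form (Suc k) a v" if "i \<le> k" "v i \<noteq> 0" for v i
      using Suc.prems that unfolding pos_def_form_def by (metis less_Suc_eq_le)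
    have akk: "a k k > 0"
    proof -
      have "quad_form (Suc k) a (\<lambda>i. if i = k then 1 else 0) = a k k"
        unfolding quad_form_def sum_Suc_split by simp
      then show ?thesis using pd[of k "\<lambda>i. if i = k then 1 else 0"] by simp
    qed
    define a' where "a' i j = a i j - a i k * a j k / a k k" for i j
    have schur: "0 < quad_form k a' v" if "i < k" "v i \<noteq> 0" for v i
    proof -
      define b where "b = (\<Sum>j<k. a j k * v j)"
      \<comment> \<open>The last coordinate minimises the form when the others are fixed to
        \<open>v\<close>; the minimal value is the Schur complement form at
        \<open>v\<close>.\<close>
      define u where "u = (\<lambda>j. if j < k then v j else - b / a k k)"
      have e1: "(\<Sum>i<k. a i k * u i * u k) = b * u k"
        unfolding b_def sum_distrib_right by (intro sum.cong) (auto simp: u_def)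
      have e2: "(\<Sum>j<k. a k j * u k * u j) = b * u k"
        unfolding b_def sum_distrib_right by (intro sum.cong) (auto simp: u_def sym)
      have e3: "(\<Sum>i<k. \<Sum>j<k. a i j * u i * u j) = quad_form k a v"
        unfolding quad_form_def by (intro sum.cong) (auto simp: u_def)
      have e4: "quad_form k a' v = quad_form k a v - b\<^sup>2 / a k k"
      proof -
        have "quad_form k a' v = (\<Sum>i<k. \<Sum>j<k. a i j * v i * v j - (a i k * v i) * (a j k * v j) / a k k)"
          unfolding quad_form_def a'_def by (intro sum.cong) (auto simp: algebra_simps)
        also have "\<dots> = quad_form k a v - (\<Sum>i<k. \<Sum>j<k. (a i k * v i) * (a j k * v j)) / a k k"
          by (simp add: sum_subtractf quad_form_def flip: sum_divide_distrib)
        also have "(\<Sum>i<k. \<Sum>j<k. (a i k * v i) * (a j k * v j)) = b\<^sup>2"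
          unfolding b_def power2_eq_square sum_product by simp
        finally show ?thesis .
      qed
      have "0 < quad_form (Suc k) a u" using pd[of i u] that by (simp add: u_def)
      also have "quad_form (Suc k) a u = quad_form k a v + 2 * b * u k + a k k * u k * u k"
        unfolding quad_form_def sum_Suc_split e1 e2 e3[unfolded quad_form_def] by simp
      also have "\<dots> = quad_form k a' v"
        unfolding e4 using akk by (simp add: u_def power2_eq_square field_simps)
      finally show ?thesis .
    qed
    have "\<exists>L d. (\<forall>i. L i i = 1) \<and> (\<forall>i j. i < j \<longrightarrow> L i j = 0) \<and> (\<forall>i<k. d i > 0) \<and>
      (\<forall>i<k. \<forall>j<k. a' i j = (\<Sum>l<k. d l * L l i * L l j))"
    proof (rule Suc.IH)
      have "a' i j = a' j i" if "i < k" "j < k" for i j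
        using that sym[of i j] by (simp add: a'_def)
      with schur show "pos_def_form k a'" unfolding pos_def_form_def by blast
    qed
    then obtain L d where L: "\<And>i. L i i = 1" "\<And>i j. i < j \<Longrightarrow> L i j = 0" "\<And>i. i < k \<Longrightarrow> d i > 0"
      "\<And>i j. i < k \<Longrightarrow> j < k \<Longrightarrow> a' i j = (\<Sum>l<k. d l * L l i * L l j)" by blast
    \<comment> \<open>The new row is row \<open>k\<close> of \<open>a\<close> divided by its pivot.
      It is set to 0 beyond the diagonal since triangularity is required for all indices, not only
      those below the dimension.\<close>
    define L' where "L' l j = (if l = k then (if j \<le> k then a k j / a k k else 0) else L l j)" for l j
    define d' where "d' l = (if l = k then a k k else d l)" for l
    have old: "(\<Sum>l<k. d' l * L' l i * L' l j) = (\<Sum>l<k. d l * L l i * L l j)" for i j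
      by (intro sum.cong) (auto simp: d'_def L'_def)
    have lastk: "(\<Sum>l<k. d l * L l i * L l k) = 0" "(\<Sum>l<k. d l * L l k * L l i) = 0" for i
      using L(2) by auto
    have "a i j = (\<Sum>l<Suc k. d' l * L' l i * L' l j)" if "i < Suc k" "j < Suc k" for i j
    proof -
      have "(\<Sum>l<Suc k. d' l * L' l i * L' l j)
        = (\<Sum>l<k. d l * L l i * L l j) + a k k * (a k i / a k k) * (a k j / a k k)"
        using that by (simp add: old) (simp add: d'_def L'_def)
      also have "\<dots> = a i j"
      proof (cases "i = k \<or> j = k")
        case True
        then show ?thesis using akk sym[of i j] that lastk by auto
      next
        case False
        then have "i < k" "j < k" using that by auto
        then show ?thesis using L(4)[of i j] sym[of i k] sym[of j k] akk
          by (simp add: a'_def field_simps)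
      qed
      finally show ?thesis by simp
    qed
    moreover have "L' i i = 1" "i < j \<Longrightarrow> L' i j = 0" "i < Suc k \<Longrightarrow> d' i > 0" for i j
      using L akk by (auto simp: L'_def d'_def less_Suc_eq)
    ultimately show ?case by blast
qed

lemma det_LDL:
  assumes "\<And>i. L i i = 1" "\<And>i j. i < j \<Longrightarrow> L i j = 0"
    and a: "\<And>i j. i < k \<Longrightarrow> j < k \<Longrightarrow> a i j = (\<Sum>l<k. d l * L l i * L l j)"
  shows "Determinant.det (Matrix.mat k k (\<lambda>(i, j). a i j)) = (\<Prod>l<k. d l :: real)"
proof -
  let ?L = "Matrix.mat k k (\<lambda>(i, j). L i j)"
  let ?M = "Matrix.mat k k (\<lambda>(i, j). d i * L i j)"
  have eq: "Matrix.mat k k (\<lambda>(i, j). a i j) = transpose_mat ?L * ?M"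
    by (rule eq_matI) (auto simp: scalar_prod_def a atLeast0LessThan mult_ac intro!: sum.cong)
  have "Determinant.det ?L = 1" "Determinant.det ?M = (\<Prod>l<k. d l)"
    using assms(1,2)
    by (subst det_lower_triangular[where n = k]; force simp: prod_list_diag_prod atLeast0LessThan)+
  then show ?thesis
    unfolding eq by (subst det_mult[where n = k]) (auto simp: det_transpose[where n = k])
qed

lemma quad_form_LDL:
  assumes "\<And>i j. i < k \<Longrightarrow> j < k \<Longrightarrow> a i j = (\<Sum>l<k. d l * L l i * L l j)"
  shows "quad_form k a v = (\<Sum>l<k. d l * (\<Sum>j<k. L l j * v j)\<^sup>2)"
proof -
  have "quad_form k a v = (\<Sum>i<k. \<Sum>j<k. \<Sum>l<k. d l * ((L l i * v i) * (L l j * v j)))"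
    unfolding quad_form_def by (intro sum.cong refl) (auto simp: assms sum_distrib_right sum_distrib_left mult_ac)
  also have "\<dots> = (\<Sum>l<k. \<Sum>i<k. \<Sum>j<k. d l * ((L l i * v i) * (L l j * v j)))"
    by (subst sum.swap[of _ "{..<k}" "{..<k}"], subst (2) sum.swap) (rule refl)
  also have "\<dots> = (\<Sum>l<k. d l * (\<Sum>j<k. L l j * v j)\<^sup>2)"
    unfolding power2_eq_square sum_product by (simp add: sum_distrib_left)
  finally show ?thesis .
qed

text \<open>Forward substitution: coordinate \<open>i\<close> is row \<open>i\<close> of
  \<open>L v\<close> minus a combination of earlier coordinates, which are already bounded.\<close>

lemma unit_lower_triangular_coercive:
  fixes L :: "nat \<Rightarrow> nat \<Rightarrow> real"
  assumes "\<And>i. L i i = 1" "\<And>i j. i < j \<Longrightarrow> L i j = (0::real)" "i < k"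
  shows "\<exists>C>0. \<forall>v. \<bar>v i\<bar> \<le> C * (\<Sum>l<k. \<bar>\<Sum>j<k. L l j * v j\<bar>)"
  using assms(3)
proof (induction i rule: less_induct)
  case (less i)
  then have "\<forall>j\<in>{..<i}. \<exists>C>0. \<forall>v. \<bar>v j\<bar> \<le> C * (\<Sum>l<k. \<bar>\<Sum>j<k. L l j * v j\<bar>)" by auto
  then obtain C where C: "\<And>j. j < i \<Longrightarrow> C j > 0"
    "\<And>j v. j < i \<Longrightarrow> \<bar>v j\<bar> \<le> C j * (\<Sum>l<k. \<bar>\<Sum>j<k. L l j * v j\<bar>)"
    by (auto dest!: bchoice)
  define K where "K = 1 + (\<Sum>j<i. \<bar>L i j\<bar> * C j)"
  have K: "K > 0" unfolding K_def using C(1) by (intro add_pos_nonneg sum_nonneg mult_nonneg_nonneg) (auto simp: less_imp_le)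
  have "\<bar>v i\<bar> \<le> K * (\<Sum>l<k. \<bar>\<Sum>j<k. L l j * v j\<bar>)" (is "_ \<le> K * ?Y") for v
  proof -
    have "(\<Sum>j<k. L i j * v j) = (\<Sum>j\<in>insert i {..<i}. L i j * v j)"
      using less.prems assms(2) by (intro sum.mono_neutral_right) (auto simp: not_less)
    also have "\<dots> = v i + (\<Sum>j<i. L i j * v j)" using assms(1) by simp
    finally have "v i = (\<Sum>j<k. L i j * v j) - (\<Sum>j<i. L i j * v j)" by simp
    then have "\<bar>v i\<bar> \<le> \<bar>\<Sum>j<k. L i j * v j\<bar> + \<bar>\<Sum>j<i. L i j * v j\<bar>" by linarith
    also have "\<bar>\<Sum>j<k. L i j * v j\<bar> \<le> ?Y"
      using less.prems by (intro member_le_sum[where f = "\<lambda>l. \<bar>\<Sum>j<k. L l j * v j\<bar>"]) auto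
    also have "\<bar>\<Sum>j<i. L i j * v j\<bar> \<le> (\<Sum>j<i. \<bar>L i j\<bar> * (C j * ?Y))"
      by (rule order.trans[OF sum_abs]) (auto intro!: sum_mono mult_left_mono C simp: abs_mult)
    also have "?Y + (\<Sum>j<i. \<bar>L i j\<bar> * (C j * ?Y)) = K * ?Y"
    proof -
      have "Y + (\<Sum>j<i. \<bar>L i j\<bar> * (C j * Y)) = K * Y" for Y
        unfolding K_def by (simp add: distrib_right sum_distrib_right mult.assoc)
      then show ?thesis .
    qed
    finally show ?thesis by simp
  qed
  with K show ?case by blast
qed

text \<open>In the coordinates \<open>L v\<close> the form is a weighted sum of squares with
  positive weights, and \<open>L v\<close> controls every coordinate of \<open>v\<close>.\<close>

lemma pos_def_form_coercive:
  assumes "pos_def_form k a"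
  obtains c where "c > 0" "\<And>v i. i < k \<Longrightarrow> c * (v i)\<^sup>2 \<le> quad_form k a v"
proof -
  obtain L d where L: "\<And>i. L i i = 1" "\<And>i j. i < j \<Longrightarrow> L i j = 0" "\<And>i. i < k \<Longrightarrow> d i > 0"
    "\<And>i j. i < k \<Longrightarrow> j < k \<Longrightarrow> a i j = (\<Sum>l<k. d l * L l i * L l j)"
    using LDL_decomposition[OF assms] by blast
  have "\<exists>C. \<forall>i<k. C i > 0 \<and> (\<forall>v. \<bar>v i\<bar> \<le> C i * (\<Sum>l<k. \<bar>\<Sum>j<k. L l j * v j\<bar>))"
    using unit_lower_triangular_coercive[of L _ k, OF L(1,2)] by metis
  then obtain C where C: "\<And>i. i < k \<Longrightarrow> C i > 0"
    "\<And>i v. i < k \<Longrightarrow> \<bar>v i\<bar> \<le> C i * (\<Sum>l<k. \<bar>\<Sum>j<k. L l j * v j\<bar>)" by blast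
  \<comment> \<open>The product of the truncated pivots lies below each single pivot;
    \<open>real k + 1\<close> absorbs the Cauchy-Schwarz factor and the last denominator absorbs the
    squared constant \<open>C i\<close>. The summands 1 keep both denominators positive.\<close>
  define c where "c = (\<Prod>i<k. min 1 (d i)) / (real k + 1) / (1 + (\<Sum>i<k. (C i)\<^sup>2))"
  have S0: "0 \<le> (\<Sum>i<k. (C i)\<^sup>2)" by (intro sum_nonneg) auto
  have P0: "0 < (\<Prod>i<k. min 1 (d i))" using L(3) by (intro prod_pos) auto
  have c: "c > 0" unfolding c_def using S0 P0 by (intro divide_pos_pos) auto
  have "c * (v i)\<^sup>2 \<le> quad_form k a v" if i: "i < k" for v i
  proof -
    define y where "y l = (\<Sum>j<k. L l j * v j)" for l
    have dl: "(\<Prod>i<k. min 1 (d i)) \<le> d l" if "l < k" for l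
    proof -
      have "(\<Prod>i<k. min 1 (d i)) = min 1 (d l) * (\<Prod>i\<in>{..<k} - {l}. min 1 (d i))"
        using that by (intro prod.remove) auto
      also have "\<dots> \<le> min 1 (d l) * 1"
        using L(3) that by (intro mult_left_mono prod_le_1) (auto simp: less_imp_le)
      finally show ?thesis by simp
    qed
    have "(v i)\<^sup>2 \<le> (C i * (\<Sum>l<k. \<bar>y l\<bar>))\<^sup>2"
      using power_mono[OF C(2)[OF i, of v], of 2] by (simp add: y_def)
    also have "\<dots> = (C i)\<^sup>2 * (\<Sum>l<k. \<bar>y l\<bar> * 1)\<^sup>2" by (simp add: power_mult_distrib)
    also have "\<dots> \<le> (C i)\<^sup>2 * ((\<Sum>l<k. \<bar>y l\<bar>\<^sup>2) * (\<Sum>l<k. 1\<^sup>2))"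
      by (intro mult_left_mono Cauchy_Schwarz_ineq_sum) auto
    also have "\<dots> \<le> (1 + (\<Sum>i<k. (C i)\<^sup>2)) * ((\<Sum>l<k. \<bar>y l\<bar>\<^sup>2) * (real k + 1))"
    proof (rule mult_mono)
      show "(C i)\<^sup>2 \<le> 1 + (\<Sum>i<k. (C i)\<^sup>2)"
        using member_le_sum[of i "{..<k}" "\<lambda>i. (C i)\<^sup>2"] i by simp
      show "(\<Sum>l<k. \<bar>y l\<bar>\<^sup>2) * (\<Sum>l<k. 1\<^sup>2) \<le> (\<Sum>l<k. \<bar>y l\<bar>\<^sup>2) * (real k + 1)"
        by (intro mult_left_mono sum_nonneg) auto
    qed (use S0 in \<open>auto intro!: sum_nonneg mult_nonneg_nonneg\<close>)
    finally have "c * (v i)\<^sup>2 \<le> c * ((1 + (\<Sum>i<k. (C i)\<^sup>2)) * ((\<Sum>l<k. \<bar>y l\<bar>\<^sup>2) * (real k + 1)))"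
      using c by (intro mult_left_mono) auto
    also have "\<dots> = (\<Prod>i<k. min 1 (d i)) * (\<Sum>l<k. (y l)\<^sup>2)"
    proof -
      have "a / K / N * (N * (Y * K)) = a * Y" if "K > 0" "N > 0" for a K N Y :: real
        using that by simp
      then show ?thesis unfolding c_def using S0 by simp
    qed
    also have "\<dots> \<le> (\<Sum>l<k. d l * (y l)\<^sup>2)"
      unfolding sum_distrib_left using dl by (intro sum_mono mult_right_mono) auto
    also have "\<dots> = quad_form k a v"
      unfolding y_def by (rule quad_form_LDL[OF L(4), symmetric])
    finally show ?thesis .
  qed
  with c show thesis using that by blast
qed

subsection \<open>Product Lebesgue measure and ellipsoids\<close>

lemma PiM_density_const:
  fixes f :: "'a \<Rightarrow> ennreal"
  assumes "sigma_finite_measure M" "sigma_finite_measure (density M f)" "finite I"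
    and [measurable]: "f \<in> borel_measurable M"
  shows "PiM I (\<lambda>_. density M f) = density (PiM I (\<lambda>_. M)) (\<lambda>x. \<Prod>i\<in>I. f (x i))"
proof -
  interpret M: product_sigma_finite "\<lambda>_. M" by (rule product_sigma_finite.intro) fact
  interpret D: product_sigma_finite "\<lambda>_. density M f" by (rule product_sigma_finite.intro) fact
  have m[measurable]: "(\<lambda>x. \<Prod>i\<in>I. f (x i)) \<in> borel_measurable (PiM I (\<lambda>_. M))"
    by (intro borel_measurable_prod_ennreal) measurable
  show ?thesis
  proof (rule D.PiM_eqI[symmetric])
    fix A assume A: "\<And>i. i \<in> I \<Longrightarrow> A i \<in> sets (density M f)"
    then have A': "\<And>i. i \<in> I \<Longrightarrow> A i \<in> sets M" by simp
    have "emeasure (density (PiM I (\<lambda>_. M)) (\<lambda>x. \<Prod>i\<in>I. f (x i))) (Pi\<^sub>E I A)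
      = (\<integral>\<^sup>+x. (\<Prod>i\<in>I. f (x i)) * indicator (Pi\<^sub>E I A) x \<partial>PiM I (\<lambda>_. M))"
      using A' assms(3) by (subst emeasure_density) (auto intro!: sets_PiM_I_finite)
    also have "\<dots> = (\<integral>\<^sup>+x. (\<Prod>i\<in>I. f (x i) * indicator (A i) (x i)) \<partial>PiM I (\<lambda>_. M))"
    proof (intro nn_integral_cong)
      fix x assume "x \<in> space (PiM I (\<lambda>_. M))"
      then have "indicator (Pi\<^sub>E I A) x = (\<Prod>i\<in>I. indicator (A i) (x i) :: ennreal)"
        using assms(3) by (cases "x \<in> Pi\<^sub>E I A")
          (auto simp: space_PiM PiE_iff indicator_def intro!: prod_zero[symmetric])
      then show "(\<Prod>i\<in>I. f (x i)) * indicator (Pi\<^sub>E I A) x = (\<Prod>i\<in>I. f (x i) * indicator (A i) (x i))"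
        by (simp add: prod.distrib)
    qed
    also have "\<dots> = (\<Prod>i\<in>I. \<integral>\<^sup>+y. f y * indicator (A i) y \<partial>M)"
      using A' assms(3) by (intro M.product_nn_integral_prod) auto
    also have "\<dots> = (\<Prod>i\<in>I. emeasure (density M f) (A i))"
      using A' by (intro prod.cong refl) (simp add: emeasure_density)
    finally show "emeasure (density (PiM I (\<lambda>_. M)) (\<lambda>x. \<Prod>i\<in>I. f (x i))) (Pi\<^sub>E I A)
      = (\<Prod>i\<in>I. emeasure (density M f) (A i))" .
  qed (use assms(3) in \<open>auto intro!: sets_PiM_cong simp: sets_density\<close>)
qed

text \<open>Rectangles pull back to rectangles, and these determine the product measure. Serves both
  the affine rescaling of Lebesgue measure and the rotation of the circle.\<close>

lemma distr_PiM_coordinatewise: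
  assumes "product_sigma_finite M" "product_sigma_finite (\<lambda>i. distr (M i) (N i) (\<phi> i))" "finite I"
    and [measurable]: "\<And>i. \<phi> i \<in> measurable (M i) (N i)"
  shows "distr (PiM I M) (PiM I N) (\<lambda>x. \<lambda>i\<in>I. \<phi> i (x i)) = PiM I (\<lambda>i. distr (M i) (N i) (\<phi> i))"
proof -
  interpret M: product_sigma_finite M by fact
  interpret D: product_sigma_finite "\<lambda>i. distr (M i) (N i) (\<phi> i)" by fact
  have m[measurable]: "(\<lambda>x. \<lambda>i\<in>I. \<phi> i (x i)) \<in> measurable (PiM I M) (PiM I N)"
    by (intro measurable_restrict) measurable
  show ?thesis
  proof (rule D.PiM_eqI)
    fix A assume "\<And>i. i \<in> I \<Longrightarrow> A i \<in> sets (distr (M i) (N i) (\<phi> i))"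
    then have A: "\<And>i. i \<in> I \<Longrightarrow> A i \<in> sets (N i)" by simp
    have "emeasure (distr (PiM I M) (PiM I N) (\<lambda>x. \<lambda>i\<in>I. \<phi> i (x i))) (Pi\<^sub>E I A)
      = emeasure (PiM I M) ((\<lambda>x. \<lambda>i\<in>I. \<phi> i (x i)) -` Pi\<^sub>E I A \<inter> space (PiM I M))"
      using A assms(3) by (subst emeasure_distr) (auto intro!: sets_PiM_I_finite)
    also have "(\<lambda>x. \<lambda>i\<in>I. \<phi> i (x i)) -` Pi\<^sub>E I A \<inter> space (PiM I M) = Pi\<^sub>E I (\<lambda>i. \<phi> i -` A i \<inter> space (M i))"
      by (auto simp: space_PiM PiE_iff)
    also have "emeasure (PiM I M) \<dots> = (\<Prod>i\<in>I. emeasure (distr (M i) (N i) (\<phi> i)) (A i))"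
      using A assms(3) by (subst M.emeasure_PiM) (auto intro!: prod.cong simp: emeasure_distr)
    finally show "emeasure (distr (PiM I M) (PiM I N) (\<lambda>x. \<lambda>i\<in>I. \<phi> i (x i))) (Pi\<^sub>E I A)
      = (\<Prod>i\<in>I. emeasure (distr (M i) (N i) (\<phi> i)) (A i))" .
  qed (use assms(3) in \<open>auto intro!: sets_PiM_cong\<close>)
qed

lemma distr_PiM_bij:
  assumes "sigma_finite_measure M" "finite I" and \<sigma>: "bij_betw \<sigma> I J"
  shows "distr (PiM J (\<lambda>_. M)) (PiM I (\<lambda>_. M)) (\<lambda>x. \<lambda>i\<in>I. x (\<sigma> i)) = PiM I (\<lambda>_. M)"
proof -
  interpret M: product_sigma_finite "\<lambda>_. M" by (rule product_sigma_finite.intro) fact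
  have fJ: "finite J" using assms(2) \<sigma> bij_betw_finite by blast
  have m[measurable]: "(\<lambda>x. \<lambda>i\<in>I. x (\<sigma> i)) \<in> measurable (PiM J (\<lambda>_. M)) (PiM I (\<lambda>_. M))"
    using \<sigma> by (intro measurable_restrict measurable_component_singleton) (auto simp: bij_betw_def)
  show ?thesis
  proof (rule M.PiM_eqI)
    fix A assume A: "\<And>i. i \<in> I \<Longrightarrow> A i \<in> sets M"
    have inv: "the_inv_into I \<sigma> (\<sigma> i) = i" if "i \<in> I" for i
      using \<sigma> that by (simp add: bij_betw_def the_inv_into_f_f)
    have J: "J = \<sigma> ` I" using \<sigma> by (simp add: bij_betw_def)
    have "emeasure (distr (PiM J (\<lambda>_. M)) (PiM I (\<lambda>_. M)) (\<lambda>x. \<lambda>i\<in>I. x (\<sigma> i))) (Pi\<^sub>E I A)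
      = emeasure (PiM J (\<lambda>_. M)) ((\<lambda>x. \<lambda>i\<in>I. x (\<sigma> i)) -` Pi\<^sub>E I A \<inter> space (PiM J (\<lambda>_. M)))"
      using A assms(2) by (subst emeasure_distr) (auto intro!: sets_PiM_I_finite)
    also have "(\<lambda>x. \<lambda>i\<in>I. x (\<sigma> i)) -` Pi\<^sub>E I A \<inter> space (PiM J (\<lambda>_. M)) = Pi\<^sub>E J (\<lambda>j. A (the_inv_into I \<sigma> j))"
      using A[THEN sets.sets_into_space] by (auto simp: space_PiM PiE_iff J inv) blast+
    also have "emeasure (PiM J (\<lambda>_. M)) \<dots> = (\<Prod>j\<in>J. emeasure M (A (the_inv_into I \<sigma> j)))"
      using A fJ by (subst M.emeasure_PiM) (auto simp: J inv)
    also have "\<dots> = (\<Prod>i\<in>I. emeasure M (A i))"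
      using prod.reindex_bij_betw[OF \<sigma>, of "\<lambda>j. emeasure M (A (the_inv_into I \<sigma> j))"]
      by (simp add: inv cong: prod.cong)
    finally show "emeasure (distr (PiM J (\<lambda>_. M)) (PiM I (\<lambda>_. M)) (\<lambda>x. \<lambda>i\<in>I. x (\<sigma> i))) (Pi\<^sub>E I A)
      = (\<Prod>i\<in>I. emeasure M (A i))" .
  qed (use assms(2) in auto)
qed

lemma measurable_PiM_lborel_component:
  "i \<in> I \<Longrightarrow> (\<lambda>x. x i :: real) \<in> borel_measurable (PiM I (\<lambda>_. lborel))"
  using measurable_component_singleton[of i I "\<lambda>_. lborel :: real measure"] by simp

interpretation lborel_prod: product_sigma_finite "\<lambda>_. lborel :: real measure"
  by standard

lemma distr_lborel_affine:
  assumes "c \<noteq> (0::real)"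
  shows "distr lborel borel (\<lambda>x. t + c * x) = density lborel (\<lambda>_. ennreal (1 / \<bar>c\<bar>))"
proof -
  have "density lborel (\<lambda>_. ennreal (1 / \<bar>c\<bar>))
    = density (density (distr lborel borel (\<lambda>x. t + c * x)) (\<lambda>_. ennreal \<bar>c\<bar>)) (\<lambda>_. ennreal (1 / \<bar>c\<bar>))"
    by (subst lborel_real_affine[OF assms, of t]) simp
  also have "\<dots> = distr lborel borel (\<lambda>x. t + c * x)"
    using assms by (subst density_density_eq) (auto simp: density_1 simp flip: ennreal_mult)
  finally show ?thesis by simp
qed

lemma distr_PiM_lborel_affine:
  assumes "finite I" "\<And>i. c i \<noteq> (0::real)"
  shows "distr (PiM I (\<lambda>_. lborel)) (PiM I (\<lambda>_. lborel)) (\<lambda>x. \<lambda>i\<in>I. t i + c i * x i)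
    = density (PiM I (\<lambda>_. lborel)) (\<lambda>_. \<Prod>i\<in>I. ennreal (1 / \<bar>c i\<bar>))"
    (is "?L = ?R")
proof -
  let ?D = "\<lambda>i. distr lborel lborel (\<lambda>x. t i + c i * x)"
  have D: "?D i = density lborel (\<lambda>_. ennreal (1 / \<bar>c i\<bar>))" for i
  proof -
    have "?D i = distr lborel borel (\<lambda>x. t i + c i * x)" by (intro distr_cong) auto
    then show ?thesis by (simp add: distr_lborel_affine assms)
  qed
  have sf: "sigma_finite_measure (?D i)" for i
    unfolding D by (subst sigma_finite_measure.sigma_finite_iff_density_finite) (auto intro: sigma_finite_lborel)
  interpret D: product_sigma_finite ?D by (rule product_sigma_finite.intro) (rule sf)
  have "?L = PiM I ?D"
    by (rule distr_PiM_coordinatewise)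
      (use assms in \<open>auto intro!: lborel_prod.product_sigma_finite_axioms D.product_sigma_finite_axioms\<close>)
  also have "\<dots> = ?R"
  proof (rule D.PiM_eqI[symmetric])
    fix A assume "\<And>i. i \<in> I \<Longrightarrow> A i \<in> sets (?D i)"
    then have A: "\<And>i. i \<in> I \<Longrightarrow> A i \<in> sets lborel" by simp
    show "emeasure ?R (Pi\<^sub>E I A) = (\<Prod>i\<in>I. emeasure (?D i) (A i))"
      unfolding D using A assms(1)
      by (subst emeasure_density_const)
        (auto intro!: sets_PiM_I_finite simp: lborel_prod.emeasure_PiM emeasure_density_const prod.distrib)
  qed (use assms in \<open>auto intro!: sets_PiM_cong\<close>)
  finally show ?thesis .
qed

lemma nn_integral_PiM_lborel_affine:
  assumes "finite I" "s > 0" and [measurable]: "f \<in> borel_measurable (PiM I (\<lambda>_. lborel))"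
  shows "(\<integral>\<^sup>+x. f x \<partial>PiM I (\<lambda>_. lborel))
    = ennreal (s ^ card I) * (\<integral>\<^sup>+x. f (\<lambda>i\<in>I. t i + s * x i) \<partial>PiM I (\<lambda>_. lborel))"
proof -
  have m: "(\<lambda>x. \<lambda>i\<in>I. t i + s * x i) \<in> measurable (PiM I (\<lambda>_. lborel)) (PiM I (\<lambda>_. lborel))"
    by (intro measurable_restrict) simp
  have "(\<integral>\<^sup>+x. f (\<lambda>i\<in>I. t i + s * x i) \<partial>PiM I (\<lambda>_. lborel))
    = (\<integral>\<^sup>+x. f x \<partial>distr (PiM I (\<lambda>_. lborel)) (PiM I (\<lambda>_. lborel)) (\<lambda>x. \<lambda>i\<in>I. t i + s * x i))"
    using m by (simp add: nn_integral_distr)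
  also have "\<dots> = (\<Prod>i\<in>I. ennreal (1 / \<bar>s\<bar>)) * (\<integral>\<^sup>+x. f x \<partial>PiM I (\<lambda>_. lborel))"
    using assms by (subst distr_PiM_lborel_affine[of I "\<lambda>_. s" t]) (auto simp: nn_integral_density nn_integral_cmult)
  finally show ?thesis
    using assms(2) by (simp add: mult.assoc[symmetric] ennreal_power power_divide flip: ennreal_mult)
qed

text \<open>Integrating the last coordinate first, its shift depends only on the earlier
  coordinates, so for fixed values of these it is a translation; the rest is the induction
  hypothesis for the partially integrated function.\<close>

lemma nn_integral_PiM_lborel_shear:
  fixes L :: "nat \<Rightarrow> nat \<Rightarrow> real"
  assumes "f \<in> borel_measurable (PiM {..<k} (\<lambda>_. lborel))"
  shows "(\<integral>\<^sup>+x. f (\<lambda>i\<in>{..<k}. x i + (\<Sum>j<i. L i j * x j)) \<partial>PiM {..<k} (\<lambda>_. lborel))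
    = (\<integral>\<^sup>+x. f x \<partial>PiM {..<k} (\<lambda>_. lborel))"
  using assms
proof (induction k arbitrary: f)
  case 0
  show ?case by (intro nn_integral_cong) (auto simp: space_PiM)
next
  case (Suc k f)
  define T where "T k x = (\<lambda>i\<in>{..<k}. x i + (\<Sum>j<i. L i j * x j))" for k and x :: "nat \<Rightarrow> real"
  let ?P = "\<lambda>k. PiM {..<k} (\<lambda>_. lborel :: real measure)"
  have ins: "{..<Suc k} = insert k {..<k}" by auto
  have Tm[measurable]: "T n \<in> measurable (?P n) (?P n)" for n
    unfolding T_def
  proof (intro measurable_restrict)
    fix i assume "i \<in> {..<n}"
    then show "(\<lambda>x. x i + (\<Sum>j<i. L i j * x j)) \<in> measurable (?P n) lborel"
      by (auto intro!: borel_measurable_add borel_measurable_sum borel_measurable_times measurable_PiM_lborel_component)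
  qed
  note fm[measurable] = Suc.prems
  have um: "(\<lambda>(x, y). x(k := y)) \<in> measurable (?P k \<Otimes>\<^sub>M lborel) (?P (Suc k))"
    unfolding ins by (rule measurable_add_dim)
  have Fm: "(\<lambda>x. \<integral>\<^sup>+y. f (x(k := y)) \<partial>lborel) \<in> borel_measurable (?P k)"
    using measurable_compose[OF um fm]
    by (intro lborel.borel_measurable_nn_integral) (simp add: case_prod_unfold fun_upd_def)
  have "(\<integral>\<^sup>+x. f (T (Suc k) x) \<partial>?P (Suc k)) = (\<integral>\<^sup>+x. \<integral>\<^sup>+y. f (T (Suc k) (x(k := y))) \<partial>lborel \<partial>?P k)"
    unfolding ins using measurable_compose[OF Tm fm]
    by (intro lborel_prod.product_nn_integral_insert) (auto simp: ins)
  also have "\<dots> = (\<integral>\<^sup>+x. \<integral>\<^sup>+y. f ((T k x)(k := y)) \<partial>lborel \<partial>?P k)"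
  proof (rule nn_integral_cong)
    fix x assume x: "x \<in> space (?P k)"
    have "T (Suc k) (x(k := y)) = (T k x)(k := (\<Sum>j<k. L k j * x j) + 1 * y)" for y
      by (auto simp: T_def fun_eq_iff less_Suc_eq intro!: sum.cong)
    moreover have "(\<lambda>y. f ((T k x)(k := y))) \<in> borel_measurable lborel"
      using measurable_compose[OF measurable_Pair1'[OF measurable_space[OF Tm x]] measurable_compose[OF um fm]] by (simp add: fun_upd_def)
    ultimately show "(\<integral>\<^sup>+y. f (T (Suc k) (x(k := y))) \<partial>lborel) = (\<integral>\<^sup>+y. f ((T k x)(k := y)) \<partial>lborel)"
      using nn_integral_real_affine[of "\<lambda>y. f ((T k x)(k := y))" 1 "\<Sum>j<k. L k j * x j"] by simp
  qed
  also have "\<dots> = (\<integral>\<^sup>+x. \<integral>\<^sup>+y. f (x(k := y)) \<partial>lborel \<partial>?P k)"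
    using Suc.IH[OF Fm] unfolding T_def .
  also have "\<dots> = (\<integral>\<^sup>+x. f x \<partial>?P (Suc k))"
    unfolding ins using fm
    by (intro lborel_prod.product_nn_integral_insert[symmetric]) (auto simp: ins)
  finally show ?case unfolding T_def .
qed

lemma measurable_quad_form:
  "quad_form k a \<in> borel_measurable (PiM {..<k} (\<lambda>_. lborel))"
  unfolding quad_form_def
  by (auto intro!: borel_measurable_add borel_measurable_sum borel_measurable_times measurable_PiM_lborel_component)

lemma pos_def_form_det_pos:
  assumes "pos_def_form k a"
  shows "Determinant.det (Matrix.mat k k (\<lambda>(i, j). a i j)) > 0"
proof -
  obtain L d where L: "\<And>i. L i i = 1" "\<And>i j. i < j \<Longrightarrow> L i j = 0" "\<And>i. i < k \<Longrightarrow> d i > 0"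
    "\<And>i j. i < k \<Longrightarrow> j < k \<Longrightarrow> a i j = (\<Sum>l<k. d l * L l i * L l j)"
    using LDL_decomposition[OF assms(1)] by blast
  show ?thesis unfolding det_LDL[of L k a d, OF L(1,2,4), simplified] using L(3) by (intro prod_pos) auto
qed

text \<open>The factorisation maps the ellipsoid onto a ball by a shear \<open>T\<close>, which
  preserves volume, followed by a diagonal scaling \<open>S\<close> by the square roots of the
  pivots, whose product is the square root of the determinant.\<close>

lemma emeasure_ellipsoid:
  assumes "pos_def_form k a" "r > 0"
  shows "emeasure (PiM {..<k} (\<lambda>_. lborel)) {v \<in> space (PiM {..<k} (\<lambda>_. lborel)). quad_form k a v \<le> r}
    = ennreal (unit_ball_vol k * sqrt r ^ k / sqrt (Determinant.det (Matrix.mat k k (\<lambda>(i, j). a i j))))"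
proof -
  let ?P = "PiM {..<k} (\<lambda>_. lborel :: real measure)"
  obtain L d where L: "\<And>i. L i i = 1" "\<And>i j. i < j \<Longrightarrow> L i j = 0" "\<And>i. i < k \<Longrightarrow> d i > 0"
    "\<And>i j. i < k \<Longrightarrow> j < k \<Longrightarrow> a i j = (\<Sum>l<k. d l * L l i * L l j)"
    using LDL_decomposition[OF assms(1)] by blast
  define T where "T x = (\<lambda>i\<in>{..<k}. x i + (\<Sum>j<i. L i j * x j))" for x
  \<comment> \<open>The value 1 beyond the dimension is a default: the affine change of variables
    asks for nonzero scales at every index.\<close>
  define e where "e i = (if i < k then sqrt (d i) else 1)" for i
  define S where "S x = (\<lambda>i\<in>{..<k}. 0 + e i * x i)" for x
  define B where "B = {y. sqrt (\<Sum>i<k. (y i)\<^sup>2) \<le> sqrt r} \<inter> space ?P"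
  have e0: "e i \<noteq> 0" "\<bar>e i\<bar> = e i" "e i > 0" for i using L(3)[of i] by (auto simp: e_def)
  have Sm: "S \<in> measurable ?P ?P"
    unfolding S_def by (intro measurable_restrict) (auto intro!: borel_measurable_add borel_measurable_times measurable_PiM_lborel_component)
  have sqm: "(\<lambda>y. sqrt (\<Sum>i<k. (y i)\<^sup>2)) \<in> borel_measurable ?P"
    by (intro borel_measurable_sum borel_measurable_power measurable_PiM_lborel_component
      measurable_compose[OF _ borel_measurable_continuous_onI[of sqrt]]) (auto intro: continuous_intros)
  have Bm: "B \<in> sets ?P"
  proof -
    have "B = {y \<in> space ?P. sqrt (\<Sum>i<k. (y i)\<^sup>2) \<le> sqrt r}" by (auto simp: B_def)
    also have "\<dots> \<in> sets ?P" by (intro borel_measurable_le sqm borel_measurable_const)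
    finally show ?thesis .
  qed
  have spT: "T x \<in> space ?P" "S x \<in> space ?P" for x
    by (auto simp: T_def S_def space_PiM)
  have SmB: "S -` B \<inter> space ?P \<in> sets ?P" using Sm Bm by (rule measurable_sets)
  have q: "quad_form k a v \<le> r \<longleftrightarrow> S (T v) \<in> B" for v
  proof -
    have "(\<Sum>j<k. L l j * v j) = T v l" if "l < k" for l
    proof -
      have "(\<Sum>j<k. L l j * v j) = (\<Sum>j\<in>insert l {..<l}. L l j * v j)"
        using that L(2) by (intro sum.mono_neutral_right) (auto simp: not_less)
      then show ?thesis using L(1) that by (simp add: T_def)
    qed
    then have "quad_form k a v = (\<Sum>l<k. d l * (T v l)\<^sup>2)"
      by (subst quad_form_LDL[OF L(4)]) auto
    also have "\<dots> = (\<Sum>l<k. (S (T v) l)\<^sup>2)"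
      by (intro sum.cong) (auto simp: S_def e_def power_mult_distrib L(3) less_imp_le)
    finally show ?thesis using spT by (simp add: B_def)
  qed
  have "emeasure ?P {v \<in> space ?P. quad_form k a v \<le> r} = (\<integral>\<^sup>+v. indicator {v \<in> space ?P. quad_form k a v \<le> r} v \<partial>?P)"
    by (intro nn_integral_indicator[symmetric] borel_measurable_le measurable_quad_form borel_measurable_const)
  also have "\<dots> = (\<integral>\<^sup>+v. indicator (S -` B \<inter> space ?P) (T v) \<partial>?P)"
    by (intro nn_integral_cong) (auto simp: indicator_def q spT)
  also have "\<dots> = (\<integral>\<^sup>+v. indicator (S -` B \<inter> space ?P) v \<partial>?P)"
    unfolding T_def using SmB by (intro nn_integral_PiM_lborel_shear) auto
  also have "\<dots> = emeasure (distr ?P ?P S) B"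
    using SmB Sm Bm by (simp add: emeasure_distr)
  also have "\<dots> = (\<Prod>i<k. ennreal (1 / e i)) * emeasure ?P B"
    unfolding S_def using Bm e0 by (subst distr_PiM_lborel_affine) (auto simp: emeasure_density_const)
  also have "emeasure ?P B = ennreal (unit_ball_vol k * sqrt r ^ k)"
    unfolding B_def using emeasure_cball_aux[of "{..<k}" "sqrt r"] assms(2) by simp
  also have "(\<Prod>i<k. ennreal (1 / e i)) = ennreal (\<Prod>i<k. 1 / e i)"
    using e0(3) by (intro prod_ennreal) (simp add: less_imp_le)
  also have "(\<Prod>i<k. 1 / e i) = 1 / sqrt (\<Prod>i<k. d i)"
  proof -
    have "(\<Prod>i<k. 1 / e i) = 1 / (\<Prod>i<k. sqrt (d i))"
      by (simp add: prod_dividef e_def)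
    also have "(\<Prod>i<k. sqrt (d i)) = sqrt (\<Prod>i<k. d i)"
      by (induction k) (auto simp: real_sqrt_mult)
    finally show ?thesis .
  qed
  also have "(\<Prod>i<k. d i) = Determinant.det (Matrix.mat k k (\<lambda>(i, j). a i j))"
    using det_LDL[of L k a d, OF L(1,2,4)] by simp
  finally show ?thesis
    using assms(2) pos_def_form_det_pos[OF assms(1)]
    by (subst (asm) ennreal_mult[symmetric]) (auto intro!: mult_nonneg_nonneg unit_ball_vol_nonneg)
qed

text \<open>The boundary lies in every shell between the levels \<open>s < r\<close> and
  \<open>r\<close>, and the volume is continuous in the level. This gives almost everywhere
  convergence of the indicators of rescaled hits.\<close>

lemma ellipsoid_boundary_null:
  assumes "pos_def_form k a" "r > 0"
  shows "{v \<in> space (PiM {..<k} (\<lambda>_. lborel)). quad_form k a v = r} \<in> null_sets (PiM {..<k} (\<lambda>_. lborel))"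
proof -
  let ?P = "PiM {..<k} (\<lambda>_. lborel :: real measure)"
  define E where "E r = {v \<in> space ?P. quad_form k a v \<le> r}" for r
  define C where "C = unit_ball_vol k / sqrt (Determinant.det (Matrix.mat k k (\<lambda>(i, j). a i j)))"
  have Em: "E r \<in> sets ?P" for r
    unfolding E_def by (intro borel_measurable_le measurable_quad_form borel_measurable_const)
  have Bm: "{v \<in> space ?P. quad_form k a v = r} \<in> sets ?P"
    by (intro borel_measurable_eq measurable_quad_form borel_measurable_const)
  have C0: "C \<ge> 0" unfolding C_def using pos_def_form_det_pos[OF assms(1)] by simp
  have vol: "emeasure ?P (E s) = ennreal (C * sqrt s ^ k)" if "s > 0" for s
    unfolding E_def C_def using emeasure_ellipsoid[OF assms(1) that] by simp
  have le: "emeasure ?P {v \<in> space ?P. quad_form k a v = r} \<le> ennreal (C * sqrt r ^ k - C * sqrt s ^ k)"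
    if "0 < s" "s < r" for s
  proof -
    have "emeasure ?P {v \<in> space ?P. quad_form k a v = r} \<le> emeasure ?P (E r - E s)"
      using that Em by (intro emeasure_mono) (auto simp: E_def)
    also have "\<dots> = emeasure ?P (E r) - emeasure ?P (E s)"
      using that Em vol by (intro emeasure_Diff) (auto simp: E_def)
    also have "\<dots> = ennreal (C * sqrt r ^ k - C * sqrt s ^ k)"
      using that C0 assms(2) by (simp add: vol ennreal_minus)
    finally show ?thesis .
  qed
  have lim: "((\<lambda>s. ennreal (C * sqrt r ^ k - C * sqrt s ^ k)) \<longlongrightarrow> ennreal (C * sqrt r ^ k - C * sqrt r ^ k)) (at_left r)"
    by (intro tendsto_intros)
  have "emeasure ?P {v \<in> space ?P. quad_form k a v = r} \<le> ennreal (C * sqrt r ^ k - C * sqrt r ^ k)"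
    by (rule tendsto_lowerbound[OF lim])
      (use assms(2) le in \<open>auto simp: eventually_at_left intro!: exI[of _ 0]\<close>)
  then show ?thesis using Bm by (auto simp: null_sets_def)
qed

subsection \<open>The statistic as a function of angles\<close>

lemma Arg2pi_cis: "0 \<le> x \<Longrightarrow> x < 2 * pi \<Longrightarrow> Arg2pi (cis x) = x"
  by (rule Arg2pi_unique[of 1]) (auto simp: cis_conv_exp)

lemma cis_Arg2pi: "norm z = 1 \<Longrightarrow> cis (Arg2pi z) = z"
  using complex_norm_eq_1_exp[of z] by (simp add: cis_conv_exp)

section \<open>Sums over pairs of indices and cyclic distances\<close>

lemma sum_pairs_symmetric:
  fixes h :: "nat \<Rightarrow> nat \<Rightarrow> real"
  assumes "\<And>i j. h i j = h j i"
  shows "(\<Sum>j<m. \<Sum>i<j. h i j) = (\<Sum>j<m. \<Sum>i\<in>{..<m} - {j}. h i j) / 2"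
proof (induction m)
  case (Suc m)
  have "{..<Suc m} - {j} = insert m ({..<m} - {j})" if "j < m" for j using that by auto
  then have "(\<Sum>j<m. \<Sum>i\<in>{..<Suc m} - {j}. h i j) = (\<Sum>j<m. (\<Sum>i\<in>{..<m} - {j}. h i j) + h m j)"
    by (intro sum.cong) auto
  also have "\<dots> = (\<Sum>j<m. \<Sum>i\<in>{..<m} - {j}. h i j) + (\<Sum>j<m. h j m)"
    using assms by (simp add: sum.distrib)
  moreover have "{..<Suc m} - {m} = {..<m}" by auto
  ultimately show ?case using Suc by simp
qed simp

lemma sum_pairs_permute:
  fixes h :: "nat \<Rightarrow> nat \<Rightarrow> real"
  assumes h: "\<And>i j. h i j = h j i" and \<sigma>: "bij_betw \<sigma> {..<m} {..<m}"
  shows "(\<Sum>j<m. \<Sum>i<j. h (\<sigma> i) (\<sigma> j)) = (\<Sum>j<m. \<Sum>i<j. h i j)"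
proof -
  have "(\<Sum>j<m. \<Sum>i\<in>{..<m} - {j}. h (\<sigma> i) (\<sigma> j)) = (\<Sum>j<m. \<Sum>i\<in>{..<m} - {\<sigma> j}. h i (\<sigma> j))"
  proof (rule sum.cong)
    fix j assume j: "j \<in> {..<m}"
    have "bij_betw \<sigma> ({..<m} - {j}) ({..<m} - {\<sigma> j})"
      using bij_betw_DiffI[OF \<sigma>, of "{j}" "{\<sigma> j}"] bij_betw_apply[OF \<sigma> j] j by auto
    then show "(\<Sum>i\<in>{..<m} - {j}. h (\<sigma> i) (\<sigma> j)) = (\<Sum>i\<in>{..<m} - {\<sigma> j}. h i (\<sigma> j))"
      by (rule sum.reindex_bij_betw)
  qed simp
  also have "\<dots> = (\<Sum>j<m. \<Sum>i\<in>{..<m} - {j}. h i j)"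
    by (rule sum.reindex_bij_betw[OF \<sigma>])
  finally show ?thesis
    using sum_pairs_symmetric[of h m, OF h] sum_pairs_symmetric[of "\<lambda>i j. h (\<sigma> i) (\<sigma> j)" m, OF h]
    by linarith
qed

text \<open>Indices left of \<open>j\<close> contribute the distances 1 to \<open>j\<close>; those
  on the right contribute distances that the reflection \<open>s\<close> to \<open>m - s\<close>
  sends onto \<open>j + 1\<close> to \<open>m - 1\<close>. So every vertex of the polygon sees the
  same distances. Applied to the values of \<open>g\<close> and to its second derivatives.\<close>

lemma sum_cyclic_distances:
  fixes c :: "nat \<Rightarrow> real"
  assumes c: "\<And>s. s \<in> {1..<m} \<Longrightarrow> c (m - s) = c s" and j: "j < m"
  shows "(\<Sum>i\<in>{..<m} - {j}. c (if i < j then j - i else i - j)) = (\<Sum>s = 1..m - 1. c s)"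
proof -
  have split: "{..<m} - {j} = {..<j} \<union> {Suc j..<m}" using j by auto
  have "(\<Sum>i\<in>{..<m} - {j}. c (if i < j then j - i else i - j))
    = (\<Sum>i<j. c (j - i)) + (\<Sum>i = Suc j..<m. c (i - j))"
    unfolding split by (subst sum.union_disjoint) (auto intro!: sum.cong arg_cong2[where f = "(+)"])
  also have "(\<Sum>i<j. c (j - i)) = (\<Sum>s = 1..j. c s)"
    by (rule sum.reindex_bij_witness[of _ "\<lambda>s. j - s" "\<lambda>i. j - i"]) auto
  also have "(\<Sum>i = Suc j..<m. c (i - j)) = (\<Sum>s = Suc j..m - 1. c s)"
  proof (rule sum.reindex_bij_witness[of _ "\<lambda>s. m + j - s" "\<lambda>i. m + j - i"])
    fix i assume i: "i \<in> {Suc j..<m}"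
    have "m - (i - j) = m + j - i" using i by auto
    then show "c (m + j - i) = c (i - j)" using c[of "i - j"] i by (simp add: Suc_le_eq less_imp_diff_less)
  qed (use j in auto)
  also have "(\<Sum>s = 1..j. c s) + (\<Sum>s = Suc j..m - 1. c s) = (\<Sum>s\<in>{1..j} \<union> {Suc j..m - 1}. c s)"
    by (rule sum.union_disjoint[symmetric]) auto
  also have "{1..j} \<union> {Suc j..m - 1} = {1..m - 1}" using j by auto
  finally show ?thesis .
qed

text \<open>The \<open>2\<pi>\<close>-periodic even extension of \<open>g\<close> restricted to \<open>[0, 2\<pi>]\<close>.\<close>

definition circ :: "(real \<Rightarrow> real) \<Rightarrow> real \<Rightarrow> real" where
  "circ g x = g (arccos (cos x))"

definition angle_sum :: "nat \<Rightarrow> (real \<Rightarrow> real) \<Rightarrow> (nat \<Rightarrow> real) \<Rightarrow> real" where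
  "angle_sum m g x = (\<Sum>j<m. \<Sum>i<j. circ g (x j - x i))"

text \<open>The deficit of a tuple of angles from the value at a regular polygon. In the sequel the angles
  are indexed from \<open>0\<close>, and \<open>0\<close> is the root that carries the rotation.\<close>

definition gap :: "nat \<Rightarrow> (real \<Rightarrow> real) \<Rightarrow> (nat \<Rightarrow> real) \<Rightarrow> real" where
  "gap m g x = 1 / 2 * (\<Sum>s = 1..m - 1. real m * g (2 * pi * real s / real m)) - angle_sum m g x"

definition vertex :: "nat \<Rightarrow> nat \<Rightarrow> real" where
  "vertex m i = 2 * pi * real i / real m"

lemma circ_cong: "cos x = cos y \<Longrightarrow> circ g x = circ g y"
  by (simp add: circ_def)

lemma circ_minus: "circ g (x - y) = circ g (y - x)"
  by (rule circ_cong) (metis cos_minus minus_diff_eq)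

lemma angle_sum_translate: "angle_sum m g (\<lambda>i. c + x i) = angle_sum m g x"
  by (simp add: angle_sum_def)

lemma angle_sum_cong: "(\<And>i. i < m \<Longrightarrow> cis (x i) = cis (y i)) \<Longrightarrow> angle_sum m g x = angle_sum m g y"
proof -
  assume eq: "\<And>i. i < m \<Longrightarrow> cis (x i) = cis (y i)"
  have "cos (x j - x i) = cos (y j - y i)" if "i < m" "j < m" for i j
    using eq[OF that(1)] eq[OF that(2)] by (simp add: cos_diff complex_eq_iff)
  then show ?thesis unfolding angle_sum_def by (intro sum.cong refl circ_cong) auto
qed

lemma angle_sum_permute: "bij_betw \<sigma> {..<m} {..<m} \<Longrightarrow> angle_sum m g (\<lambda>i. x (\<sigma> i)) = angle_sum m g x"
  unfolding angle_sum_def by (rule sum_pairs_permute[of "\<lambda>i j. circ g (x j - x i)"]) (rule circ_minus)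

lemma gap_cong: "(\<And>i. i < m \<Longrightarrow> x i = y i) \<Longrightarrow> gap m g x = gap m g y"
  unfolding gap_def using angle_sum_cong[of m x y g] by simp

section \<open>The deficit at regular polygons and the description of its zeros\<close>

locale polygon_kernel =
  fixes m :: nat and g :: "real \<Rightarrow> real"
  assumes m_ge_2: "m \<ge> 2"
    and cont: "continuous_on {0..2 * pi} g"
    and smooth: "\<forall>s\<in>{1..m - 1}. \<exists>N. open N \<and> N \<subseteq> {0..2 * pi} \<and> 2 * pi * real s / real m \<in> N
           \<and> cont_diff_on 3 g N"
    and symm: "\<forall>x\<in>{0..2 * pi}. g x = g (2 * pi - x)"
    and max_only: "max_only_at_regular_polygons m (pair_sum m g)"
    and det_ne: "Determinant.det (hess_mat m g) \<noteq> 0"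
begin

lemma m_pos: "0 < m" using m_ge_2 by simp

lemma vertex_bounds: "i < m \<Longrightarrow> 0 \<le> vertex m i" "i < m \<Longrightarrow> vertex m i < 2 * pi"
  by (auto simp: vertex_def field_simps)

text \<open>\<open>arccos (cos x)\<close> folds the interval at \<pi>, and the symmetry of
  \<open>g\<close> undoes the fold.\<close>

lemma circ_eq: "0 \<le> x \<Longrightarrow> x \<le> 2 * pi \<Longrightarrow> circ g x = g x"
proof (cases "x \<le> pi")
  case False
  assume x: "0 \<le> x" "x \<le> 2 * pi"
  have "arccos (cos x) = arccos (cos (2 * pi - x))" by (simp add: cos_diff)
  also have "\<dots> = 2 * pi - x" using x False by (intro arccos_cos) auto
  finally show ?thesis using symm[rule_format, of x] x by (simp add: circ_def)
qed (simp add: circ_def arccos_cos)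

lemma continuous_circ: "continuous_on UNIV (circ g)"
proof -
  have "continuous_on UNIV (\<lambda>x. g (arccos (cos x)))"
  proof (rule continuous_on_compose2[OF cont])
    show "continuous_on UNIV (\<lambda>x. arccos (cos x) :: real)" by (intro continuous_intros) auto
    show "(\<lambda>x. arccos (cos x)) ` UNIV \<subseteq> {0..2 * pi}"
      using arccos_bounded[of "cos _"] by (auto intro!: arccos_lbound order.trans[OF arccos_ubound])
  qed
  then show ?thesis by (simp add: circ_def[abs_def])
qed

text \<open>The angles \<open>beta\<close> differ from \<open>x i - x 0\<close> by full turns only,
  which \<open>circ\<close> does not see. Hence any choice of real arguments of the points may be
  used, and the distinguished first point disappears from the formula.\<close>

lemma pair_sum_eq:
  assumes "\<And>i. i < m \<Longrightarrow> u (Suc i) = cis (x i)"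
  shows "pair_sum m g u = angle_sum m g x"
proof -
  have b: "cis (beta u i) = cis (x i - x 0)" "0 \<le> beta u i" "beta u i < 2 * pi" if "i < m" for i
    using that assms[of i] assms[of 0] m_pos Arg2pi_ge_0 Arg2pi_lt_2pi
    by (auto simp: beta_def cis_Arg2pi cis_divide)
  have "g \<bar>beta u j - beta u i\<bar> = circ g (x j - x i)" if "j < m" "i < j" for i j
  proof -
    have ij: "i < m" "j < m" using that by auto
    have "g \<bar>beta u j - beta u i\<bar> = circ g \<bar>beta u j - beta u i\<bar>"
      using b(2,3)[OF ij(1)] b(2,3)[OF ij(2)] by (intro circ_eq[symmetric]) auto
    also have "\<dots> = circ g ((x j - x 0) - (x i - x 0))"
    proof (rule circ_cong)
      have "cis (beta u j - beta u i) = cis ((x j - x 0) - (x i - x 0))"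
        using b(1)[OF ij(1)] b(1)[OF ij(2)] by (simp only: cis_divide[symmetric])
      then show "cos \<bar>beta u j - beta u i\<bar> = cos ((x j - x 0) - (x i - x 0))"
        by (simp only: cos_abs_real complex_eq_iff cis.sel)
    qed
    finally show ?thesis by simp
  qed
  then show ?thesis unfolding pair_sum_def angle_sum_def by (intro sum.cong) auto
qed

lemma g_vertex_sym: "s \<in> {1..<m} \<Longrightarrow> g (vertex m (m - s)) = g (vertex m s)"
proof -
  assume s: "s \<in> {1..<m}"
  have "vertex m (m - s) = 2 * pi - vertex m s" using s by (auto simp: vertex_def field_simps of_nat_diff)
  moreover have "vertex m s \<in> {0..2 * pi}" using vertex_bounds[of s] s by auto
  ultimately show ?thesis using symm[rule_format, of "vertex m s"] by simp
qed

text \<open>Each of the \<open>m\<close> vertices sees the distances \<open>vertex m 1\<close> to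
  \<open>vertex m (m - 1)\<close> once, and summing over vertices counts every pair twice: this is
  the origin of the factors \<open>m\<close> and 1/2 in the centring constant.\<close>

lemma gap_vertex: "gap m g (vertex m) = 0"
proof -
  define c where "c s = g (vertex m s)" for s
  have circ_c: "circ g (vertex m j - vertex m i) = c (if i < j then j - i else i - j)"
    if "i < m" "j < m" for i j
  proof -
    have *: "circ g (vertex m j - vertex m i) = c (j - i)" if "i \<le> j" "i < m" "j < m" for i j
    proof -
      have "vertex m j - vertex m i = vertex m (j - i)"
        using that by (simp add: vertex_def of_nat_diff diff_divide_distrib right_diff_distrib)
      then show ?thesis
        using circ_eq[of "vertex m (j - i)"] vertex_bounds[of "j - i"] that by (simp add: c_def less_imp_diff_less)
    qed
    show ?thesis using *[of i j] *[of j i] that circ_minus[of g "vertex m j"] by auto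
  qed
  have "angle_sum m g (vertex m) = (\<Sum>j<m. \<Sum>i\<in>{..<m} - {j}. circ g (vertex m j - vertex m i)) / 2"
    unfolding angle_sum_def by (rule sum_pairs_symmetric) (rule circ_minus)
  also have "(\<Sum>j<m. \<Sum>i\<in>{..<m} - {j}. circ g (vertex m j - vertex m i)) = (\<Sum>j<m. \<Sum>s = 1..m - 1. c s)"
  proof (rule sum.cong)
    fix j assume j: "j \<in> {..<m}"
    then have "(\<Sum>i\<in>{..<m} - {j}. circ g (vertex m j - vertex m i))
      = (\<Sum>i\<in>{..<m} - {j}. c (if i < j then j - i else i - j))"
      by (intro sum.cong) (auto simp: circ_c)
    also have "\<dots> = (\<Sum>s = 1..m - 1. c s)"
      using j g_vertex_sym by (intro sum_cyclic_distances) (auto simp: c_def)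
    finally show "(\<Sum>i\<in>{..<m} - {j}. circ g (vertex m j - vertex m i)) = (\<Sum>s = 1..m - 1. c s)" .
  qed simp
  also have "(\<Sum>j<m. \<Sum>s = 1..m - 1. c s) = (\<Sum>s = 1..m - 1. real m * g (2 * pi * real s / real m))"
    by (simp add: c_def vertex_def sum_distrib_left)
  finally show ?thesis unfolding gap_def by simp
qed

definition tuple :: "(nat \<Rightarrow> real) \<Rightarrow> nat \<Rightarrow> complex" where
  "tuple x k = cis (x (k - 1))"

lemma pair_sum_tuple: "pair_sum m g (tuple x) = angle_sum m g x"
  by (rule pair_sum_eq) (simp add: tuple_def)

lemma tuple_in: "tuple x \<in> {1..m} \<rightarrow> unit_circle"
  by (auto simp: tuple_def unit_circle_def)

lemma regular_vertex: "regular_polygon m (tuple (vertex m))"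
  unfolding regular_polygon_def
proof (intro bexI exI conjI ballI)
  show "bij_betw (\<lambda>k. k - 1) {1..m} {..<m}"
    by (rule bij_betw_byWitness[where f' = Suc]) auto
qed (auto simp: tuple_def vertex_def unit_circle_def)

text \<open>One half of the hypothesis on the maximum: regular polygons do attain it.\<close>

lemma gap_nonneg: "0 \<le> gap m g x"
proof -
  have "is_arg_max (pair_sum m g) (\<lambda>v. v \<in> {1..m} \<rightarrow> unit_circle) (tuple (vertex m))"
    using max_only regular_vertex unfolding max_only_at_regular_polygons_def by blast
  then have "pair_sum m g (tuple x) \<le> pair_sum m g (tuple (vertex m))"
    using tuple_in[of x] unfolding is_arg_max_def by (meson not_less)
  then show ?thesis using gap_vertex by (simp add: pair_sum_tuple gap_def)
qed

text \<open>The other half of the hypothesis: a tuple with zero deficit is itself maximal, because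
  every competitor, written through its arguments, has nonnegative deficit.\<close>

lemma gap_zero_regular:
  assumes "gap m g x = 0"
  shows "regular_polygon m (tuple x)"
proof -
  have "is_arg_max (pair_sum m g) (\<lambda>v. v \<in> {1..m} \<rightarrow> unit_circle) (tuple x)"
    unfolding is_arg_max_def
  proof (intro conjI tuple_in notI)
    assume "\<exists>v. v \<in> {1..m} \<rightarrow> unit_circle \<and> pair_sum m g (tuple x) < pair_sum m g v"
    then obtain v where v: "v \<in> {1..m} \<rightarrow> unit_circle" "pair_sum m g (tuple x) < pair_sum m g v" by blast
    have "pair_sum m g v = angle_sum m g (\<lambda>i. Arg2pi (v (Suc i)))"
      using v(1) by (intro pair_sum_eq) (auto simp: cis_Arg2pi unit_circle_def Pi_iff)
    then show False
      using v(2) gap_nonneg[of "\<lambda>i. Arg2pi (v (Suc i))"] assms by (simp add: pair_sum_tuple gap_def)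
  qed
  then show ?thesis using max_only unfolding max_only_at_regular_polygons_def by blast
qed

text \<open>Fixing the root at angle 0 removes the rotation, so only a relabelling of the other
  vertices remains free. The closed interval is allowed because the localisation minimises over a
  compact cube.\<close>

lemma gap_zero_permutation:
  assumes "gap m g b = 0" "b 0 = 0" "\<And>i. i \<in> {1..<m} \<Longrightarrow> b i \<in> {0..2 * pi}"
  shows "\<exists>\<tau>. \<tau> permutes {1..<m} \<and> (\<forall>i\<in>{1..<m}. b i = vertex m (\<tau> i))"
proof -
  obtain z \<sigma> where z: "z \<in> unit_circle" and \<sigma>: "bij_betw \<sigma> {1..m} {..<m}"
    and eq: "\<And>i. i \<in> {1..m} \<Longrightarrow> tuple b i = z * cis (2 * pi * real (\<sigma> i) / real m)"
    using gap_zero_regular[OF assms(1)] unfolding regular_polygon_def by blast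
  have \<sigma>m: "\<sigma> i < m" if "i \<in> {1..m}" for i using \<sigma> that by (auto simp: bij_betw_def)
  have one: "1 \<in> {1..m}" using m_pos by simp
  \<comment> \<open>Labels relative to the label of the root. Adding \<open>m\<close> first prevents
    truncated subtraction, and the identity elsewhere is what \<open>permutes\<close> asks
    for.\<close>
  define \<tau> where "\<tau> k = (if k \<in> {1..<m} then (\<sigma> (Suc k) + m - \<sigma> 1) mod m else k)" for k
  have bk: "b k = vertex m (\<tau> k)" and tk: "\<tau> k \<in> {1..<m}" if k: "k \<in> {1..<m}" for k
  proof -
    have Sk: "Suc k \<in> {1..m}" using k by auto
    have "\<sigma> (Suc k) \<noteq> \<sigma> 1"
      using inj_onD[of \<sigma> "{1..m}" "Suc k" 1] \<sigma> Sk one k unfolding bij_betw_def by auto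
    have t0: "\<tau> k \<noteq> 0"
    proof
      assume "\<tau> k = 0"
      then have "m dvd \<sigma> (Suc k) + m - \<sigma> 1" using k by (auto simp: \<tau>_def)
      then obtain q where q: "\<sigma> (Suc k) + m - \<sigma> 1 = m * q" by (auto elim: dvdE)
      have "0 < m * q" "m * q < 2 * m" using q \<sigma>m[OF Sk] \<sigma>m[OF one] by linarith+
      then have "q = 1" by (auto simp: mult.commute)
      then show False using q \<open>\<sigma> (Suc k) \<noteq> \<sigma> 1\<close> \<sigma>m[OF one] by auto
    qed
    show tk: "\<tau> k \<in> {1..<m}" using t0 k m_pos by (auto simp: \<tau>_def)
    have z0: "z \<noteq> 0" using z by (auto simp: unit_circle_def)
    have "cis (b k) = tuple b (Suc k) / tuple b 1" using assms(2) by (simp add: tuple_def)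
    also have "\<dots> = cis (2 * pi * real (\<sigma> (Suc k)) / real m - 2 * pi * real (\<sigma> 1) / real m)"
      using eq[OF Sk] eq[OF one] z0 by (simp add: cis_divide)
    \<comment> \<open>The quotient counts full turns; the subtracted 1 undoes the \<open>m\<close>
      added in \<open>\<tau>\<close>.\<close>
    also have "2 * pi * real (\<sigma> (Suc k)) / real m - 2 * pi * real (\<sigma> 1) / real m
      = vertex m (\<tau> k) + (2 * pi * real_of_int (int ((\<sigma> (Suc k) + m - \<sigma> 1) div m) - 1))"
    proof -
      define w where "w = \<sigma> (Suc k) + m - \<sigma> 1"
      have w: "real w = real (\<sigma> (Suc k)) + real m - real (\<sigma> 1)"
        using \<sigma>m[OF one] by (simp add: w_def of_nat_diff)
      have w': "real w = real m * real (w div m) + real (w mod m)"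
        by (metis mult_div_mod_eq of_nat_add of_nat_mult)
      have t: "\<tau> k = w mod m" using k by (simp add: \<tau>_def w_def)
      have \<sigma>k: "real (\<sigma> (Suc k)) = real m * real (w div m) + real (w mod m) - real m + real (\<sigma> 1)"
        using w w' by linarith
      show ?thesis
        unfolding w_def[symmetric] t vertex_def \<sigma>k using m_pos by (simp add: field_simps)
    qed
    also have "cis \<dots> = cis (vertex m (\<tau> k))"
      by (simp only: cis_mult[symmetric] cis_multiple_2pi[OF Ints_of_int]) simp
    finally have c: "cis (b k) = cis (vertex m (\<tau> k))" .
    have v: "0 < vertex m (\<tau> k)" "vertex m (\<tau> k) < 2 * pi"
      using tk vertex_bounds[of "\<tau> k"] m_pos by (auto simp: vertex_def)
    have A: "Arg2pi (cis (vertex m (\<tau> k))) = vertex m (\<tau> k)" using v by (intro Arg2pi_cis) auto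
    \<comment> \<open>At the endpoint the point would coincide with the root, but distinct labels
      give distinct vertices.\<close>
    have "b k \<noteq> 2 * pi"
    proof
      assume "b k = 2 * pi"
      then have "cis (vertex m (\<tau> k)) = cis 0" using c by simp
      then show False using A v Arg2pi_cis[of 0] by simp
    qed
    then show "b k = vertex m (\<tau> k)" using assms(3)[OF k] c A Arg2pi_cis[of "b k"] by auto
  qed
  have "inj_on \<tau> {1..<m}"
  proof (rule inj_onI)
    fix i k assume ik: "i \<in> {1..<m}" "k \<in> {1..<m}" "\<tau> i = \<tau> k"
    \<comment> \<open>One inequality suffices by symmetry. The assumed reverse order makes the
      congruence a divisibility by \<open>m\<close> of a positive natural difference below
      \<open>m\<close>.\<close>
    have le: "\<sigma> (Suc i) \<le> \<sigma> (Suc k)"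
      if "i \<in> {1..<m}" "k \<in> {1..<m}" "\<tau> i = \<tau> k" for i k
    proof (rule ccontr)
      assume less: "\<not> \<sigma> (Suc i) \<le> \<sigma> (Suc k)"
      have "(\<sigma> (Suc i) + m - \<sigma> 1) mod m = (\<sigma> (Suc k) + m - \<sigma> 1) mod m"
        using that by (simp add: \<tau>_def)
      then have "m dvd (\<sigma> (Suc i) + m - \<sigma> 1) - (\<sigma> (Suc k) + m - \<sigma> 1)"
        using less by (subst (asm) mod_eq_dvd_iff_nat) auto
      also have "(\<sigma> (Suc i) + m - \<sigma> 1) - (\<sigma> (Suc k) + m - \<sigma> 1) = \<sigma> (Suc i) - \<sigma> (Suc k)"
        using \<sigma>m[OF one] by simp
      finally show False using less \<sigma>m[of "Suc i"] that by (auto dest!: dvd_imp_le)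
    qed
    have "\<sigma> (Suc i) = \<sigma> (Suc k)" using le[of i k] le[of k i] ik by simp
    then show "i = k" using \<sigma> ik unfolding bij_betw_def by (auto dest: inj_onD)
  qed
  moreover have "\<tau> ` {1..<m} \<subseteq> {1..<m}" using tk by blast
  ultimately have "bij_betw \<tau> {1..<m} {1..<m}"
    by (simp add: bij_betw_def endo_inj_surj)
  then have "\<tau> permutes {1..<m}" by (rule bij_imp_permutes) (simp add: \<tau>_def del: atLeastLessThan_iff)
  then show ?thesis using bk by blast
qed

end

subsection \<open>Second-order behaviour at a regular polygon\<close>

text \<open>The Lagrange remainder contains the second derivative at an intermediate point, and
  continuity of that derivative at \<open>a\<close> makes the error at most \<eta> times the square
  of the increment. This o-form is enough here; no explicit cubic bound is carried along.\<close>

lemma taylor_second_order: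
  assumes "open N" "a \<in> N" and f: "cont_diff_on 3 f N" and "\<eta> > 0"
  shows "\<exists>\<delta>>0. \<forall>h. \<bar>h\<bar> \<le> \<delta> \<longrightarrow> a + h \<in> N \<and>
    \<bar>f (a + h) - f a - deriv f a * h - (deriv ^^ 2) f a / 2 * h\<^sup>2\<bar> \<le> \<eta> * h\<^sup>2"
proof -
  obtain e where e: "e > 0" "ball a e \<subseteq> N" using assms(1,2) open_contains_ball by blast
  have df: "((deriv ^^ k) f has_real_derivative (deriv ^^ Suc k) f x) (at x)" if "k < 3" "x \<in> N" for k x
    using f that by (auto simp: cont_diff_on_def DERIV_deriv_iff_real_differentiable)
  have "isCont ((deriv ^^ 2) f) a" using df[of 2 a] assms(2) DERIV_isCont by auto
  then obtain d where d: "d > 0" "\<And>x. \<bar>x - a\<bar> < d \<Longrightarrow> \<bar>(deriv ^^ 2) f x - (deriv ^^ 2) f a\<bar> < \<eta>"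
    using assms(4) unfolding continuous_at_real_range real_norm_def by blast
  define \<delta> where "\<delta> = min e d / 2"
  have \<delta>: "\<delta> > 0" "\<delta> < e" "\<delta> < d" using e d by (auto simp: \<delta>_def)
  have inN: "x \<in> N" if "\<bar>x - a\<bar> \<le> \<delta>" for x
    using that \<delta> e by (auto simp: subset_iff dist_real_def)
  have "\<bar>f (a + h) - f a - deriv f a * h - (deriv ^^ 2) f a / 2 * h\<^sup>2\<bar> \<le> \<eta> * h\<^sup>2" if h: "\<bar>h\<bar> \<le> \<delta>" for h
  proof (cases "h = 0")
    case False
    have dd: "\<forall>k t. k < 2 \<and> a - \<delta> \<le> t \<and> t \<le> a + \<delta> \<longrightarrow>
      ((deriv ^^ k) f has_real_derivative (deriv ^^ Suc k) f t) (at t)"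
      by (intro allI impI df inN) (auto simp: abs_le_iff)
    have "\<exists>t. (if a + h < a then a + h < t \<and> t < a else a < t \<and> t < a + h) \<and>
      f (a + h) = (\<Sum>k<2. (deriv ^^ k) f a / fact k * (a + h - a) ^ k) + (deriv ^^ 2) f t / fact 2 * (a + h - a) ^ 2"
      by (rule Taylor[OF _ _ dd]) (use False h \<delta>(1) in \<open>auto simp: abs_le_iff\<close>)
    then obtain t where t0: "if a + h < a then a + h < t \<and> t < a else a < t \<and> t < a + h"
      "f (a + h) = (\<Sum>k<2. (deriv ^^ k) f a / fact k * (a + h - a) ^ k) + (deriv ^^ 2) f t / fact 2 * (a + h - a) ^ 2"
      by blast
    have t: "\<bar>t - a\<bar> \<le> \<bar>h\<bar>"
      "f (a + h) = (\<Sum>k<2. (deriv ^^ k) f a / fact k * h ^ k) + (deriv ^^ 2) f t / fact 2 * h ^ 2"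
      using t0 by (auto split: if_splits)
    have "f (a + h) - f a - deriv f a * h - (deriv ^^ 2) f a / 2 * h\<^sup>2
      = ((deriv ^^ 2) f t - (deriv ^^ 2) f a) / 2 * h\<^sup>2"
      unfolding t(2) by (simp add: numeral_2_eq_2 field_simps)
    also have "\<bar>\<dots>\<bar> = \<bar>(deriv ^^ 2) f t - (deriv ^^ 2) f a\<bar> / 2 * h\<^sup>2" by (simp add: abs_mult)
    also have "\<dots> \<le> \<eta> * h\<^sup>2"
      using d(2)[of t] t(1) h \<delta> assms(4) by (intro mult_right_mono) auto
    finally show ?thesis .
  qed simp
  then show ?thesis using \<delta>(1) inN by (intro exI[of _ \<delta>]) auto
qed

context polygon_kernel
begin

definition curv :: "nat \<Rightarrow> real" where
  "curv s = (deriv ^^ 2) g (vertex m s)"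

lemma circ_taylor:
  assumes s: "s \<in> {1..<m}" and \<eta>: "\<eta> > 0"
  shows "\<exists>\<delta>>0. \<forall>h. \<bar>h\<bar> \<le> \<delta> \<longrightarrow>
    \<bar>circ g (vertex m s + h) - g (vertex m s) - deriv g (vertex m s) * h - curv s / 2 * h\<^sup>2\<bar> \<le> \<eta> * h\<^sup>2"
proof -
  have "s \<in> {1..m - 1}" using s by auto
  then obtain N where N: "open N" "N \<subseteq> {0..2 * pi}" "vertex m s \<in> N" "cont_diff_on 3 g N"
    using smooth unfolding vertex_def by blast
  obtain \<delta> where \<delta>: "\<delta> > 0" "\<And>h. \<bar>h\<bar> \<le> \<delta> \<Longrightarrow> vertex m s + h \<in> N \<and>
    \<bar>g (vertex m s + h) - g (vertex m s) - deriv g (vertex m s) * h - (deriv ^^ 2) g (vertex m s) / 2 * h\<^sup>2\<bar> \<le> \<eta> * h\<^sup>2"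
    using taylor_second_order[OF N(1,3,4) \<eta>] by blast
  have "circ g (vertex m s + h) = g (vertex m s + h)" if "\<bar>h\<bar> \<le> \<delta>" for h
    using \<delta>(2)[OF that] N(2) by (intro circ_eq) auto
  with \<delta> show ?thesis unfolding curv_def by (intro exI[of _ \<delta>]) auto
qed

lemma vertex_reflect: "s \<le> m \<Longrightarrow> vertex m (m - s) = 2 * pi - vertex m s"
  using m_pos by (auto simp: vertex_def field_simps of_nat_diff)

text \<open>The symmetric second differences of \<open>circ g\<close> at \<open>vertex m s\<close>
  and at its reflection coincide, and in them the first-order terms cancel. Comparing the two Taylor
  expansions therefore identifies the second derivatives.\<close>

lemma curv_sym:
  assumes s: "s \<in> {1..<m}"
  shows "curv (m - s) = curv s"
proof (rule ccontr)
  assume ne: "curv (m - s) \<noteq> curv s"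
  \<comment> \<open>Two expansions, each with error \<open>2 * \<eta> * h^2\<close>, add up to half
    of the supposed discrepancy, a contradiction.\<close>
  define \<eta> where "\<eta> = \<bar>curv (m - s) - curv s\<bar> / 8"
  have \<eta>: "\<eta> > 0" using ne by (simp add: \<eta>_def)
  have s': "m - s \<in> {1..<m}" using s by auto
  obtain \<delta>1 where \<delta>1: "\<delta>1 > 0" "\<And>h. \<bar>h\<bar> \<le> \<delta>1 \<Longrightarrow>
    \<bar>circ g (vertex m s + h) - g (vertex m s) - deriv g (vertex m s) * h - curv s / 2 * h\<^sup>2\<bar> \<le> \<eta> * h\<^sup>2"
    using circ_taylor[OF s \<eta>] by blast
  obtain \<delta>2 where \<delta>2: "\<delta>2 > 0" "\<And>h. \<bar>h\<bar> \<le> \<delta>2 \<Longrightarrow>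
    \<bar>circ g (vertex m (m - s) + h) - g (vertex m (m - s)) - deriv g (vertex m (m - s)) * h - curv (m - s) / 2 * h\<^sup>2\<bar> \<le> \<eta> * h\<^sup>2"
    using circ_taylor[OF s' \<eta>] by blast
  define h where "h = min \<delta>1 \<delta>2"
  have h: "h > 0" "\<bar>h\<bar> \<le> \<delta>1" "\<bar>-h\<bar> \<le> \<delta>1" "\<bar>h\<bar> \<le> \<delta>2" "\<bar>-h\<bar> \<le> \<delta>2" using \<delta>1 \<delta>2 by (auto simp: h_def)
  have refl: "circ g (vertex m (m - s) + x) = circ g (vertex m s + - x)" for x
    using s by (intro circ_cong) (simp add: vertex_reflect cos_diff cos_add sin_diff sin_add)
  have gs: "g (vertex m (m - s)) = g (vertex m s)" by (rule g_vertex_sym[OF s])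
  define S where "S = circ g (vertex m s + h) + circ g (vertex m s + - h) - 2 * g (vertex m s)"
  have "\<bar>S - curv s * h\<^sup>2\<bar> \<le> 2 * \<eta> * h\<^sup>2"
    using \<delta>1(2)[OF h(2)] \<delta>1(2)[OF h(3)] unfolding S_def abs_le_iff by (simp add: field_simps)
  moreover have "\<bar>S - curv (m - s) * h\<^sup>2\<bar> \<le> 2 * \<eta> * h\<^sup>2"
    using \<delta>2(2)[OF h(4)] \<delta>2(2)[OF h(5)] unfolding S_def abs_le_iff refl gs minus_minus by (simp add: field_simps)
  ultimately have "\<bar>(curv (m - s) - curv s) * h\<^sup>2\<bar> \<le> 4 * \<eta> * h\<^sup>2"
    unfolding left_diff_distrib by linarith
  then have "\<bar>curv (m - s) - curv s\<bar> \<le> 4 * \<eta>" using h(1) by (simp add: abs_mult)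
  then show False using \<eta> by (simp add: \<eta>_def)
qed

text \<open>The entries of -G, the Hessian of the deficit at the regular polygon with the root held
  fixed.\<close>

definition neg_hess :: "nat \<Rightarrow> nat \<Rightarrow> real" where
  "neg_hess i j = (if i \<noteq> j then (deriv ^^ 2) g (2 * pi * \<bar>real i - real j\<bar> / real m)
    else - (\<Sum>s = 1..m - 1. (deriv ^^ 2) g (2 * pi * real s / real m)))"

text \<open>The root coordinate is left out: a common rotation of all points costs nothing, so only
  the \<open>m - 1\<close> offsets can carry a definite form.\<close>

definition quad :: "(nat \<Rightarrow> real) \<Rightarrow> real" where
  "quad v = quad_form (m - 1) neg_hess (\<lambda>i. v (Suc i))"

lemma uminus_hess_mat: "- hess_mat m g = Matrix.mat (m - 1) (m - 1) (\<lambda>(i, j). neg_hess i j)"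
  by (rule eq_matI) (auto simp: hess_mat_def neg_hess_def)

lemma det_neg_hess: "Determinant.det (Matrix.mat (m - 1) (m - 1) (\<lambda>(i, j). neg_hess i j)) \<noteq> 0"
proof -
  have "- hess_mat m g = (-1) \<cdot>\<^sub>m hess_mat m g" by (rule eq_matI) auto
  then have "Determinant.det (- hess_mat m g) \<noteq> 0" using det_ne by (simp only: det_smult) simp
  then show ?thesis unfolding uminus_hess_mat .
qed

lemma neg_hess_curv: "neg_hess i j = (if i = j then - (\<Sum>s = 1..m - 1. curv s) else curv (if i < j then j - i else i - j))"
  by (auto simp: neg_hess_def curv_def vertex_def of_nat_diff)

text \<open>The diagonal entry of -G is minus the sum of the curvatures at all distances from a
  vertex, the distance to the root included. So expanding the squares over pairs of all
  \<open>m\<close> points, with the root at 0, produces the matrix form.\<close>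

lemma quad_eq:
  assumes "v 0 = 0"
  shows "quad v = - (\<Sum>j<m. \<Sum>i<j. curv (j - i) * (v j - v i)\<^sup>2)"
proof -
  define C where "C i j = curv (if i < j then j - i else i - j)" for i j :: nat
  define S where "S = (\<Sum>s = 1..m - 1. curv s)"
  have Csym: "C i j = C j i" for i j
    by (cases "i < j"; cases "j < i") (auto simp: C_def)
  have CS: "(\<Sum>i\<in>{..<m} - {j}. C i j) = S" if "j < m" for j
    unfolding C_def S_def by (rule sum_cyclic_distances) (auto simp: curv_sym that)
  have "(\<Sum>j<m. \<Sum>i<j. curv (j - i) * (v j - v i)\<^sup>2) = (\<Sum>j<m. \<Sum>i<j. C i j * (v j - v i)\<^sup>2)"
    by (intro sum.cong refl) (auto simp: C_def)
  also have "\<dots> = (\<Sum>j<m. \<Sum>i\<in>{..<m} - {j}. C i j * (v j - v i)\<^sup>2) / 2"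
    by (rule sum_pairs_symmetric) (simp add: Csym[of i j for i j] power2_commute)
  also have "(\<Sum>j<m. \<Sum>i\<in>{..<m} - {j}. C i j * (v j - v i)\<^sup>2)
    = (\<Sum>j<m. \<Sum>i\<in>{..<m} - {j}. C i j * (v j)\<^sup>2) + (\<Sum>j<m. \<Sum>i\<in>{..<m} - {j}. C i j * (v i)\<^sup>2)
      - 2 * (\<Sum>j<m. \<Sum>i\<in>{..<m} - {j}. C i j * v i * v j)"
    by (simp add: sum_distrib_left sum_subtractf[symmetric] sum.distrib[symmetric] power2_eq_square algebra_simps)
  also have "(\<Sum>j<m. \<Sum>i\<in>{..<m} - {j}. C i j * (v i)\<^sup>2) = (\<Sum>j<m. \<Sum>i\<in>{..<m} - {j}. C i j * (v j)\<^sup>2)"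
  proof -
    have "(\<Sum>j<m. \<Sum>i\<in>{..<m} - {j}. C i j * (v i)\<^sup>2) = (\<Sum>j<m. \<Sum>i<m. if i = j then 0 else C i j * (v i)\<^sup>2)"
      by (rule sum.cong, simp, rule sum.mono_neutral_cong_left) auto
    also have "\<dots> = (\<Sum>i<m. \<Sum>j<m. if i = j then 0 else C i j * (v i)\<^sup>2)" by (rule sum.swap)
    also have "\<dots> = (\<Sum>j<m. \<Sum>i\<in>{..<m} - {j}. C i j * (v j)\<^sup>2)"
      by (rule sum.cong, simp, rule sum.mono_neutral_cong_right) (auto simp: Csym)
    finally show ?thesis .
  qed
  also have "(\<Sum>j<m. \<Sum>i\<in>{..<m} - {j}. C i j * (v j)\<^sup>2) = (\<Sum>j<m. S * (v j)\<^sup>2)"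
    by (rule sum.cong) (simp_all add: CS flip: sum_distrib_right)
  finally have "- (\<Sum>j<m. \<Sum>i<j. curv (j - i) * (v j - v i)\<^sup>2)
    = (\<Sum>j<m. \<Sum>i\<in>{..<m} - {j}. C i j * v i * v j) - (\<Sum>j<m. S * (v j)\<^sup>2)" by simp
  also have "\<dots> = (\<Sum>j<m. (\<Sum>i\<in>{..<m} - {j}. C i j * v i * v j) - S * (v j)\<^sup>2)"
    by (simp add: sum_subtractf)
  also have "\<dots> = (\<Sum>j<m. \<Sum>i<m. neg_hess i j * v i * v j)"
  proof (rule sum.cong)
    fix j assume j: "j \<in> {..<m}"
    then have "(\<Sum>i<m. neg_hess i j * v i * v j) = neg_hess j j * v j * v j + (\<Sum>i\<in>{..<m} - {j}. neg_hess i j * v i * v j)"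
      by (intro sum.remove) auto
    also have "(\<Sum>i\<in>{..<m} - {j}. neg_hess i j * v i * v j) = (\<Sum>i\<in>{..<m} - {j}. C i j * v i * v j)"
      by (rule sum.cong) (auto simp: neg_hess_curv C_def)
    also have "neg_hess j j * v j * v j = - S * (v j)\<^sup>2" by (simp add: neg_hess_curv S_def power2_eq_square)
    finally show "(\<Sum>i\<in>{..<m} - {j}. C i j * v i * v j) - S * (v j)\<^sup>2 = (\<Sum>i<m. neg_hess i j * v i * v j)" by simp
  qed simp
  also have "\<dots> = (\<Sum>i<m. \<Sum>j<m. neg_hess i j * v i * v j)" by (rule sum.swap)
  also have "\<dots> = quad v"
  proof -
    \<comment> \<open>Row and column 0 vanish with \<open>v 0\<close>, and the entries depend only
      on index differences, so numbering the offsets from 0 or from 1 gives the same matrix.\<close>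
    have drop0: "(\<Sum>i<Suc k. \<Sum>j<Suc k. f i j) = (\<Sum>i<k. \<Sum>j<k. f (Suc i) (Suc j))"
      if "\<And>i. f i 0 = 0" "\<And>j. f 0 j = 0" for f :: "nat \<Rightarrow> nat \<Rightarrow> real" and k
      using that by (simp add: sum.lessThan_Suc_shift del: sum.lessThan_Suc)
    have "(\<Sum>i<m. \<Sum>j<m. neg_hess i j * v i * v j)
      = (\<Sum>i<Suc (m - 1). \<Sum>j<Suc (m - 1). neg_hess i j * v i * v j)" using m_pos by simp
    also have "\<dots> = (\<Sum>i<m - 1. \<Sum>j<m - 1. neg_hess (Suc i) (Suc j) * v (Suc i) * v (Suc j))"
      by (rule drop0) (simp_all add: assms)
    also have "\<dots> = quad v"
      unfolding quad_def quad_form_def by (intro sum.cong refl) (simp add: neg_hess_curv)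
    finally show ?thesis .
  qed
  finally show ?thesis by simp
qed

text \<open>The sum of the Taylor expansions over all pairs. The linear term is kept for the moment,
  because its vanishing is deduced from this very estimate.\<close>

lemma gap_expansion:
  assumes "\<eta> > 0"
  shows "\<exists>\<delta>>0. \<forall>v. v 0 = 0 \<and> (\<forall>i<m. \<bar>v i\<bar> \<le> \<delta>) \<longrightarrow>
    \<bar>gap m g (\<lambda>i. vertex m i + v i) + (\<Sum>j<m. \<Sum>i<j. deriv g (vertex m (j - i)) * (v j - v i)) - quad v / 2\<bar>
      \<le> \<eta> * (\<Sum>j<m. \<Sum>i<j. (v j - v i)\<^sup>2)"
proof -
  have "\<forall>s\<in>{1..<m}. \<exists>\<delta>>0. \<forall>h. \<bar>h\<bar> \<le> \<delta> \<longrightarrow>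
    \<bar>circ g (vertex m s + h) - g (vertex m s) - deriv g (vertex m s) * h - curv s / 2 * h\<^sup>2\<bar> \<le> \<eta> * h\<^sup>2"
    using circ_taylor assms by blast
  from bchoice[OF this] obtain d where d: "\<And>s. s \<in> {1..<m} \<Longrightarrow> d s > 0" "\<And>s h. s \<in> {1..<m} \<Longrightarrow> \<bar>h\<bar> \<le> d s \<Longrightarrow>
    \<bar>circ g (vertex m s + h) - g (vertex m s) - deriv g (vertex m s) * h - curv s / 2 * h\<^sup>2\<bar> \<le> \<eta> * h\<^sup>2"
    by blast
  \<comment> \<open>Halved because differences of two offsets can be as large as
    \<open>2 * \<delta>\<close>.\<close>
  define \<delta> where "\<delta> = Min (d ` {1..<m}) / 2"
  have ne: "d ` {1..<m} \<noteq> {}" "finite (d ` {1..<m})" using m_ge_2 by auto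
  have \<delta>: "\<delta> > 0" "\<And>s. s \<in> {1..<m} \<Longrightarrow> 2 * \<delta> \<le> d s"
    unfolding \<delta>_def using ne d(1) by (auto simp: Min_gr_iff)
  have "\<bar>gap m g (\<lambda>i. vertex m i + v i) + (\<Sum>j<m. \<Sum>i<j. deriv g (vertex m (j - i)) * (v j - v i)) - quad v / 2\<bar>
      \<le> \<eta> * (\<Sum>j<m. \<Sum>i<j. (v j - v i)\<^sup>2)" if v: "v 0 = 0" "\<And>i. i < m \<Longrightarrow> \<bar>v i\<bar> \<le> \<delta>" for v
  proof -
    define t where "t i j = circ g (vertex m (j - i) + (v j - v i)) - g (vertex m (j - i))
      - deriv g (vertex m (j - i)) * (v j - v i) - curv (j - i) / 2 * (v j - v i)\<^sup>2" for i j
    have tb: "\<bar>t i j\<bar> \<le> \<eta> * (v j - v i)\<^sup>2" if "j < m" "i < j" for i j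
    proof -
      have ji: "j - i \<in> {1..<m}" using that by (simp add: Suc_le_eq less_imp_diff_less)
      show ?thesis
        unfolding t_def using that v(2)[of i] v(2)[of j] \<delta>(2)[OF ji] by (intro d(2) ji) auto
    qed
    have vd: "vertex m j - vertex m i = vertex m (j - i)" if "i < j" for i j
      using that by (simp add: vertex_def of_nat_diff diff_divide_distrib right_diff_distrib)
    have as: "angle_sum m g x = (\<Sum>j<m. \<Sum>i<j. circ g (x j - x i))" for x by (simp add: angle_sum_def)
    have "gap m g (\<lambda>i. vertex m i + v i) = angle_sum m g (vertex m) - angle_sum m g (\<lambda>i. vertex m i + v i)"
      using gap_vertex by (simp add: gap_def)
    also have "\<dots> = - (\<Sum>j<m. \<Sum>i<j. circ g (vertex m (j - i) + (v j - v i)) - g (vertex m (j - i)))"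
    proof -
      have f1: "circ g (vertex m j - vertex m i) = g (vertex m (j - i))" if "j < m" "i < j" for i j
        using that vd[of i j] vertex_bounds[of "j - i"] circ_eq[of "vertex m (j - i)"] by (simp add: less_imp_diff_less)
      have f2: "vertex m j + v j - (vertex m i + v i) = vertex m (j - i) + (v j - v i)" if "i < j" for i j
        using vd[OF that] by simp
      have "angle_sum m g (vertex m) = (\<Sum>j<m. \<Sum>i<j. g (vertex m (j - i)))"
        "angle_sum m g (\<lambda>i. vertex m i + v i) = (\<Sum>j<m. \<Sum>i<j. circ g (vertex m (j - i) + (v j - v i)))"
        unfolding as by (intro sum.cong refl; simp add: f1 f2)+
      then show ?thesis by (simp add: sum_subtractf)
    qed
    finally have "gap m g (\<lambda>i. vertex m i + v i) + (\<Sum>j<m. \<Sum>i<j. deriv g (vertex m (j - i)) * (v j - v i)) - quad v / 2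
      = - (\<Sum>j<m. \<Sum>i<j. t i j)"
      by (simp add: quad_eq[of v, OF v(1)] t_def sum_subtractf sum_divide_distrib sum_negf)
    then have "\<bar>gap m g (\<lambda>i. vertex m i + v i) + (\<Sum>j<m. \<Sum>i<j. deriv g (vertex m (j - i)) * (v j - v i)) - quad v / 2\<bar>
      = \<bar>\<Sum>j<m. \<Sum>i<j. t i j\<bar>" by simp
    also have "\<dots> \<le> (\<Sum>j<m. \<bar>\<Sum>i<j. t i j\<bar>)" by (rule sum_abs)
    also have "\<dots> \<le> (\<Sum>j<m. \<Sum>i<j. \<bar>t i j\<bar>)" by (intro sum_mono sum_abs)
    also have "\<dots> \<le> (\<Sum>j<m. \<Sum>i<j. \<eta> * (v j - v i)\<^sup>2)" using tb by (intro sum_mono) auto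
    finally show ?thesis by (simp add: sum_distrib_left)
  qed
  with \<delta>(1) show ?thesis by blast
qed

lemma quad_scale: "quad (\<lambda>i. s * v i) = s\<^sup>2 * quad v"
  by (simp add: quad_def quad_form_def sum_distrib_left power2_eq_square mult_ac)

lemma small_multiple:
  assumes "\<delta> > (0::real)"
  shows "\<exists>r>0. \<forall>s. \<bar>s\<bar> \<le> r \<longrightarrow> (\<forall>i<m. \<bar>s * v i\<bar> \<le> \<delta>)"
proof -
  define B where "B = 1 + (\<Sum>i<m. \<bar>v i\<bar>)"
  have B: "B > 0" "\<And>i. i < m \<Longrightarrow> \<bar>v i\<bar> \<le> B"
    unfolding B_def using member_le_sum[of _ "{..<m}" "\<lambda>i. \<bar>v i\<bar>"] by (auto intro: add_pos_nonneg sum_nonneg simp: add_increasing)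
  have "\<bar>s * v i\<bar> \<le> \<delta>" if "\<bar>s\<bar> \<le> \<delta> / B" "i < m" for s i
  proof -
    have "\<bar>s * v i\<bar> \<le> \<delta> / B * B" unfolding abs_mult using that B assms by (intro mult_mono) auto
    then show ?thesis using B by simp
  qed
  then show ?thesis using assms B by (intro exI[of _ "\<delta> / B"]) auto
qed

text \<open>First-order condition at a maximum. Along the line \<open>s * v\<close> the deficit is
  nonnegative but equals minus \<open>s\<close> times the linear term up to O(s^2), and
  \<open>s\<close> may have either sign.\<close>

lemma gap_gradient_zero:
  assumes v: "v 0 = 0"
  shows "(\<Sum>j<m. \<Sum>i<j. deriv g (vertex m (j - i)) * (v j - v i)) = 0" (is "?l = 0")
proof (rule ccontr)
  assume ne: "?l \<noteq> 0"
  let ?R = "\<Sum>j<m. \<Sum>i<j. (v j - v i)\<^sup>2"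
  have one: "(0::real) < 1" by simp
  obtain \<delta> where \<delta>: "\<delta> > 0" "\<And>v. v 0 = 0 \<Longrightarrow> (\<forall>i<m. \<bar>v i\<bar> \<le> \<delta>) \<Longrightarrow>
    \<bar>gap m g (\<lambda>i. vertex m i + v i) + (\<Sum>j<m. \<Sum>i<j. deriv g (vertex m (j - i)) * (v j - v i)) - quad v / 2\<bar>
      \<le> 1 * (\<Sum>j<m. \<Sum>i<j. (v j - v i)\<^sup>2)"
    using gap_expansion[OF one] by blast
  obtain r where r: "r > 0" "\<And>s. \<bar>s\<bar> \<le> r \<Longrightarrow> (\<forall>i<m. \<bar>s * v i\<bar> \<le> \<delta>)"
    using small_multiple[OF \<delta>(1)] by blast
  define B where "B = \<bar>quad v / 2 + ?R\<bar> + 1"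
  have key: "s * ?l \<le> s\<^sup>2 * B" if "\<bar>s\<bar> \<le> r" for s
  proof -
    have "\<bar>gap m g (\<lambda>i. vertex m i + s * v i) + (\<Sum>j<m. \<Sum>i<j. deriv g (vertex m (j - i)) * (s * v j - s * v i)) - quad (\<lambda>i. s * v i) / 2\<bar>
      \<le> 1 * (\<Sum>j<m. \<Sum>i<j. (s * v j - s * v i)\<^sup>2)"
      by (rule \<delta>(2)) (use v r(2)[OF that] in auto)
    moreover have "(\<Sum>j<m. \<Sum>i<j. deriv g (vertex m (j - i)) * (s * v j - s * v i)) = s * ?l"
      by (simp add: sum_distrib_left algebra_simps)
    moreover have "(\<Sum>j<m. \<Sum>i<j. (s * v j - s * v i)\<^sup>2) = s\<^sup>2 * ?R"
      by (simp add: sum_distrib_left power_mult_distrib flip: right_diff_distrib)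
    ultimately have "s * ?l \<le> s\<^sup>2 * (quad v / 2 + ?R)"
      using gap_nonneg[of "\<lambda>i. vertex m i + s * v i"] by (simp add: quad_scale abs_le_iff algebra_simps)
    also have "\<dots> \<le> s\<^sup>2 * B" unfolding B_def by (intro mult_left_mono) auto
    finally show ?thesis .
  qed
  have B: "B > 0" by (simp add: B_def)
  \<comment> \<open>For this step the quadratic bound is at most half of the linear term.\<close>
  define s where "s = min r (\<bar>?l\<bar> / (2 * B))"
  have s: "s > 0" "s \<le> r" "s \<le> \<bar>?l\<bar> / (2 * B)" using r ne B by (auto simp: s_def)
  have "s * \<bar>?l\<bar> \<le> s\<^sup>2 * B"
    using key[of s] key[of "- s"] s by (cases "?l \<ge> 0") auto
  then have "\<bar>?l\<bar> \<le> s * B" using s(1) by (simp add: power2_eq_square)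
  also have "\<dots> \<le> \<bar>?l\<bar> / (2 * B) * B" using s B by (intro mult_right_mono) auto
  also have "\<dots> = \<bar>?l\<bar> / 2" using B by simp
  finally show False using ne by simp
qed

lemma gap_expansion':
  assumes "\<eta> > 0"
  shows "\<exists>\<delta>>0. \<forall>v. v 0 = 0 \<and> (\<forall>i<m. \<bar>v i\<bar> \<le> \<delta>) \<longrightarrow>
    \<bar>gap m g (\<lambda>i. vertex m i + v i) - quad v / 2\<bar> \<le> \<eta> * (\<Sum>j<m. \<Sum>i<j. (v j - v i)\<^sup>2)"
proof -
  obtain \<delta> where \<delta>: "\<delta> > 0" "\<And>v. v 0 = 0 \<Longrightarrow> (\<forall>i<m. \<bar>v i\<bar> \<le> \<delta>) \<Longrightarrow>
    \<bar>gap m g (\<lambda>i. vertex m i + v i) + (\<Sum>j<m. \<Sum>i<j. deriv g (vertex m (j - i)) * (v j - v i)) - quad v / 2\<bar>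
      \<le> \<eta> * (\<Sum>j<m. \<Sum>i<j. (v j - v i)\<^sup>2)"
    using gap_expansion[OF assms] by blast
  have "\<bar>gap m g (\<lambda>i. vertex m i + v i) - quad v / 2\<bar> \<le> \<eta> * (\<Sum>j<m. \<Sum>i<j. (v j - v i)\<^sup>2)"
    if "v 0 = 0" "\<forall>i<m. \<bar>v i\<bar> \<le> \<delta>" for v
    using \<delta>(2)[of v, OF that] gap_gradient_zero[of v, OF that(1)] by simp
  with \<delta>(1) show ?thesis by blast
qed

text \<open>Second-order condition at a maximum: a negative direction of the form would make the
  deficit negative at a small multiple of it.\<close>

lemma quad_nonneg:
  assumes v: "v 0 = 0"
  shows "0 \<le> quad v"
proof (rule ccontr)
  assume neg: "\<not> 0 \<le> quad v"
  let ?R = "\<Sum>j<m. \<Sum>i<j. (v j - v i)\<^sup>2"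
  have R: "?R \<ge> 0" by (intro sum_nonneg) auto
  \<comment> \<open>The error then uses up at most half of \<open>quad v / 2\<close>, leaving the
    negative value \<open>quad v / 4\<close>.\<close>
  define \<eta> where "\<eta> = - quad v / (4 * (?R + 1))"
  have \<eta>: "\<eta> > 0" unfolding \<eta>_def using neg R by (intro divide_pos_pos) auto
  obtain \<delta> where \<delta>: "\<delta> > 0" "\<And>v. v 0 = 0 \<Longrightarrow> (\<forall>i<m. \<bar>v i\<bar> \<le> \<delta>) \<Longrightarrow>
    \<bar>gap m g (\<lambda>i. vertex m i + v i) - quad v / 2\<bar> \<le> \<eta> * (\<Sum>j<m. \<Sum>i<j. (v j - v i)\<^sup>2)"
    using gap_expansion'[OF \<eta>] by blast
  obtain r where r: "r > 0" "\<And>s. \<bar>s\<bar> \<le> r \<Longrightarrow> (\<forall>i<m. \<bar>s * v i\<bar> \<le> \<delta>)"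
    using small_multiple[OF \<delta>(1)] by blast
  have "\<bar>gap m g (\<lambda>i. vertex m i + r * v i) - quad (\<lambda>i. r * v i) / 2\<bar> \<le> \<eta> * (\<Sum>j<m. \<Sum>i<j. (r * v j - r * v i)\<^sup>2)"
    by (rule \<delta>(2)) (use v r(2)[of r] r(1) in auto)
  moreover have "(\<Sum>j<m. \<Sum>i<j. (r * v j - r * v i)\<^sup>2) = r\<^sup>2 * ?R"
    by (simp add: sum_distrib_left power_mult_distrib flip: right_diff_distrib)
  ultimately have "0 \<le> r\<^sup>2 * (quad v / 2 + \<eta> * ?R)"
    using gap_nonneg[of "\<lambda>i. vertex m i + r * v i"] by (simp add: quad_scale abs_le_iff algebra_simps)
  then have "0 \<le> quad v / 2 + \<eta> * ?R" using r(1) by (simp add: zero_le_mult_iff)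
  also have "\<dots> \<le> quad v / 2 + \<eta> * (?R + 1)" using \<eta> by simp
  also have "\<dots> = quad v / 4" using R unfolding \<eta>_def by (simp add: field_simps)
  finally show False using neg by simp
qed

lemma pos_def_neg_hess: "pos_def_form (m - 1) neg_hess"
proof (rule psd_nonsingular_imp_pos_def)
  show "neg_hess i j = neg_hess j i" for i j by (auto simp: neg_hess_curv)
  show "0 \<le> quad_form (m - 1) neg_hess w" for w
    using quad_nonneg[of "\<lambda>i. if i = 0 then 0 else w (i - 1)"] by (simp add: quad_def)
qed (rule det_neg_hess)

lemma quad_coercive:
  obtains c where "c > 0" "\<And>v i. v 0 = 0 \<Longrightarrow> i < m \<Longrightarrow> c * (v i)\<^sup>2 \<le> quad v"
proof -
  obtain c where c: "c > 0" "\<And>w i. i < m - 1 \<Longrightarrow> c * (w i)\<^sup>2 \<le> quad_form (m - 1) neg_hess w"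
    using pos_def_form_coercive[OF pos_def_neg_hess] by blast
  have "c * (v i)\<^sup>2 \<le> quad v" if v: "v 0 = 0" "i < m" for v i
    using that c(2)[of "i - 1" "\<lambda>i. v (Suc i)"] quad_nonneg[of v] by (cases i) (auto simp: quad_def)
  with c(1) show thesis using that by blast
qed

text \<open>Coercivity absorbs the sum of squared differences into the form itself, so the error
  becomes relative.\<close>

lemma gap_approx:
  assumes "\<eta> > 0"
  shows "\<exists>\<delta>>0. \<forall>v. v 0 = 0 \<and> (\<forall>i<m. \<bar>v i\<bar> \<le> \<delta>) \<longrightarrow>
    \<bar>gap m g (\<lambda>i. vertex m i + v i) - quad v / 2\<bar> \<le> \<eta> * quad v"
proof -
  obtain c where c: "c > 0" "\<And>v i. v 0 = 0 \<Longrightarrow> i < m \<Longrightarrow> c * (v i)\<^sup>2 \<le> quad v"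
    using quad_coercive by blast
  \<comment> \<open>At most \<open>m^2\<close> pairs, each squared difference being at most
    \<open>4 * (quad v / c)\<close>.\<close>
  define K where "K = (real m)\<^sup>2 * (4 / c)"
  have K: "K > 0" using c m_pos by (simp add: K_def)
  have R: "(\<Sum>j<m. \<Sum>i<j. (v j - v i)\<^sup>2) \<le> K * quad v" if v: "v 0 = 0" for v
  proof -
    have vi: "(v i)\<^sup>2 \<le> quad v / c" if "i < m" for i using c(2)[of v i, OF v that] c(1) by (simp add: field_simps)
    have one: "(v j - v i)\<^sup>2 \<le> 4 * (quad v / c)" if "j < m" "i < m" for i j
    proof -
      have "(v j - v i)\<^sup>2 \<le> 2 * (v j)\<^sup>2 + 2 * (v i)\<^sup>2"
        using zero_le_power2[of "v j + v i"] by (simp add: power2_eq_square algebra_simps)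
      then show ?thesis using vi[OF that(1)] vi[OF that(2)] by linarith
    qed
    have "(\<Sum>j<m. \<Sum>i<j. (v j - v i)\<^sup>2) \<le> (\<Sum>j<m. \<Sum>i<m. (v j - v i)\<^sup>2)"
      by (intro sum_mono sum_mono2) auto
    also have "\<dots> \<le> (\<Sum>j<m. \<Sum>i<m. 4 * (quad v / c))" using one by (intro sum_mono) auto
    also have "\<dots> = K * quad v" by (simp add: K_def power2_eq_square)
    finally show ?thesis .
  qed
  have "\<eta> / K > 0" using assms K by simp
  then obtain \<delta> where \<delta>: "\<delta> > 0" "\<And>v. v 0 = 0 \<Longrightarrow> (\<forall>i<m. \<bar>v i\<bar> \<le> \<delta>) \<Longrightarrow>
    \<bar>gap m g (\<lambda>i. vertex m i + v i) - quad v / 2\<bar> \<le> \<eta> / K * (\<Sum>j<m. \<Sum>i<j. (v j - v i)\<^sup>2)"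
    using gap_expansion'[OF \<open>\<eta> / K > 0\<close>] by blast
  have "\<eta> / K * (\<Sum>j<m. \<Sum>i<j. (v j - v i)\<^sup>2) \<le> \<eta> * quad v" if "v 0 = 0" for v
  proof -
    have "\<eta> / K * (\<Sum>j<m. \<Sum>i<j. (v j - v i)\<^sup>2) \<le> \<eta> / K * (K * quad v)"
      using R[of v, OF that] assms K by (intro mult_left_mono) auto
    then show ?thesis using K by simp
  qed
  with \<delta> show ?thesis by (meson order.trans)
qed

text \<open>With relative error 1/4 the deficit is at least \<open>quad v / 4\<close>. This gives
  the rate in the localisation and the domination in the limit of the rescaled integrals.\<close>

lemma gap_lower_bound:
  obtains c \<delta> where "c > 0" "\<delta> > 0"
    "\<And>v i. v 0 = 0 \<Longrightarrow> (\<forall>i<m. \<bar>v i\<bar> \<le> \<delta>) \<Longrightarrow> i < m \<Longrightarrow> c * (v i)\<^sup>2 \<le> gap m g (\<lambda>i. vertex m i + v i)"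
proof -
  obtain c where c: "c > 0" "\<And>v i. v 0 = 0 \<Longrightarrow> i < m \<Longrightarrow> c * (v i)\<^sup>2 \<le> quad v"
    using quad_coercive by blast
  obtain \<delta> where \<delta>: "\<delta> > 0" "\<And>v. v 0 = 0 \<Longrightarrow> (\<forall>i<m. \<bar>v i\<bar> \<le> \<delta>) \<Longrightarrow>
    \<bar>gap m g (\<lambda>i. vertex m i + v i) - quad v / 2\<bar> \<le> 1 / 4 * quad v"
    using gap_approx[of "1 / 4"] by auto
  have "c / 4 * (v i)\<^sup>2 \<le> gap m g (\<lambda>i. vertex m i + v i)" if "v 0 = 0" "\<forall>i<m. \<bar>v i\<bar> \<le> \<delta>" "i < m" for v i
    using c(2)[of v i, OF that(1,3)] \<delta>(2)[of v, OF that(1,2)] by linarith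
  then show thesis using that[of "c / 4" \<delta>] c(1) \<delta>(1) by simp
qed

text \<open>With offsets scaled by \<open>s n\<close>, the condition that the deficit is at most
  \<open>(s n)^2\<close> becomes in the limit \<open>quad v \<le> 2\<close>, up to the
  boundary.\<close>

lemma gap_limit:
  assumes v: "v 0 = 0" and s: "s \<longlonglongrightarrow> 0" "\<And>n. s n \<noteq> 0"
  shows "(\<lambda>n. gap m g (\<lambda>i. vertex m i + s n * v i) / (s n)\<^sup>2) \<longlonglongrightarrow> quad v / 2"
proof (rule LIMSEQ_I)
  fix e :: real assume e: "e > 0"
  have q: "quad v \<ge> 0" by (rule quad_nonneg[of v, OF v])
  define \<eta> where "\<eta> = e / (2 * (quad v + 1))"
  have \<eta>: "\<eta> > 0" using e q by (simp add: \<eta>_def)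
  obtain \<delta> where \<delta>: "\<delta> > 0" "\<And>v. v 0 = 0 \<Longrightarrow> (\<forall>i<m. \<bar>v i\<bar> \<le> \<delta>) \<Longrightarrow>
    \<bar>gap m g (\<lambda>i. vertex m i + v i) - quad v / 2\<bar> \<le> \<eta> * quad v"
    using gap_approx[OF \<eta>] by blast
  obtain r where r: "r > 0" "\<And>s. \<bar>s\<bar> \<le> r \<Longrightarrow> (\<forall>i<m. \<bar>s * v i\<bar> \<le> \<delta>)"
    using small_multiple[OF \<delta>(1)] by blast
  obtain n0 where n0: "\<And>n. n \<ge> n0 \<Longrightarrow> \<bar>s n\<bar> < r" using LIMSEQ_D[OF s(1) r(1)] by auto
  have "norm (gap m g (\<lambda>i. vertex m i + s n * v i) / (s n)\<^sup>2 - quad v / 2) < e" if n: "n \<ge> n0" for n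
  proof -
    have "\<bar>gap m g (\<lambda>i. vertex m i + s n * v i) - quad (\<lambda>i. s n * v i) / 2\<bar> \<le> \<eta> * quad (\<lambda>i. s n * v i)"
      by (rule \<delta>(2)) (use v r(2)[of "s n"] n0[OF n] in auto)
    then have "\<bar>gap m g (\<lambda>i. vertex m i + s n * v i) - (s n)\<^sup>2 * (quad v / 2)\<bar> \<le> (s n)\<^sup>2 * (\<eta> * quad v)"
      by (simp add: quad_scale mult_ac)
    moreover have "gap m g (\<lambda>i. vertex m i + s n * v i) / (s n)\<^sup>2 - quad v / 2
      = (gap m g (\<lambda>i. vertex m i + s n * v i) - (s n)\<^sup>2 * (quad v / 2)) / (s n)\<^sup>2"
      using s(2)[of n] by (simp add: field_simps)
    ultimately have "\<bar>gap m g (\<lambda>i. vertex m i + s n * v i) / (s n)\<^sup>2 - quad v / 2\<bar> \<le> \<eta> * quad v"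
      using s(2)[of n] by (simp add: abs_divide pos_divide_le_eq mult.commute)
    also have "\<dots> \<le> \<eta> * (quad v + 1)" using \<eta> by simp
    also have "\<dots> = e / 2" unfolding \<eta>_def using q by (simp add: field_simps)
    finally show ?thesis using e by simp
  qed
  then show "\<exists>n0. \<forall>n\<ge>n0. norm (gap m g (\<lambda>i. vertex m i + s n * v i) / (s n)\<^sup>2 - quad v / 2) < e" by blast
qed

end

subsection \<open>Localisation of almost maximal tuples\<close>

definition wrap :: "real \<Rightarrow> real" where
  "wrap x = x - 2 * pi * of_int \<lfloor>x / (2 * pi)\<rfloor>"

lemma wrap_bounds: "0 \<le> wrap x" "wrap x < 2 * pi"
proof -
  have "of_int \<lfloor>x / (2 * pi)\<rfloor> \<le> x / (2 * pi)" "x / (2 * pi) < of_int \<lfloor>x / (2 * pi)\<rfloor> + 1"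
    by linarith+
  then have "of_int \<lfloor>x / (2 * pi)\<rfloor> * (2 * pi) \<le> x" "x < (of_int \<lfloor>x / (2 * pi)\<rfloor> + 1) * (2 * pi)"
    by (simp_all only: pos_le_divide_eq[OF mult_pos_pos[OF _ pi_gt_zero]] pos_divide_less_eq[OF mult_pos_pos[OF _ pi_gt_zero]] zero_less_numeral)
  then show "0 \<le> wrap x" "wrap x < 2 * pi" by (simp_all add: wrap_def algebra_simps)
qed

lemma wrap_id: "0 \<le> x \<Longrightarrow> x < 2 * pi \<Longrightarrow> wrap x = x"
  by (simp add: wrap_def floor_eq_iff)

lemma wrap_add_multiple: "wrap (x + 2 * pi * of_int k) = wrap x"
  by (simp add: wrap_def add_divide_distrib algebra_simps)

lemma cis_wrap: "cis (wrap x) = cis x"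
proof -
  have "cis x = cis (wrap x) * cis (2 * pi * of_int \<lfloor>x / (2 * pi)\<rfloor>)"
    by (simp only: cis_mult) (simp add: wrap_def)
  then show ?thesis by (simp only: cis_multiple_2pi[OF Ints_of_int]) simp
qed

lemma wrap_diff: "\<exists>k::int. x = wrap x + 2 * pi * of_int k"
  by (intro exI[of _ "\<lfloor>x / (2 * pi)\<rfloor>"]) (simp add: wrap_def)

lemma wrap_measurable[measurable]: "wrap \<in> borel_measurable borel"
  unfolding wrap_def[abs_def] by measurable

lemma periodic_wrap:
  assumes "\<And>x. p (x + 2 * pi) = p x"
  shows "p (wrap x) = p x"
proof -
  have n: "p (x + 2 * pi * of_nat n) = p x" for n x
  proof (induction n)
    case (Suc n)
    have "p (x + 2 * pi * of_nat (Suc n)) = p (x + 2 * pi * of_nat n + 2 * pi)" by (simp add: algebra_simps)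
    then show ?case using assms Suc by simp
  qed simp
  have k: "p (x + 2 * pi * of_int k) = p x" for k x
  proof (cases "k \<ge> 0")
    case True
    then show ?thesis using n[of x "nat k"] by simp
  next
    case False
    then show ?thesis using n[of "x + 2 * pi * of_int k" "nat (- k)"] by simp
  qed
  show ?thesis using wrap_diff[of x] k[of "wrap x"] by metis
qed

text \<open>Lebesgue measure of one period, regarded as a measure on the whole line so that sums and
  differences of angles stay in its space.\<close>

definition circle_angle :: "real measure" where
  "circle_angle = density lborel (indicator {0..<2 * pi})"

lemma sets_circle_angle[simp, measurable_cong]: "sets circle_angle = sets borel"
  by (simp add: circle_angle_def)

lemma space_circle_angle[simp]: "space circle_angle = UNIV"
  by (simp add: circle_angle_def)

lemma finite_measure_circle_angle: "finite_measure circle_angle"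
  by (rule finite_measureI) (simp add: circle_angle_def emeasure_density)

text \<open>A rotation by \<open>a\<close> in one period cuts the interval into two pieces, one
  translated by \<open>a\<close> and the other by \<open>a - 2 * pi\<close>; the images tile the
  period again.\<close>

lemma circle_angle_rotate: "distr circle_angle borel (\<lambda>y. wrap (x + y)) = circle_angle"
proof (rule measure_eqI)
  fix A assume "A \<in> sets (distr circle_angle borel (\<lambda>y. wrap (x + y)))"
  then have A[measurable]: "A \<in> sets borel" by simp
  define a where "a = wrap x"
  have a: "0 \<le> a" "a < 2 * pi" using wrap_bounds by (auto simp: a_def)
  have wa: "wrap (x + y) = wrap (a + y)" for y
  proof -
    obtain k :: int where "x = a + 2 * pi * of_int k" using wrap_diff a_def by blast
    then have "x + y = (a + y) + 2 * pi * of_int k" by simp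
    then show ?thesis using wrap_add_multiple by metis
  qed
  have w2: "wrap z = z - 2 * pi" if "2 * pi \<le> z" "z < 4 * pi" for z
    using wrap_add_multiple[of "z - 2 * pi" 1] wrap_id[of "z - 2 * pi"] that by simp
  have Aw[measurable]: "(\<lambda>y. wrap (x + y)) -` A \<in> sets borel"
    using measurable_sets[of "\<lambda>y. wrap (x + y)" borel borel A] by simp
  have "emeasure (distr circle_angle borel (\<lambda>y. wrap (x + y))) A
    = emeasure circle_angle ((\<lambda>y. wrap (x + y)) -` A)"
    by (subst emeasure_distr) auto
  also have "\<dots> = (\<integral>\<^sup>+y. indicator {0..<2 * pi} y * indicator A (wrap (x + y)) \<partial>lborel)"
    unfolding circle_angle_def by (subst emeasure_density) (auto simp: indicator_def intro!: nn_integral_cong)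
  also have "\<dots> = (\<integral>\<^sup>+z. indicator {a..<a + 2 * pi} z * indicator A (wrap z) \<partial>lborel)"
    by (subst nn_integral_real_affine[of _ 1 a]) (auto simp: wa indicator_def intro!: nn_integral_cong)
  also have "\<dots> = (\<integral>\<^sup>+z. indicator {a..<2 * pi} z * indicator A z + indicator {2 * pi..<a + 2 * pi} z * indicator A (z - 2 * pi) \<partial>lborel)"
    using a by (intro nn_integral_cong) (auto simp: indicator_def wrap_id w2)
  also have "\<dots> = (\<integral>\<^sup>+z. indicator {a..<2 * pi} z * indicator A z \<partial>lborel)
      + (\<integral>\<^sup>+z. indicator {2 * pi..<a + 2 * pi} z * indicator A (z - 2 * pi) \<partial>lborel)"
    by (rule nn_integral_add) measurable
  also have "(\<integral>\<^sup>+z. indicator {2 * pi..<a + 2 * pi} z * indicator A (z - 2 * pi) \<partial>lborel)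
    = (\<integral>\<^sup>+z. indicator {0..<a} z * indicator A z \<partial>lborel)"
    by (subst nn_integral_real_affine[of _ 1 "2 * pi"]) (auto simp: indicator_def intro!: nn_integral_cong)
  also have "(\<integral>\<^sup>+z. indicator {a..<2 * pi} z * indicator A z \<partial>lborel) + (\<integral>\<^sup>+z. indicator {0..<a} z * indicator A z \<partial>lborel)
    = (\<integral>\<^sup>+z. indicator {a..<2 * pi} z * indicator A z + indicator {0..<a} z * indicator A z \<partial>lborel)"
    by (rule nn_integral_add[symmetric]) measurable
  also have "\<dots> = (\<integral>\<^sup>+z. indicator {0..<2 * pi} z * indicator A z \<partial>lborel)"
    using a by (intro nn_integral_cong) (auto simp: indicator_def)
  also have "\<dots> = emeasure circle_angle A"
    unfolding circle_angle_def by (subst emeasure_density) auto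
  finally show "emeasure (distr circle_angle borel (\<lambda>y. wrap (x + y))) A = emeasure circle_angle A" .
qed simp

lemma PiM_circle_angle_rotate:
  assumes "finite I"
  shows "distr (PiM I (\<lambda>_. circle_angle)) (PiM I (\<lambda>_. borel)) (\<lambda>b. \<lambda>i\<in>I. wrap (x + b i)) = PiM I (\<lambda>_. circle_angle)"
proof -
  have sf: "product_sigma_finite (\<lambda>_. circle_angle)"
    by (rule product_sigma_finite.intro) (rule finite_measure.axioms(1)[OF finite_measure_circle_angle])
  have "distr (PiM I (\<lambda>_. circle_angle)) (PiM I (\<lambda>_. borel)) (\<lambda>b. \<lambda>i\<in>I. wrap (x + b i))
    = PiM I (\<lambda>i. distr circle_angle borel (\<lambda>y. wrap (x + y)))"
    by (rule distr_PiM_coordinatewise) (auto simp: circle_angle_rotate sf assms)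
  then show ?thesis by (simp add: circle_angle_rotate)
qed

section \<open>Compactness and the square-root rate\<close>

context polygon_kernel
begin

lemma gap_permute:
  assumes "\<tau> permutes {1..<m}"
  shows "gap m g (\<lambda>i. x (\<tau> i)) = gap m g x"
proof -
  have "\<tau> permutes {..<m}" using assms by (rule permutes_subset) auto
  then show ?thesis using angle_sum_permute[of \<tau> m g x] by (simp add: gap_def permutes_imp_bij)
qed

lemma gap_rotate:
  assumes "\<And>i. i < m \<Longrightarrow> cis (x i) = cis (c + y i)"
  shows "gap m g x = gap m g y"
proof -
  have "angle_sum m g x = angle_sum m g (\<lambda>i. c + y i)" by (rule angle_sum_cong) (rule assms)
  then show ?thesis by (simp add: gap_def angle_sum_translate)
qed

lemma continuous_gap: "continuous_on UNIV (gap m g)"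
proof -
  have "continuous_on UNIV (\<lambda>x. circ g (x j - x i))" for i j :: nat
    by (rule continuous_on_compose2[OF continuous_circ]) (auto intro!: continuous_intros continuous_on_product_coordinates)
  then show ?thesis
    unfolding gap_def[abs_def] angle_sum_def[abs_def] by (intro continuous_intros)
qed

lemma measurable_gap[measurable]: "gap m g \<in> borel_measurable (PiM {..<m} (\<lambda>_. borel))"
proof -
  have c[measurable]: "circ g \<in> borel_measurable borel"
    by (rule borel_measurable_continuous_onI[OF continuous_circ])
  have "(\<lambda>x. circ g (x j - x i)) \<in> borel_measurable (PiM {..<m} (\<lambda>_. borel))" if "i < m" "j < m" for i j
    using that measurable_component_singleton[of _ "{..<m}" "\<lambda>_. borel :: real measure"]
    by (intro measurable_compose[OF _ c] borel_measurable_diff) auto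
  then have "(\<lambda>x. (\<Sum>j<m. \<Sum>i<j. circ g (x j - x i))) \<in> borel_measurable (PiM {..<m} (\<lambda>_. borel))"
    by (intro borel_measurable_sum) auto
  then show ?thesis unfolding gap_def[abs_def] angle_sum_def[abs_def] by (intro borel_measurable_diff borel_measurable_const)
qed

text \<open>On the cube of offsets outside neighbourhoods of the finitely many zeros, the continuous
  deficit has a positive minimum \<mu>, so a deficit below \<mu> forces the tuple near some
  relabelled polygon. There the quadratic lower bound improves nearness to O(sqrt
  \<epsilon>).\<close>

lemma gap_localize:
  "\<exists>C>0. \<exists>\<epsilon>0>0. \<forall>\<epsilon> b. 0 \<le> \<epsilon> \<and> \<epsilon> < \<epsilon>0 \<and> b 0 = 0 \<and> (\<forall>i\<in>{1..<m}. b i \<in> {0..2 * pi}) \<and> gap m g b \<le> \<epsilon> \<longrightarrow>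
    (\<exists>\<tau>. \<tau> permutes {1..<m} \<and> (\<forall>i\<in>{1..<m}. \<bar>b i - vertex m (\<tau> i)\<bar> \<le> C * sqrt \<epsilon>))"
proof -
  obtain c \<delta> where c: "c > 0" and \<delta>: "\<delta> > 0" and lower:
    "\<And>v i. v 0 = 0 \<Longrightarrow> (\<forall>i<m. \<bar>v i\<bar> \<le> \<delta>) \<Longrightarrow> i < m \<Longrightarrow> c * (v i)\<^sup>2 \<le> gap m g (\<lambda>i. vertex m i + v i)"
    by (rule gap_lower_bound) (rule that; assumption)
  \<comment> \<open>Tuples are functions on all of \<open>nat\<close>; pinning the coordinates
    outside \<open>{1..<m}\<close> to 0 makes the cube compact in the product topology.\<close>
  define K where "K = PiE UNIV (\<lambda>i. if i \<in> {1..<m} then {0..2 * pi} else {0::real})"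
  define N where "N = (\<Union>\<tau>\<in>{\<tau>. \<tau> permutes {1..<m}}. \<Inter>i\<in>{1..<m}. {b :: nat \<Rightarrow> real. \<bar>b i - vertex m (\<tau> i)\<bar> < \<delta>})"
  have "compactin (product_topology (\<lambda>i. euclidean) UNIV) K"
    unfolding K_def compactin_PiE by auto
  then have K: "compact K" by (simp add: euclidean_product_topology)
  have N: "open N"
    unfolding N_def by (intro open_UN ballI open_INT open_Collect_less continuous_intros continuous_on_product_coordinates) auto
  have "\<exists>\<mu>>0. \<forall>b\<in>K - N. \<mu> \<le> gap m g b"
  proof (cases "K - N = {}")
    case False
    have "compact (K - N)" using K N by (rule compact_diff)
    then obtain b where b: "b \<in> K - N" "\<And>y. y \<in> K - N \<Longrightarrow> gap m g b \<le> gap m g y"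
      using continuous_attains_inf[OF _ False continuous_on_subset[OF continuous_gap]] by blast
    have "gap m g b \<noteq> 0"
    proof
      assume "gap m g b = 0"
      moreover have "b 0 = 0" "\<And>i. i \<in> {1..<m} \<Longrightarrow> b i \<in> {0..2 * pi}"
        using b(1) by (auto simp: K_def PiE_iff split: if_splits dest: spec)
      ultimately obtain \<tau> where "\<tau> permutes {1..<m}" "\<forall>i\<in>{1..<m}. b i = vertex m (\<tau> i)"
        using gap_zero_permutation by blast
      then have "b \<in> N" unfolding N_def using \<delta> by auto
      then show False using b(1) by simp
    qed
    then have "gap m g b > 0" using gap_nonneg[of b] by simp
    then show ?thesis using b(2) by blast
  qed (auto intro: exI[of _ 1])
  then obtain \<mu> where \<mu>: "\<mu> > 0" "\<And>b. b \<in> K - N \<Longrightarrow> \<mu> \<le> gap m g b" by blast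
  have "\<exists>\<tau>. \<tau> permutes {1..<m} \<and> (\<forall>i\<in>{1..<m}. \<bar>b i - vertex m (\<tau> i)\<bar> \<le> 1 / sqrt c * sqrt \<epsilon>)"
    if \<epsilon>: "0 \<le> \<epsilon>" "\<epsilon> < \<mu>" and b: "b 0 = 0" "\<forall>i\<in>{1..<m}. b i \<in> {0..2 * pi}" "gap m g b \<le> \<epsilon>" for \<epsilon> b
  proof -
    \<comment> \<open>Replaces the arbitrary values beyond index \<open>m\<close> by those pinned in
      \<open>K\<close>; the deficit does not see them.\<close>
    define b' where "b' i = (if i \<in> {1..<m} then b i else 0)" for i
    have gb: "gap m g b' = gap m g b" by (rule gap_cong) (use b(1) in \<open>auto simp: b'_def Suc_le_eq\<close>)
    have "b' \<in> K" using b(2) by (auto simp: K_def b'_def)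
    then have "b' \<in> N" using \<mu>(2)[of b'] gb b(3) \<epsilon>(2) by force
    then obtain \<tau> where \<tau>: "\<tau> permutes {1..<m}" "\<And>i. i \<in> {1..<m} \<Longrightarrow> \<bar>b' i - vertex m (\<tau> i)\<bar> < \<delta>"
      unfolding N_def by blast
    \<comment> \<open>Relabelling by the inverse puts the points into the standard cyclic order,
      around which the quadratic bound is stated.\<close>
    define \<rho> where "\<rho> = Hilbert_Choice.inv \<tau>"
    define v where "v i = (if i \<in> {1..<m} then b (\<rho> i) - vertex m i else 0)" for i
    have inv: "\<rho> permutes {1..<m}" unfolding \<rho>_def using \<tau>(1) by (rule permutes_inv)
    have inI: "\<rho> i \<in> {1..<m}" if "i \<in> {1..<m}" for i using inv that permutes_in_image by metis
    have ti: "\<tau> (\<rho> i) = i" for i using permutes_inverses(1)[OF \<tau>(1)] by (simp add: \<rho>_def)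
    have it: "\<rho> (\<tau> i) = i" for i using permutes_inverses(2)[OF \<tau>(1)] by (simp add: \<rho>_def)
    have v0: "v 0 = 0" by (simp add: v_def)
    have v\<delta>: "\<forall>i<m. \<bar>v i\<bar> \<le> \<delta>"
    proof (intro allI impI)
      fix i assume "i < m"
      then show "\<bar>v i\<bar> \<le> \<delta>"
        using \<tau>(2)[of "\<rho> i"] inI[of i] \<delta> by (cases "i \<in> {1..<m}") (auto simp: v_def b'_def ti)
    qed
    have "gap m g (\<lambda>i. vertex m i + v i) = gap m g (\<lambda>i. b (\<rho> i))"
    proof (rule gap_cong)
      fix i assume "i < m"
      show "vertex m i + v i = b (\<rho> i)"
      proof (cases "i = 0")
        case True
        have "\<rho> 0 = 0" using inv by (simp add: permutes_def)
        then show ?thesis using True b(1) by (simp add: v_def vertex_def)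
      qed (use \<open>i < m\<close> in \<open>auto simp: v_def\<close>)
    qed
    also have "\<dots> = gap m g b" by (rule gap_permute[OF inv])
    finally have gv: "gap m g (\<lambda>i. vertex m i + v i) \<le> \<epsilon>" using b(3) by simp
    have "\<bar>b i - vertex m (\<tau> i)\<bar> \<le> 1 / sqrt c * sqrt \<epsilon>" if i: "i \<in> {1..<m}" for i
    proof -
      have ti: "\<tau> i \<in> {1..<m}" using \<tau>(1) i permutes_in_image by metis
      have "c * (v (\<tau> i))\<^sup>2 \<le> \<epsilon>"
        using lower[of v "\<tau> i", OF v0 v\<delta>] ti gv by force
      then have "(v (\<tau> i))\<^sup>2 \<le> \<epsilon> / c" using c by (simp add: field_simps)
      then have "\<bar>v (\<tau> i)\<bar> \<le> sqrt (\<epsilon> / c)" using real_sqrt_le_mono[of "(v (\<tau> i))\<^sup>2"] by simp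
      then show ?thesis using ti c by (simp add: v_def it real_sqrt_divide)
    qed
    with \<tau>(1) show ?thesis by blast
  qed
  with \<mu>(1) c show ?thesis
    by (intro exI[of _ "1 / sqrt c"] conjI exI[of _ \<mu>]) auto
qed

text \<open>A form of the localisation in which no point is the root and the angles are arbitrary
  real lifts. For overlapping hits, the shared index need not be the first in either subset.\<close>

lemma gap_pairs:
  "\<exists>C>0. \<exists>\<epsilon>0>0. \<forall>\<epsilon> x. 0 \<le> \<epsilon> \<and> \<epsilon> < \<epsilon>0 \<and> gap m g x \<le> \<epsilon> \<longrightarrow>
    (\<forall>i<m. \<forall>j<m. \<exists>k::int. \<bar>x j - x i - 2 * pi * of_int k / real m\<bar> \<le> C * sqrt \<epsilon>)"
proof -
  obtain C \<epsilon>0 where C: "C > 0" "\<epsilon>0 > 0" and loc: "\<And>\<epsilon> b. 0 \<le> \<epsilon> \<Longrightarrow> \<epsilon> < \<epsilon>0 \<Longrightarrow> b 0 = 0 \<Longrightarrow>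
      (\<forall>i\<in>{1..<m}. b i \<in> {0..2 * pi}) \<Longrightarrow> gap m g b \<le> \<epsilon> \<Longrightarrow>
      \<exists>\<tau>. \<tau> permutes {1..<m} \<and> (\<forall>i\<in>{1..<m}. \<bar>b i - vertex m (\<tau> i)\<bar> \<le> C * sqrt \<epsilon>)"
    using gap_localize by blast
  have "\<exists>k::int. \<bar>x j - x i - 2 * pi * of_int k / real m\<bar> \<le> 2 * C * sqrt \<epsilon>"
    if \<epsilon>: "0 \<le> \<epsilon>" "\<epsilon> < \<epsilon>0" "gap m g x \<le> \<epsilon>" and ij: "i < m" "j < m" for \<epsilon> x i j
  proof -
    define b where "b i = wrap (x i - x 0)" for i
    have "gap m g b = gap m g x" by (rule gap_rotate[where c = "- x 0"]) (simp add: b_def cis_wrap)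
    moreover have "b 0 = 0" by (simp add: b_def wrap_id)
    moreover have "\<forall>i\<in>{1..<m}. b i \<in> {0..2 * pi}" using wrap_bounds by (auto simp: b_def less_imp_le)
    ultimately obtain \<tau> where \<tau>: "\<tau> permutes {1..<m}" "\<And>i. i \<in> {1..<m} \<Longrightarrow> \<bar>b i - vertex m (\<tau> i)\<bar> \<le> C * sqrt \<epsilon>"
      using loc[of \<epsilon> b] \<epsilon> by auto
    have near: "\<exists>k::int. \<bar>x i - x 0 - 2 * pi * of_int k / real m\<bar> \<le> C * sqrt \<epsilon>" if "i < m" for i
    proof -
      have "\<exists>l::nat. \<bar>b i - vertex m l\<bar> \<le> C * sqrt \<epsilon>"
      proof (cases "i = 0")
        case True
        then show ?thesis using \<open>b 0 = 0\<close> C \<epsilon>(1) by (intro exI[of _ 0]) (simp add: vertex_def)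
      qed (use \<tau>(2)[of i] that in auto)
      then obtain l :: nat where l: "\<bar>b i - vertex m l\<bar> \<le> C * sqrt \<epsilon>" by blast
      obtain k :: int where k: "x i - x 0 = b i + 2 * pi * of_int k" using wrap_diff b_def by metis
      \<comment> \<open>A full turn amounts to \<open>m\<close> steps of the polygon.\<close>
      have "x i - x 0 - 2 * pi * of_int (int l + k * int m) / real m = b i - vertex m l"
        using m_pos k by (simp add: vertex_def field_simps)
      then show ?thesis using l by metis
    qed
    obtain k1 k2 :: int where k: "\<bar>x i - x 0 - 2 * pi * of_int k1 / real m\<bar> \<le> C * sqrt \<epsilon>"
      "\<bar>x j - x 0 - 2 * pi * of_int k2 / real m\<bar> \<le> C * sqrt \<epsilon>"
      using near[OF ij(1)] near[OF ij(2)] by blast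
    have "2 * pi * of_int (k2 - k1) / real m = 2 * pi * of_int k2 / real m - 2 * pi * of_int k1 / real m"
      by (simp add: diff_divide_distrib right_diff_distrib)
    then have "\<bar>x j - x i - 2 * pi * of_int (k2 - k1) / real m\<bar> \<le> 2 * C * sqrt \<epsilon>" using k by linarith
    then show ?thesis by blast
  qed
  with C show ?thesis by (intro exI[of _ "2 * C"] conjI exI[of _ \<epsilon>0]) auto
qed

end

subsection \<open>The probability of a hit\<close>

locale polygon_sample = polygon_kernel +
  fixes p :: "real \<Rightarrow> real"
  assumes p_cont: "continuous_on UNIV p"
    and p_nonneg: "p x \<ge> 0"
    and p_periodic: "p (x + 2 * pi) = p x"
    and p_integral: "(p has_integral 1) {0..2 * pi}"
begin

lemma p_measurable[measurable]: "p \<in> borel_measurable borel"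
  by (rule borel_measurable_continuous_onI[OF p_cont])

lemma p_bounded: "\<exists>B>0. \<forall>x. p x \<le> B"
proof -
  have "compact (p ` {0..2 * pi})"
    by (intro compact_continuous_image continuous_on_subset[OF p_cont]) auto
  then obtain B where B: "\<And>x. x \<in> {0..2 * pi} \<Longrightarrow> \<bar>p x\<bar> \<le> B"
    using compact_imp_bounded bounded_real by (metis imageI)
  have "p x \<le> max B 1" for x
    using B[of "wrap x"] wrap_bounds[of x] periodic_wrap[of p x, OF p_periodic] by auto
  then show ?thesis by (intro exI[of _ "max B 1"]) auto
qed

definition law :: "real measure" where
  "law = density circle_angle (\<lambda>x. ennreal (p x))"

lemma law_lborel: "law = density lborel (\<lambda>x. indicator {0..<2 * pi} x * ennreal (p x))"
  unfolding law_def circle_angle_def by (subst density_density_eq) auto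

lemma sets_law[simp, measurable_cong]: "sets law = sets borel"
  by (simp add: law_def)

lemma space_law[simp]: "space law = UNIV"
  by (simp add: law_def)

lemma nn_integral_Ico_eq_Icc:
  "(\<integral>\<^sup>+x. indicator {0..<2 * pi} x * f x \<partial>lborel) = (\<integral>\<^sup>+x. indicator {0..2 * pi} x * f x \<partial>lborel)"
proof (rule nn_integral_cong_AE)
  have "AE x in lborel. x \<noteq> 2 * pi" by (rule AE_lborel_singleton)
  then show "AE x in lborel. indicator {0..<2 * pi} x * f x = indicator {0..2 * pi} x * f x"
    by eventually_elim (auto simp: indicator_def)
qed

lemma prob_space_law: "prob_space law"
proof
  have "emeasure law (space law) = (\<integral>\<^sup>+x. indicator {0..<2 * pi} x * ennreal (p x) \<partial>lborel)"
    unfolding law_lborel by (simp add: emeasure_density)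
  also have "\<dots> = (\<integral>\<^sup>+x. ennreal (indicator {0..2 * pi} x * p x) \<partial>lborel)"
    unfolding nn_integral_Ico_eq_Icc by (intro nn_integral_cong) (auto simp: indicator_def)
  also have "\<dots> = 1"
    using nn_integral_has_integral_lebesgue[OF p_nonneg p_integral] by simp
  finally show "emeasure law (space law) = 1" .
qed

lemma product_sigma_finite_circle: "product_sigma_finite (\<lambda>_. circle_angle)"
  by (rule product_sigma_finite.intro) (rule finite_measure.axioms(1)[OF finite_measure_circle_angle])

lemma product_sigma_finite_law: "product_sigma_finite (\<lambda>_. law)"
proof (rule product_sigma_finite.intro)
  interpret prob_space law by (rule prob_space_law)
  show "sigma_finite_measure law" by (rule sigma_finite_measure_axioms)
qed

lemma lessThan_m: "{..<m} = insert 0 {1..<m}"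
  using m_pos by auto

lemma measurable_gap0: "(\<lambda>b. gap m g (b(0 := 0))) \<in> borel_measurable (PiM {1..<m} (\<lambda>_. borel))"
proof -
  have "(\<lambda>b. (\<lambda>(f, y). f(0 := y)) (b, 0 :: real)) \<in> measurable (PiM {1..<m} (\<lambda>_. borel)) (PiM (insert 0 {1..<m}) (\<lambda>_. borel))"
    by (rule measurable_compose[OF _ measurable_add_dim]) measurable
  then show ?thesis using measurable_gap unfolding lessThan_m[symmetric]
    by (intro measurable_compose[OF _ measurable_gap]) simp
qed

text \<open>The likelihood of the offsets \<open>b\<close> from the root, integrated over the angle of the root.\<close>

definition overlap :: "(nat \<Rightarrow> real) \<Rightarrow> ennreal" where
  "overlap b = (\<integral>\<^sup>+x. indicator {0..<2 * pi} x * (ennreal (p x) * (\<Prod>i\<in>{1..<m}. ennreal (p (x + b i)))) \<partial>lborel)"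

lemma comp_measurable: "i \<in> I \<Longrightarrow> (\<lambda>b. b i :: real) \<in> borel_measurable (PiM I (\<lambda>_. borel))"
  using measurable_component_singleton[of i I "\<lambda>_. borel :: real measure"] by simp

lemma measurable_PiM_borel_cong:
  "sets N = sets borel \<Longrightarrow> measurable (PiM I (\<lambda>_. N)) L = measurable (PiM I (\<lambda>_. borel)) L"
  by (intro measurable_cong_sets sets_PiM_cong) auto

lemma overlap_joint_measurable:
  "(\<lambda>(x, b). indicator {0..<2 * pi} x * (ennreal (p x) * (\<Prod>i\<in>{1..<m}. ennreal (p (x + b i)))))
    \<in> borel_measurable (borel \<Otimes>\<^sub>M PiM {1..<m} (\<lambda>_. borel))"
proof -
  have [measurable]: "(\<lambda>z. fst z + snd z i) \<in> borel_measurable (borel \<Otimes>\<^sub>M PiM {1..<m} (\<lambda>_. borel :: real measure))"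
    if "i \<in> {1..<m}" for i
    using comp_measurable[OF that] by (intro borel_measurable_add measurable_fst) (auto intro: measurable_compose[OF measurable_snd])
  have "(\<lambda>z. \<Prod>i\<in>{1..<m}. ennreal (p (fst z + snd z i))) \<in> borel_measurable (borel \<Otimes>\<^sub>M PiM {1..<m} (\<lambda>_. borel))"
    by (intro borel_measurable_prod_ennreal) measurable
  then show ?thesis unfolding case_prod_beta by measurable
qed

lemma measurable_overlap: "overlap \<in> borel_measurable (PiM {1..<m} (\<lambda>_. borel))"
proof -
  have "(\<lambda>(b, x). indicator {0..<2 * pi} x * (ennreal (p x) * (\<Prod>i\<in>{1..<m}. ennreal (p (x + b i)))))
    \<in> borel_measurable (PiM {1..<m} (\<lambda>_. borel) \<Otimes>\<^sub>M lborel)"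
    using measurable_compose[OF measurable_pair_swap' overlap_joint_measurable]
    by (simp add: case_prod_beta cong: measurable_cong_sets)
  then show ?thesis unfolding overlap_def[abs_def] by (rule lborel.borel_measurable_nn_integral)
qed

text \<open>For a fixed angle of the root, rotating the other angles preserves their reference
  measure and turns the deficit into a function of the offsets only. The rotation then enters solely
  through the densities, and integrating over it first leaves \<open>overlap\<close>.\<close>

lemma hit_eq:
  "emeasure (PiM {..<m} (\<lambda>_. law)) {x \<in> space (PiM {..<m} (\<lambda>_. law)). gap m g x \<le> \<epsilon>}
  = (\<integral>\<^sup>+b. (\<Prod>i\<in>{1..<m}. indicator {0..<2 * pi} (b i)) * (indicator {..\<epsilon>} (gap m g (b(0 := 0))) * overlap b)
      \<partial>PiM {1..<m} (\<lambda>_. lborel))"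
proof -
  let ?I = "{1..<m}"
  let ?C = "PiM ?I (\<lambda>_. circle_angle)"
  interpret law: product_sigma_finite "\<lambda>_. law" by (rule product_sigma_finite_law)
  interpret circ: product_sigma_finite "\<lambda>_. circle_angle" by (rule product_sigma_finite_circle)
  interpret C: sigma_finite_measure ?C by (rule circ.sigma_finite) simp
  interpret P: pair_sigma_finite lborel ?C by standard
  define h where "h x = (indicator {..\<epsilon>} (gap m g x) :: ennreal)" for x
  define w where "w x b = (ennreal (p x) * (\<Prod>i\<in>?I. ennreal (p (x + b i))))" for x b
  have hm: "h \<in> borel_measurable (PiM {..<m} (\<lambda>_. law))"
    unfolding h_def measurable_PiM_borel_cong[OF sets_law] by measurable
  have h0m: "(\<lambda>b. h (b(0 := 0))) \<in> borel_measurable (PiM ?I (\<lambda>_. borel))"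
    unfolding h_def using measurable_gap0 by measurable
  have setsC: "sets ?C = sets (PiM ?I (\<lambda>_. borel))" by (intro sets_PiM_cong) auto
  \<comment> \<open>The law is written as a density over \<open>circle_angle\<close> before
    rotating, since the law itself is not rotation invariant.\<close>
  have inner: "(\<integral>\<^sup>+b. h (b(0 := y)) \<partial>PiM ?I (\<lambda>_. law)) = (\<integral>\<^sup>+b. (\<Prod>i\<in>?I. ennreal (p (y + b i))) * h (b(0 := 0)) \<partial>?C)" for y
  proof -
    have hy: "(\<lambda>b. h (b(0 := y))) \<in> borel_measurable (PiM ?I (\<lambda>_. borel))"
    proof -
      have "(\<lambda>b. (\<lambda>(f, y). f(0 := y)) (b, y)) \<in> measurable (PiM ?I (\<lambda>_. borel)) (PiM (insert 0 ?I) (\<lambda>_. borel))"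
        by (rule measurable_compose[OF _ measurable_add_dim]) measurable
      then show ?thesis using hm unfolding lessThan_m[symmetric] measurable_PiM_borel_cong[OF sets_law]
        by (auto intro: measurable_compose)
    qed
    have pm: "(\<lambda>b. \<Prod>i\<in>?I. ennreal (p (b i))) \<in> borel_measurable (PiM ?I (\<lambda>_. borel))"
      using comp_measurable by (intro borel_measurable_prod_ennreal) measurable
    have rot: "(\<lambda>b. \<lambda>i\<in>?I. wrap (y + b i)) \<in> measurable (PiM ?I (\<lambda>_. borel)) (PiM ?I (\<lambda>_. borel))"
      using comp_measurable[of _ ?I] by (intro measurable_restrict) measurable
    have "PiM ?I (\<lambda>_. law) = density ?C (\<lambda>b. \<Prod>i\<in>?I. ennreal (p (b i)))"
      unfolding law_def
      by (rule PiM_density_const) (auto intro: circ.sigma_finite_measures law.sigma_finite_measures simp flip: law_def)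
    then have "(\<integral>\<^sup>+b. h (b(0 := y)) \<partial>PiM ?I (\<lambda>_. law)) = (\<integral>\<^sup>+b. (\<Prod>i\<in>?I. ennreal (p (b i))) * h (b(0 := y)) \<partial>?C)"
      using hy pm by (simp add: nn_integral_density measurable_PiM_borel_cong[OF sets_circle_angle])
    also have "\<dots> = (\<integral>\<^sup>+b. (\<Prod>i\<in>?I. ennreal (p (b i))) * h (b(0 := y)) \<partial>distr ?C (PiM ?I (\<lambda>_. borel)) (\<lambda>b. \<lambda>i\<in>?I. wrap (y + b i)))"
      by (subst PiM_circle_angle_rotate) auto
    also have "\<dots> = (\<integral>\<^sup>+b. (\<Prod>i\<in>?I. ennreal (p ((\<lambda>i\<in>?I. wrap (y + b i)) i))) * h ((\<lambda>i\<in>?I. wrap (y + b i))(0 := y)) \<partial>?C)"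
      using hy pm rot by (subst nn_integral_distr) (auto simp: measurable_PiM_borel_cong[OF sets_circle_angle])
    also have "\<dots> = (\<integral>\<^sup>+b. (\<Prod>i\<in>?I. ennreal (p (y + b i))) * h (b(0 := 0)) \<partial>?C)"
    proof (rule nn_integral_cong)
      fix b
      have "gap m g ((\<lambda>i\<in>?I. wrap (y + b i))(0 := y)) = gap m g (b(0 := 0))"
        by (rule gap_rotate[where c = y]) (auto simp: cis_wrap)
      then show "(\<Prod>i\<in>?I. ennreal (p ((\<lambda>i\<in>?I. wrap (y + b i)) i))) * h ((\<lambda>i\<in>?I. wrap (y + b i))(0 := y))
        = (\<Prod>i\<in>?I. ennreal (p (y + b i))) * h (b(0 := 0))"
        by (simp add: h_def periodic_wrap[of p, OF p_periodic])
    qed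
    finally show ?thesis .
  qed
  have wm: "(\<lambda>(x, b). indicator {0..<2 * pi} x * (w x b * h (b(0 := 0)))) \<in> borel_measurable (lborel \<Otimes>\<^sub>M ?C)"
  proof -
    have "(\<lambda>z. (\<lambda>(x, b). indicator {0..<2 * pi} x * w x b) z * h ((snd z)(0 := 0)))
      \<in> borel_measurable (borel \<Otimes>\<^sub>M PiM ?I (\<lambda>_. borel))"
      using overlap_joint_measurable h0m unfolding w_def
      by (intro borel_measurable_times_ennreal) (auto intro: measurable_compose[OF measurable_snd])
    moreover have "sets (lborel \<Otimes>\<^sub>M ?C) = sets (borel \<Otimes>\<^sub>M PiM ?I (\<lambda>_. borel))"
      by (intro sets_pair_measure_cong setsC) simp
    ultimately show ?thesis
      by (simp add: case_prod_beta mult.assoc cong: measurable_cong_sets)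
  qed
  have "emeasure (PiM {..<m} (\<lambda>_. law)) {x \<in> space (PiM {..<m} (\<lambda>_. law)). gap m g x \<le> \<epsilon>}
    = (\<integral>\<^sup>+x. indicator {x \<in> space (PiM {..<m} (\<lambda>_. law)). gap m g x \<le> \<epsilon>} x \<partial>PiM {..<m} (\<lambda>_. law))"
    using measurable_gap unfolding measurable_PiM_borel_cong[OF sets_law, symmetric]
    by (intro nn_integral_indicator[symmetric]) measurable
  also have "\<dots> = (\<integral>\<^sup>+x. h x \<partial>PiM {..<m} (\<lambda>_. law))"
    by (intro nn_integral_cong) (auto simp: h_def indicator_def)
  also have "\<dots> = (\<integral>\<^sup>+y. \<integral>\<^sup>+b. h (b(0 := y)) \<partial>PiM ?I (\<lambda>_. law) \<partial>law)"
    using hm unfolding lessThan_m by (intro law.product_nn_integral_insert_rev) auto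
  also have "\<dots> = (\<integral>\<^sup>+y. indicator {0..<2 * pi} y * ennreal (p y) * (\<integral>\<^sup>+b. (\<Prod>i\<in>?I. ennreal (p (y + b i))) * h (b(0 := 0)) \<partial>?C) \<partial>lborel)"
  proof -
    have "(\<lambda>z. (\<lambda>(x, b). \<Prod>i\<in>?I. ennreal (p (x + b i))) z * h ((snd z)(0 := 0)))
      \<in> borel_measurable (borel \<Otimes>\<^sub>M PiM ?I (\<lambda>_. borel))"
    proof (intro borel_measurable_times_ennreal)
      have "(\<lambda>z. fst z + snd z i) \<in> borel_measurable (borel \<Otimes>\<^sub>M PiM ?I (\<lambda>_. borel :: real measure))" if "i \<in> ?I" for i
        using comp_measurable[OF that] by (intro borel_measurable_add measurable_fst) (auto intro: measurable_compose[OF measurable_snd])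
      then show "(\<lambda>(x, b). \<Prod>i\<in>?I. ennreal (p (x + b i))) \<in> borel_measurable (borel \<Otimes>\<^sub>M PiM ?I (\<lambda>_. borel))"
        unfolding case_prod_beta by (intro borel_measurable_prod_ennreal) measurable
    qed (use h0m in \<open>auto intro: measurable_compose[OF measurable_snd]\<close>)
    moreover have "sets (lborel \<Otimes>\<^sub>M ?C) = sets (borel \<Otimes>\<^sub>M PiM ?I (\<lambda>_. borel))"
      by (intro sets_pair_measure_cong setsC) simp
    ultimately have "(\<lambda>(x, b). (\<Prod>i\<in>?I. ennreal (p (x + b i))) * h (b(0 := 0))) \<in> borel_measurable (lborel \<Otimes>\<^sub>M ?C)"
      by (simp add: case_prod_beta cong: measurable_cong_sets)
    then have "(\<lambda>y. \<integral>\<^sup>+b. (\<Prod>i\<in>?I. ennreal (p (y + b i))) * h (b(0 := 0)) \<partial>?C) \<in> borel_measurable lborel"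
      by (rule C.borel_measurable_nn_integral)
    then show ?thesis
      unfolding inner by (subst law_lborel, subst nn_integral_density) auto
  qed
  also have "\<dots> = (\<integral>\<^sup>+y. \<integral>\<^sup>+b. indicator {0..<2 * pi} y * (w y b * h (b(0 := 0))) \<partial>?C \<partial>lborel)"
  proof (rule nn_integral_cong)
    fix y
    have "(\<lambda>b. (\<Prod>i\<in>?I. ennreal (p (y + b i))) * h (b(0 := 0))) \<in> borel_measurable ?C"
      unfolding measurable_PiM_borel_cong[OF sets_circle_angle] using h0m comp_measurable[of _ ?I]
      by (intro borel_measurable_times_ennreal borel_measurable_prod_ennreal) measurable
    then show "indicator {0..<2 * pi} y * ennreal (p y) * (\<integral>\<^sup>+b. (\<Prod>i\<in>?I. ennreal (p (y + b i))) * h (b(0 := 0)) \<partial>?C)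
      = (\<integral>\<^sup>+b. indicator {0..<2 * pi} y * (w y b * h (b(0 := 0))) \<partial>?C)"
      by (subst nn_integral_cmult[symmetric]) (auto simp: w_def mult_ac)
  qed
  also have "\<dots> = (\<integral>\<^sup>+b. \<integral>\<^sup>+y. indicator {0..<2 * pi} y * (w y b * h (b(0 := 0))) \<partial>lborel \<partial>?C)"
    using P.Fubini'[OF wm] by simp
  also have "\<dots> = (\<integral>\<^sup>+b. h (b(0 := 0)) * overlap b \<partial>?C)"
  proof (rule nn_integral_cong)
    fix b
    have "(\<lambda>y. indicator {0..<2 * pi} y * w y b) \<in> borel_measurable lborel"
      unfolding w_def by measurable
    then show "(\<integral>\<^sup>+y. indicator {0..<2 * pi} y * (w y b * h (b(0 := 0))) \<partial>lborel) = h (b(0 := 0)) * overlap b"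
      unfolding overlap_def w_def[symmetric]
      by (subst nn_integral_cmult[symmetric]) (auto intro!: nn_integral_cong simp: mult_ac)
  qed
  also have "\<dots> = (\<integral>\<^sup>+b. (\<Prod>i\<in>?I. indicator {0..<2 * pi} (b i)) * (h (b(0 := 0)) * overlap b) \<partial>PiM ?I (\<lambda>_. lborel))"
  proof -
    have C: "?C = density (PiM ?I (\<lambda>_. lborel)) (\<lambda>b. \<Prod>i\<in>?I. indicator {0..<2 * pi} (b i))"
      unfolding circle_angle_def
      by (rule PiM_density_const)
        (auto intro: sigma_finite_lborel circ.sigma_finite_measures simp flip: circle_angle_def)
    show ?thesis
      unfolding C using measurable_overlap h0m comp_measurable[of _ ?I]
      by (subst nn_integral_density)
        (auto simp: measurable_PiM_borel_cong[OF sets_lborel] intro!: borel_measurable_prod_ennreal)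
  qed
  finally show ?thesis unfolding h_def .
qed

section \<open>Boundedness, continuity and symmetry of the overlap integral\<close>

lemma overlap_integrand_eq:
  "indicator {0..<2 * pi} x * (ennreal (p x) * (\<Prod>i\<in>{1..<m}. ennreal (p (x + b i))))
  = indicator {0..<2 * pi} x * ennreal (p x * (\<Prod>i\<in>{1..<m}. p (x + b i)))"
  by (simp add: prod_ennreal p_nonneg ennreal_mult prod_nonneg)

lemma overlap_bound:
  "\<exists>K>0. \<forall>x b. p x * (\<Prod>i\<in>{1..<m}. p (x + b i)) \<le> K"
proof -
  obtain B where B: "B > 0" "\<And>x. p x \<le> B" using p_bounded by blast
  have "p x * (\<Prod>i\<in>{1..<m}. p (x + b i)) \<le> B * (\<Prod>i\<in>{1..<m}. B)" for x b
    using B p_nonneg by (intro mult_mono prod_mono prod_nonneg) (auto simp: less_imp_le)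
  then show ?thesis using B(1) by (intro exI[of _ "B * (\<Prod>i\<in>{1..<m}. B)"]) auto
qed

lemma overlap_le: "\<exists>K. \<forall>b. overlap b \<le> ennreal K"
proof -
  obtain K where K: "K > 0" "\<And>x b. p x * (\<Prod>i\<in>{1..<m}. p (x + b i)) \<le> K" using overlap_bound by blast
  have "overlap b \<le> ennreal (K * (2 * pi))" for b
  proof -
    have "overlap b \<le> (\<integral>\<^sup>+x. ennreal K * indicator {0..<2 * pi} x \<partial>lborel)"
      unfolding overlap_def overlap_integrand_eq
      using K by (intro nn_integral_mono) (auto simp: indicator_def intro!: ennreal_leI)
    also have "\<dots> = ennreal (K * (2 * pi))"
      using K(1) by (simp add: nn_integral_cmult ennreal_mult)
    finally show ?thesis .
  qed
  then show ?thesis by blast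
qed

text \<open>Dominated convergence with a constant bound on the period; the pointwise limit is
  continuity of \<open>p\<close>. It lets \<open>overlap\<close> be replaced by its value at the
  regular polygon as the offsets shrink.\<close>

lemma overlap_tendsto:
  assumes "\<And>i. i \<in> {1..<m} \<Longrightarrow> (\<lambda>n. b n i) \<longlonglongrightarrow> c i"
  shows "(\<lambda>n. overlap (b n)) \<longlonglongrightarrow> overlap c"
proof -
  obtain K where K: "K > 0" "\<And>x b. p x * (\<Prod>i\<in>{1..<m}. p (x + b i)) \<le> K" using overlap_bound by blast
  have lim: "(\<lambda>n. p (x + b n i)) \<longlonglongrightarrow> p (x + c i)" if "i \<in> {1..<m}" for i x
  proof -
    have "isCont p (x + c i)" using p_cont by (simp add: continuous_on_eq_continuous_at)
    then show ?thesis using assms[OF that] by (intro isCont_tendsto_compose[of _ p]) (auto intro: tendsto_intros)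
  qed
  show ?thesis unfolding overlap_def overlap_integrand_eq
  proof (rule nn_integral_dominated_convergence[where w = "\<lambda>x. ennreal K * indicator {0..<2 * pi} x"])
    show "AE x in lborel. indicator {0..<2 * pi} x * ennreal (p x * (\<Prod>i\<in>{1..<m}. p (x + b n i))) \<le> ennreal K * indicator {0..<2 * pi} x" for n
      using K by (auto simp: indicator_def intro!: ennreal_leI)
    show "(\<integral>\<^sup>+x. ennreal K * indicator {0..<2 * pi} x \<partial>lborel) < \<infinity>"
      by (simp add: nn_integral_cmult ennreal_mult_less_top)
    show "AE x in lborel. (\<lambda>n. indicator {0..<2 * pi} x * ennreal (p x * (\<Prod>i\<in>{1..<m}. p (x + b n i))))
      \<longlonglongrightarrow> indicator {0..<2 * pi} x * ennreal (p x * (\<Prod>i\<in>{1..<m}. p (x + c i)))"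
    proof (rule AE_I2)
      fix x :: real
      have "(\<lambda>n. ennreal (p x * (\<Prod>i\<in>{1..<m}. p (x + b n i)))) \<longlonglongrightarrow> ennreal (p x * (\<Prod>i\<in>{1..<m}. p (x + c i)))"
        using lim by (intro tendsto_ennrealI tendsto_mult tendsto_const tendsto_prod) auto
      then show "(\<lambda>n. indicator {0..<2 * pi} x * ennreal (p x * (\<Prod>i\<in>{1..<m}. p (x + b n i))))
        \<longlonglongrightarrow> indicator {0..<2 * pi} x * ennreal (p x * (\<Prod>i\<in>{1..<m}. p (x + c i)))"
        by (cases "x \<in> {0..<2 * pi}") auto
    qed
  qed measurable
qed

lemma overlap_cong: "(\<And>i. i \<in> {1..<m} \<Longrightarrow> b i = c i) \<Longrightarrow> overlap b = overlap c"
  unfolding overlap_def by (intro nn_integral_cong) simp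

lemma overlap_permute:
  assumes "\<tau> permutes {1..<m}"
  shows "overlap (\<lambda>i. b (\<tau> i)) = overlap b"
proof -
  have "(\<Prod>i\<in>{1..<m}. ennreal (p (x + b (\<tau> i)))) = (\<Prod>i\<in>{1..<m}. ennreal (p (x + b i)))" for x
    using prod.permute[OF assms, of "\<lambda>i. ennreal (p (x + b i))"] by (simp add: comp_def)
  then show ?thesis unfolding overlap_def by simp
qed

lemma overlap_vertex: "overlap (vertex m) = ennreal (density_overlap m p)"
proof -
  define f where "f x = (\<Prod>l<m. p (x + 2 * pi * real l / real m))" for x
  have f: "p x * (\<Prod>i\<in>{1..<m}. p (x + vertex m i)) = f x" for x
  proof -
    have "f x = p (x + 2 * pi * real 0 / real m) * (\<Prod>i\<in>{1..<m}. p (x + 2 * pi * real i / real m))"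
      unfolding f_def lessThan_m by (subst prod.insert) auto
    then show ?thesis by (simp add: vertex_def)
  qed
  have "continuous_on {0..2 * pi} f"
    unfolding f_def by (intro continuous_intros continuous_on_compose2[OF p_cont]) auto
  then have "(f has_integral density_overlap m p) {0..2 * pi}"
    unfolding density_overlap_def f_def[symmetric]
    by (intro integrable_integral integrable_continuous_real)
  moreover have "0 \<le> f x" for x unfolding f_def using p_nonneg by (intro prod_nonneg) auto
  ultimately have "(\<integral>\<^sup>+x. ennreal (indicator {0..2 * pi} x * f x) \<partial>lborel) = ennreal (density_overlap m p)"
    by (intro nn_integral_has_integral_lebesgue) auto
  moreover have "overlap (vertex m) = (\<integral>\<^sup>+x. indicator {0..2 * pi} x * ennreal (f x) \<partial>lborel)"
    unfolding overlap_def overlap_integrand_eq f by (rule nn_integral_Ico_eq_Icc)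
  moreover have "(\<integral>\<^sup>+x. indicator {0..2 * pi} x * ennreal (f x) \<partial>lborel) = (\<integral>\<^sup>+x. ennreal (indicator {0..2 * pi} x * f x) \<partial>lborel)"
    by (intro nn_integral_cong) (auto simp: indicator_def)
  ultimately show ?thesis by simp
qed

text \<open>The volume of the limiting region \<open>quad \<le> 2\<close>: the level is 2 because
  the deficit is half the form.\<close>

definition ell_vol :: real where
  "ell_vol = unit_ball_vol (m - 1) * sqrt 2 ^ (m - 1) / sqrt (Determinant.det (- hess_mat m g))"

lemma quad_upd: "quad (w(0 := c)) = quad_form (m - 1) neg_hess (\<lambda>i\<in>{..<m - 1}. w (Suc i))"
  unfolding quad_def quad_form_def by (intro sum.cong) auto

lemma bij_Suc_m: "bij_betw Suc {..<m - 1} {1..<m}"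
  by (rule bij_betw_byWitness[where f' = "\<lambda>i. i - 1"]) auto

text \<open>Moves from offsets indexed by \<open>{1..<m}\<close> to the index set of the ellipsoid
  lemmas. The free predicate covers both the solid ellipsoid and its boundary.\<close>

lemma emeasure_quad:
  "emeasure (PiM {1..<m} (\<lambda>_. lborel)) {w \<in> space (PiM {1..<m} (\<lambda>_. lborel)). P (quad (w(0 := 0)))}
  = emeasure (PiM {..<m - 1} (\<lambda>_. lborel)) {v \<in> space (PiM {..<m - 1} (\<lambda>_. lborel)). P (quad_form (m - 1) neg_hess v)}"
  if P: "{r. P r} \<in> sets borel" for P
proof -
  let ?J = "PiM {1..<m} (\<lambda>_. lborel :: real measure)" and ?K = "PiM {..<m - 1} (\<lambda>_. lborel :: real measure)"
  have m: "(\<lambda>x. \<lambda>i\<in>{..<m - 1}. x (Suc i)) \<in> measurable ?J ?K"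
    using bij_Suc_m by (intro measurable_restrict measurable_component_singleton) (auto simp: bij_betw_def)
  have B: "{v \<in> space ?K. P (quad_form (m - 1) neg_hess v)} \<in> sets ?K"
    using measurable_sets[OF measurable_quad_form P, of "m - 1" neg_hess] by (simp add: vimage_def Int_def conj_commute)
  have "emeasure ?K {v \<in> space ?K. P (quad_form (m - 1) neg_hess v)}
    = emeasure (distr ?J ?K (\<lambda>x. \<lambda>i\<in>{..<m - 1}. x (Suc i))) {v \<in> space ?K. P (quad_form (m - 1) neg_hess v)}"
    by (subst distr_PiM_bij[OF sigma_finite_lborel _ bij_Suc_m]) auto
  also have "\<dots> = emeasure ?J {w \<in> space ?J. P (quad (w(0 := 0)))}"
  proof -
    have "(\<lambda>x. \<lambda>i\<in>{..<m - 1}. x (Suc i)) -` {v \<in> space ?K. P (quad_form (m - 1) neg_hess v)} \<inter> space ?J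
      = {w \<in> space ?J. P (quad (w(0 := 0)))}"
      by (auto simp: quad_upd space_PiM)
    then show ?thesis by (simp only: emeasure_distr[OF m B])
  qed
  finally show ?thesis by simp
qed

lemma measurable_quad0: "(\<lambda>w. quad (w(0 := 0))) \<in> borel_measurable (PiM {1..<m} (\<lambda>_. lborel))"
proof -
  have "(\<lambda>x. \<lambda>i\<in>{..<m - 1}. x (Suc i)) \<in> measurable (PiM {1..<m} (\<lambda>_. lborel)) (PiM {..<m - 1} (\<lambda>_. lborel :: real measure))"
    using bij_Suc_m by (intro measurable_restrict measurable_component_singleton) (auto simp: bij_betw_def)
  then show ?thesis unfolding quad_upd by (rule measurable_compose[OF _ measurable_quad_form])
qed

lemma emeasure_quad_le:
  "emeasure (PiM {1..<m} (\<lambda>_. lborel)) {w \<in> space (PiM {1..<m} (\<lambda>_. lborel)). quad (w(0 := 0)) \<le> 2} = ennreal ell_vol"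
proof -
  have "{r. r \<le> (2::real)} \<in> sets borel" by simp
  from emeasure_quad[OF this] show ?thesis
    using emeasure_ellipsoid[OF pos_def_neg_hess, of 2] by (simp add: ell_vol_def uminus_hess_mat)
qed

lemma AE_quad_ne: "AE w in PiM {1..<m} (\<lambda>_. lborel). quad (w(0 := 0)) \<noteq> 2"
proof -
  let ?J = "PiM {1..<m} (\<lambda>_. lborel :: real measure)"
  have "{r. r = (2::real)} \<in> sets borel" by simp
  from emeasure_quad[OF this] have "emeasure ?J {w \<in> space ?J. quad (w(0 := 0)) = 2} = 0"
    using ellipsoid_boundary_null[OF pos_def_neg_hess, of 2] by (auto simp: null_sets_def)
  moreover have "{w \<in> space ?J. quad (w(0 := 0)) = 2} \<in> sets ?J"
    by (intro borel_measurable_eq measurable_quad0 borel_measurable_const)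
  ultimately have "{w \<in> space ?J. quad (w(0 := 0)) = 2} \<in> null_sets ?J" by (simp add: null_sets_def)
  then show ?thesis by (rule AE_I') auto
qed

text \<open>The integrand of \<open>hit_eq\<close> with the cube replaced by a small box around the
  standard labelling, in which the quadratic lower bound is available.\<close>

definition local_hit :: "real \<Rightarrow> real \<Rightarrow> (nat \<Rightarrow> real) \<Rightarrow> ennreal" where
  "local_hit \<delta> \<epsilon> b = (\<Prod>i\<in>{1..<m}. indicator {- \<delta>..\<delta>} (b i - vertex m i)) * (indicator {..\<epsilon>} (gap m g (b(0 := 0))) * overlap b)"

lemma measurable_local_hit: "local_hit \<delta> \<epsilon> \<in> borel_measurable (PiM {1..<m} (\<lambda>_. lborel))"
proof -
  have "(\<lambda>b. \<Prod>i\<in>{1..<m}. indicator {- \<delta>..\<delta>} (b i - vertex m i) :: ennreal) \<in> borel_measurable (PiM {1..<m} (\<lambda>_. borel))"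
    using comp_measurable by (intro borel_measurable_prod_ennreal) measurable
  moreover have "(\<lambda>b. indicator {..\<epsilon>} (gap m g (b(0 := 0))) :: ennreal) \<in> borel_measurable (PiM {1..<m} (\<lambda>_. borel))"
    using measurable_gap0 by measurable
  ultimately show ?thesis
    unfolding local_hit_def[abs_def] measurable_PiM_borel_cong[OF sets_lborel]
    using measurable_overlap by (intro borel_measurable_times_ennreal)
qed

lemma prod_indicator_eq:
  assumes "finite I"
  shows "(\<Prod>i\<in>I. indicator (A i) (x i)) = (if \<forall>i\<in>I. x i \<in> A i then 1 else 0 :: ennreal)"
proof (cases "\<forall>i\<in>I. x i \<in> A i")
  case False
  then obtain i where "i \<in> I" "x i \<notin> A i" by blast
  then show ?thesis using assms by (auto simp: prod_zero_iff indicator_def)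
qed auto

text \<open>Dominated convergence in the rescaled offsets \<open>w\<close>: the integrands converge
  to the overlap at the polygon times the indicator of the ellipsoid.\<close>

lemma local_hit_limit:
  assumes c: "c > 0" and \<delta>: "\<delta> > 0" and lower:
    "\<And>v i. v 0 = 0 \<Longrightarrow> (\<forall>i<m. \<bar>v i\<bar> \<le> \<delta>) \<Longrightarrow> i < m \<Longrightarrow> c * (v i)\<^sup>2 \<le> gap m g (\<lambda>i. vertex m i + v i)"
    and s: "s \<longlonglongrightarrow> 0" "\<And>n. s n > 0"
  shows "(\<lambda>n. \<integral>\<^sup>+w. local_hit \<delta> ((s n)\<^sup>2) (\<lambda>i\<in>{1..<m}. vertex m i + s n * w i) \<partial>PiM {1..<m} (\<lambda>_. lborel))
    \<longlonglongrightarrow> ennreal (density_overlap m p) * ennreal ell_vol"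
proof -
  let ?I = "{1..<m}"
  let ?J = "PiM ?I (\<lambda>_. lborel :: real measure)"
  have sne: "s n \<noteq> 0" for n using s(2)[of n] by simp
  define R where "R = 1 / sqrt c"
  obtain K where K: "\<And>b. overlap b \<le> ennreal K" using overlap_le by blast
  define z where "z n w = (\<lambda>i\<in>?I. vertex m i + s n * w i)" for n w
  have zm: "z n \<in> measurable ?J ?J" for n
    unfolding z_def by (intro measurable_restrict)
      (auto intro!: borel_measurable_add borel_measurable_times measurable_PiM_lborel_component)
  have gz: "gap m g ((z n w)(0 := 0)) = gap m g (\<lambda>i. vertex m i + s n * (w(0 := 0)) i)" for n w
    by (rule gap_cong) (auto simp: z_def vertex_def Suc_le_eq)
  define u' where "u' w = overlap (vertex m) * indicator {w \<in> space ?J. quad (w(0 := 0)) \<le> 2} w" for w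
  define D where "D w = ennreal K * indicator (PiE ?I (\<lambda>_. {- R..R})) w" for w
  have Dm: "PiE ?I (\<lambda>_. {- R..R}) \<in> sets ?J" by (intro sets_PiM_I_finite) auto
  have qm: "{w \<in> space ?J. quad (w(0 := 0)) \<le> 2} \<in> sets ?J"
    by (intro borel_measurable_le measurable_quad0 borel_measurable_const)
  have "(\<lambda>n. \<integral>\<^sup>+w. local_hit \<delta> ((s n)\<^sup>2) (z n w) \<partial>?J) \<longlonglongrightarrow> (\<integral>\<^sup>+w. u' w \<partial>?J)"
  proof (rule nn_integral_dominated_convergence[where w = D])
    show "(\<lambda>w. local_hit \<delta> ((s n)\<^sup>2) (z n w)) \<in> borel_measurable ?J" for n
      by (rule measurable_compose[OF zm measurable_local_hit])
    show "u' \<in> borel_measurable ?J"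
      unfolding u'_def[abs_def] using qm by (intro borel_measurable_times_ennreal) auto
    show "D \<in> borel_measurable ?J"
      unfolding D_def[abs_def] using Dm by (intro borel_measurable_times_ennreal) auto
    \<comment> \<open>On the support \<open>c * (s n * w i)^2\<close> is at most the deficit, hence
      at most \<open>(s n)^2\<close>. The scale cancels, so \<open>w\<close> stays in a cube of
      half-side \<open>R = 1 / sqrt c\<close> independent of \<open>n\<close>.\<close>
    show "AE w in ?J. local_hit \<delta> ((s n)\<^sup>2) (z n w) \<le> D w" for n
    proof (rule AE_I2)
      fix w assume w: "w \<in> space ?J"
      show "local_hit \<delta> ((s n)\<^sup>2) (z n w) \<le> D w"
      proof (cases "(\<forall>i\<in>?I. \<bar>s n * w i\<bar> \<le> \<delta>) \<and> gap m g ((z n w)(0 := 0)) \<le> (s n)\<^sup>2")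
        case True
        have "w i \<in> {- R..R}" if "i \<in> ?I" for i
        proof -
          have "c * (s n * (w(0 := 0)) i)\<^sup>2 \<le> gap m g (\<lambda>i. vertex m i + s n * (w(0 := 0)) i)"
            using True that \<delta> by (intro lower[of "\<lambda>i. s n * (w(0 := 0)) i"]) (auto simp: Suc_le_eq)
          also have "\<dots> \<le> (s n)\<^sup>2" using True gz by simp
          finally have "(s n)\<^sup>2 * (c * (w i)\<^sup>2) \<le> (s n)\<^sup>2 * 1" using that by (simp add: power_mult_distrib mult_ac)
          then have "c * (w i)\<^sup>2 \<le> 1" using s(2)[of n] by (subst (asm) mult_le_cancel_left_pos) auto
          then have "(w i)\<^sup>2 \<le> 1 / c" using c by (simp add: field_simps)
          then have "sqrt ((w i)\<^sup>2) \<le> sqrt (1 / c)" by (rule real_sqrt_le_mono)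
          then have "\<bar>w i\<bar> \<le> R" by (simp add: R_def real_sqrt_divide)
          then show ?thesis by auto
        qed
        then have "w \<in> PiE ?I (\<lambda>_. {- R..R})"
          using w by (simp add: space_PiM PiE_iff)
        then have "D w = ennreal K" by (simp add: D_def)
        moreover have "local_hit \<delta> ((s n)\<^sup>2) (z n w) \<le> 1 * (1 * overlap (z n w))"
          unfolding local_hit_def prod_indicator_eq[OF finite_atLeastLessThan, of "\<lambda>_. {- \<delta>..\<delta>}" "\<lambda>i. z n w i - vertex m i" for n]
          by (intro mult_mono) (auto simp: indicator_def)
        ultimately show ?thesis using K[of "z n w"] by simp
      next
        case False
        then have "local_hit \<delta> ((s n)\<^sup>2) (z n w) = 0"
          unfolding local_hit_def prod_indicator_eq[OF finite_atLeastLessThan, of "\<lambda>_. {- \<delta>..\<delta>}" "\<lambda>i. z n w i - vertex m i" for n]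
          by (auto simp: z_def indicator_def abs_le_iff)
        then show ?thesis by simp
      qed
    qed
    show "(\<integral>\<^sup>+w. D w \<partial>?J) < \<infinity>"
    proof -
      have "emeasure ?J (PiE ?I (\<lambda>_. {- R..R})) = (\<Prod>i\<in>?I. emeasure lborel {- R..R})"
        by (rule lborel_prod.emeasure_PiM) auto
      also have "\<dots> < \<infinity>" using c by (simp add: R_def emeasure_lborel_Icc_eq ennreal_power)
      finally show ?thesis unfolding D_def using Dm by (simp add: nn_integral_cmult ennreal_mult_less_top)
    qed
    \<comment> \<open>Strictly inside or outside the ellipsoid the indicator is eventually constant;
      only its null boundary is left undecided.\<close>
    show "AE w in ?J. (\<lambda>n. local_hit \<delta> ((s n)\<^sup>2) (z n w)) \<longlonglongrightarrow> u' w"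
      using AE_quad_ne
    proof (rule AE_mp, intro AE_I2 impI)
      fix w assume w: "w \<in> space ?J" and ne: "quad (w(0 := 0)) \<noteq> 2"
      have lim: "(\<lambda>n. gap m g ((z n w)(0 := 0)) / (s n)\<^sup>2) \<longlonglongrightarrow> quad (w(0 := 0)) / 2"
        unfolding gz by (rule gap_limit[OF _ s(1) sne]) simp
      show "(\<lambda>n. local_hit \<delta> ((s n)\<^sup>2) (z n w)) \<longlonglongrightarrow> u' w"
      proof (cases "quad (w(0 := 0)) < 2")
        case True
        have ev1: "\<forall>\<^sub>F n in sequentially. gap m g ((z n w)(0 := 0)) / (s n)\<^sup>2 < 1"
          using order_tendstoD(2)[OF lim, of 1] True by simp
        have "\<forall>\<^sub>F n in sequentially. \<bar>s n * w i\<bar> < \<delta>" for i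
        proof -
          have "(\<lambda>n. \<bar>s n * w i\<bar>) \<longlonglongrightarrow> \<bar>0 * w i\<bar>" by (intro tendsto_intros s)
          then show ?thesis using order_tendstoD(2)[of _ 0 sequentially \<delta>] \<delta> by simp
        qed
        then have ev2: "\<forall>\<^sub>F n in sequentially. \<forall>i\<in>?I. \<bar>s n * w i\<bar> < \<delta>"
          by (intro eventually_ball_finite) auto
        have "\<forall>\<^sub>F n in sequentially. overlap (z n w) = local_hit \<delta> ((s n)\<^sup>2) (z n w)"
          using ev1 ev2
        proof eventually_elim
          case (elim n)
          have "gap m g ((z n w)(0 := 0)) \<le> (s n)\<^sup>2"
            using elim(1) s(2)[of n] by (simp add: pos_divide_less_eq)
          moreover have "\<forall>i\<in>?I. z n w i - vertex m i \<in> {- \<delta>..\<delta>}"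
            using elim(2) by (auto simp: z_def abs_less_iff less_imp_le)
          ultimately show ?case
            unfolding local_hit_def prod_indicator_eq[OF finite_atLeastLessThan, of "\<lambda>_. {- \<delta>..\<delta>}" "\<lambda>i. z n w i - vertex m i" for n]
            by simp
        qed
        from _ this have "(\<lambda>n. local_hit \<delta> ((s n)\<^sup>2) (z n w)) \<longlonglongrightarrow> overlap (vertex m)"
        proof (rule Lim_transform_eventually)
        show "(\<lambda>n. overlap (z n w)) \<longlonglongrightarrow> overlap (vertex m)"
        proof (rule overlap_tendsto)
          fix i assume i: "i \<in> ?I"
          have "(\<lambda>n. vertex m i + s n * w i) \<longlonglongrightarrow> vertex m i + 0 * w i" by (intro tendsto_intros s)
          then show "(\<lambda>n. z n w i) \<longlonglongrightarrow> vertex m i" using i by (simp add: z_def)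
        qed
        qed
        moreover have "u' w = overlap (vertex m)" using True w by (simp add: u'_def)
        ultimately show ?thesis by simp
      next
        case False
        then have q: "quad (w(0 := 0)) > 2" using ne by simp
        have "\<forall>\<^sub>F n in sequentially. gap m g ((z n w)(0 := 0)) / (s n)\<^sup>2 > 1"
          using order_tendstoD(1)[OF lim, of 1] q by simp
        then have "\<forall>\<^sub>F n in sequentially. local_hit \<delta> ((s n)\<^sup>2) (z n w) = 0"
        proof eventually_elim
          case (elim n)
          then have "\<not> gap m g ((z n w)(0 := 0)) \<le> (s n)\<^sup>2"
            using s(2)[of n] by (simp add: pos_less_divide_eq)
          then show ?case by (simp add: local_hit_def)
        qed
        moreover have "u' w = 0" using q by (simp add: u'_def)
        ultimately show ?thesis by (simp add: tendsto_eventually)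
      qed
    qed
  qed
  also have "(\<integral>\<^sup>+w. u' w \<partial>?J) = ennreal (density_overlap m p) * ennreal ell_vol"
    unfolding u'_def using qm by (simp add: nn_integral_cmult emeasure_quad_le[unfolded One_nat_def] overlap_vertex)
  finally show ?thesis unfolding z_def .
qed

lemma local_hit_scaled:
  assumes "s > 0"
  shows "(\<integral>\<^sup>+b. local_hit \<delta> \<epsilon> b \<partial>PiM {1..<m} (\<lambda>_. lborel))
    = ennreal (s ^ (m - 1)) * (\<integral>\<^sup>+w. local_hit \<delta> \<epsilon> (\<lambda>i\<in>{1..<m}. vertex m i + s * w i) \<partial>PiM {1..<m} (\<lambda>_. lborel))"
  using nn_integral_PiM_lborel_affine[OF _ assms measurable_local_hit, where t = "vertex m"] by simp

text \<open>Adjacent vertices are \<open>2 * pi / m\<close> apart, so closed intervals of radius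
  below half of that are disjoint.\<close>

lemma vertex_separated:
  assumes "\<bar>x - vertex m i\<bar> \<le> \<delta>" "\<bar>x - vertex m j\<bar> \<le> \<delta>" "\<delta> < pi / m"
  shows "i = j"
proof -
  have "\<bar>vertex m i - vertex m j\<bar> < 2 * pi / m" using assms by (simp add: abs_le_iff abs_less_iff)
  also have "vertex m i - vertex m j = 2 * pi / m * (real i - real j)"
    by (simp add: vertex_def diff_divide_distrib algebra_simps)
  finally have "2 * pi / m * \<bar>real i - real j\<bar> < 2 * pi / m * 1"
    by (simp add: abs_mult)
  then have "\<bar>real i - real j\<bar> < 1"
    using m_pos by (subst (asm) mult_less_cancel_left_pos) auto
  then show ?thesis by linarith
qed

text \<open>The factorial counts the labellings of the vertices other than the root, which all contribute
  the same amount.\<close>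

lemma hit_eq_local_hit:
  assumes \<delta>: "0 < \<delta>" "\<delta> < pi / m"
  shows "\<exists>\<epsilon>0>0. \<forall>\<epsilon>. 0 \<le> \<epsilon> \<and> \<epsilon> < \<epsilon>0 \<longrightarrow>
    emeasure (PiM {..<m} (\<lambda>_. law)) {x \<in> space (PiM {..<m} (\<lambda>_. law)). gap m g x \<le> \<epsilon>}
    = ennreal (fact (m - 1)) * (\<integral>\<^sup>+b. local_hit \<delta> \<epsilon> b \<partial>PiM {1..<m} (\<lambda>_. lborel))"
proof -
  let ?I = "{1..<m}"
  let ?J = "PiM ?I (\<lambda>_. lborel :: real measure)"
  let ?T = "{\<tau>. \<tau> permutes ?I}"
  obtain C \<epsilon>1 where C: "C > 0" "\<epsilon>1 > 0" and loc: "\<And>\<epsilon> b. 0 \<le> \<epsilon> \<Longrightarrow> \<epsilon> < \<epsilon>1 \<Longrightarrow> b 0 = 0 \<Longrightarrow>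
      (\<forall>i\<in>?I. b i \<in> {0..2 * pi}) \<Longrightarrow> gap m g b \<le> \<epsilon> \<Longrightarrow>
      \<exists>\<tau>. \<tau> permutes ?I \<and> (\<forall>i\<in>?I. \<bar>b i - vertex m (\<tau> i)\<bar> \<le> C * sqrt \<epsilon>)"
    using gap_localize by blast
  \<comment> \<open>The second bound makes the localisation radius
    \<open>C * sqrt \<epsilon>\<close> at most \<delta>.\<close>
  define \<epsilon>0 where "\<epsilon>0 = min \<epsilon>1 ((\<delta> / C)\<^sup>2)"
  have \<epsilon>0: "\<epsilon>0 > 0" using C \<delta> by (simp add: \<epsilon>0_def)
  have finT: "finite ?T" by (intro finite_permutations) simp
  have main: "emeasure (PiM {..<m} (\<lambda>_. law)) {x \<in> space (PiM {..<m} (\<lambda>_. law)). gap m g x \<le> \<epsilon>}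
    = ennreal (fact (m - 1)) * (\<integral>\<^sup>+b. local_hit \<delta> \<epsilon> b \<partial>?J)" if \<epsilon>: "0 \<le> \<epsilon>" "\<epsilon> < \<epsilon>0" for \<epsilon>
  proof -
    have C\<epsilon>: "C * sqrt \<epsilon> \<le> \<delta>"
    proof -
      have "sqrt \<epsilon> \<le> sqrt ((\<delta> / C)\<^sup>2)" using \<epsilon>(2) by (intro real_sqrt_le_mono) (simp add: \<epsilon>0_def)
      also have "\<dots> = \<delta> / C" using C \<delta> by simp
      finally show ?thesis using C by (simp add: field_simps)
    qed
    define X where "X b = indicator {..\<epsilon>} (gap m g (b(0 := 0))) * overlap b" for b
    define near where "near \<tau> b \<longleftrightarrow> (\<forall>i\<in>?I. \<bar>b i - vertex m (\<tau> i)\<bar> \<le> \<delta>)" for \<tau> and b :: "nat \<Rightarrow> real"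
    have lh: "local_hit \<delta> \<epsilon> b = (if near id b then X b else 0)" for b
      unfolding local_hit_def X_def near_def
        prod_indicator_eq[OF finite_atLeastLessThan, of "\<lambda>_. {- \<delta>..\<delta>}" "\<lambda>i. b i - vertex m i" for n]
      by (auto simp: abs_le_iff)
    have Xperm: "X (\<lambda>i\<in>?I. b (\<tau> i)) = X b" if "\<tau> permutes ?I" for \<tau> b
    proof -
      have "gap m g ((\<lambda>i\<in>?I. b (\<tau> i))(0 := 0)) = gap m g (\<lambda>i. (b(0 := 0)) (\<tau> i))"
      proof (rule gap_cong)
        fix i assume i: "i < m"
        have "\<tau> 0 = 0" using that by (simp add: permutes_def)
        moreover have "\<tau> i \<in> ?I" if "i \<noteq> 0" using \<open>\<tau> permutes ?I\<close> that i permutes_in_image[of \<tau> ?I i] by auto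
        ultimately show "((\<lambda>i\<in>?I. b (\<tau> i))(0 := 0)) i = (b(0 := 0)) (\<tau> i)"
          using i by (cases "i = 0") auto
      qed
      also have "\<dots> = gap m g (b(0 := 0))" by (rule gap_permute[OF that])
      finally have "gap m g ((\<lambda>i\<in>?I. b (\<tau> i))(0 := 0)) = gap m g (b(0 := 0))" .
      moreover have "overlap (\<lambda>i\<in>?I. b (\<tau> i)) = overlap b"
        using overlap_cong[of "\<lambda>i\<in>?I. b (\<tau> i)" "\<lambda>i. b (\<tau> i)"] overlap_permute[OF that, of b] by simp
      ultimately show ?thesis by (simp add: X_def)
    qed
    have near_perm: "near id (\<lambda>i\<in>?I. b (\<tau> i)) \<longleftrightarrow> near (Hilbert_Choice.inv \<tau>) b" if \<tau>: "\<tau> permutes ?I" for \<tau> b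
    proof -
      have "near id (\<lambda>i\<in>?I. b (\<tau> i)) \<longleftrightarrow> (\<forall>i\<in>?I. \<bar>b (\<tau> i) - vertex m (Hilbert_Choice.inv \<tau> (\<tau> i))\<bar> \<le> \<delta>)"
        using permutes_inverses(2)[OF \<tau>] by (simp add: near_def)
      also have "\<dots> \<longleftrightarrow> (\<forall>j\<in>\<tau> ` ?I. \<bar>b j - vertex m (Hilbert_Choice.inv \<tau> j)\<bar> \<le> \<delta>)" by blast
      also have "\<tau> ` ?I = ?I" by (rule permutes_image[OF \<tau>])
      finally show ?thesis by (simp add: near_def)
    qed
    \<comment> \<open>Where the deficit is small, lying in the cube means being near the polygon for
      exactly one labelling, so the cube indicator becomes a sum of disjoint pieces.\<close>
    have pointwise: "(\<Prod>i\<in>?I. indicator {0..<2 * pi} (b i)) * X b = (\<Sum>\<tau>\<in>?T. if near \<tau> b then X b else 0)" for b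
    proof (cases "X b = 0")
      case False
      then have gb: "gap m g (b(0 := 0)) \<le> \<epsilon>" by (auto simp: X_def indicator_def split: if_splits)
      \<comment> \<open>One direction is the localisation. Conversely, the vertices other than the
        root keep distance at least \<open>2 * pi / m\<close> from both ends of the period, so their
        neighbourhoods stay inside.\<close>
      have box_iff: "(\<forall>i\<in>?I. b i \<in> {0..<2 * pi}) \<longleftrightarrow> (\<exists>\<tau>\<in>?T. near \<tau> b)"
      proof
        assume "\<forall>i\<in>?I. b i \<in> {0..<2 * pi}"
        then have "\<exists>\<tau>. \<tau> permutes ?I \<and> (\<forall>i\<in>?I. \<bar>(b(0 := 0)) i - vertex m (\<tau> i)\<bar> \<le> C * sqrt \<epsilon>)"
          using \<epsilon> by (intro loc[OF _ _ _ _ gb]) (auto simp: \<epsilon>0_def less_imp_le)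
        then show "\<exists>\<tau>\<in>?T. near \<tau> b"
          using C\<epsilon> unfolding near_def by force
      next
        assume "\<exists>\<tau>\<in>?T. near \<tau> b"
        then obtain \<tau> where \<tau>: "\<tau> permutes ?I" "near \<tau> b" by blast
        show "\<forall>i\<in>?I. b i \<in> {0..<2 * pi}"
        proof
          fix i assume i: "i \<in> ?I"
          have ti: "1 \<le> \<tau> i" "\<tau> i \<le> m - 1" using permutes_in_image[OF \<tau>(1), of i] i by auto
          have "vertex m 1 \<le> vertex m (\<tau> i)" "vertex m (\<tau> i) \<le> vertex m (m - 1)"
            using ti m_pos unfolding vertex_def by (auto intro!: divide_right_mono mult_left_mono simp del: of_nat_diff)
          moreover have "vertex m 1 = 2 * (pi / m)" "vertex m (m - 1) = 2 * pi - 2 * (pi / m)"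
            using m_pos by (auto simp: vertex_def field_simps of_nat_diff)
          moreover have "\<bar>b i - vertex m (\<tau> i)\<bar> \<le> \<delta>" using \<tau>(2) i by (simp add: near_def)
          moreover have "0 < pi / m" using m_pos by simp
          ultimately have "0 \<le> b i" "b i < 2 * pi" using \<delta> by (auto simp: abs_le_iff)
          then show "b i \<in> {0..<2 * pi}" by simp
        qed
      qed
      have uniq: "\<tau> = \<tau>'" if "\<tau> \<in> ?T" "\<tau>' \<in> ?T" "near \<tau> b" "near \<tau>' b" for \<tau> \<tau>'
      proof
        fix i
        show "\<tau> i = \<tau>' i"
        proof (cases "i \<in> ?I")
          case True
          then show ?thesis using that \<delta> by (intro vertex_separated[of "b i" _ \<delta>]) (auto simp: near_def)
        next
          case False
          then have "\<tau> i = i" "\<tau>' i = i" using that permutes_not_in by (metis mem_Collect_eq)+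
          then show ?thesis by simp
        qed
      qed
      show ?thesis
      proof (cases "\<exists>\<tau>\<in>?T. near \<tau> b")
        case True
        then obtain \<tau> where \<tau>: "\<tau> \<in> ?T" "near \<tau> b" by blast
        have "(\<Sum>\<tau>'\<in>?T. if near \<tau>' b then X b else 0) = (\<Sum>\<tau>'\<in>?T. if \<tau>' = \<tau> then X b else 0)"
        proof (rule sum.cong)
          fix \<tau>' assume \<tau>': "\<tau>' \<in> ?T"
          show "(if near \<tau>' b then X b else 0) = (if \<tau>' = \<tau> then X b else 0)"
          proof (cases "\<tau>' = \<tau>")
            case False
            then have "\<not> near \<tau>' b" using uniq[OF \<tau>' \<tau>(1)] \<tau>(2) by blast
            then show ?thesis using False by simp
          qed (use \<tau>(2) in simp)
        qed simp
        also have "\<dots> = X b" using \<tau>(1) finT by simp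
        finally show ?thesis using box_iff True by (simp add: prod_indicator_eq)
      next
        case none: False
        then have "(\<Sum>\<tau>\<in>?T. if near \<tau> b then X b else 0) = 0" by (intro sum.neutral) auto
        moreover have "\<not> (\<forall>i\<in>?I. b i \<in> {0..<2 * pi})" using box_iff none by blast
        then have "(\<Prod>i\<in>?I. indicator {0..<2 * pi} (b i)) = (0 :: ennreal)"
          by (subst prod_indicator_eq) (auto simp only: finite_atLeastLessThan if_False)
        ultimately show ?thesis by simp
      qed
    next
      case True
      have "(\<Sum>\<tau>\<in>?T. if near \<tau> b then X b else 0) = 0"
        by (rule sum.neutral) (simp add: True)
      then show ?thesis using True by simp
    qed
    have "emeasure (PiM {..<m} (\<lambda>_. law)) {x \<in> space (PiM {..<m} (\<lambda>_. law)). gap m g x \<le> \<epsilon>}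
      = (\<integral>\<^sup>+b. (\<Sum>\<tau>\<in>?T. if near \<tau> b then X b else 0) \<partial>?J)"
      unfolding hit_eq X_def[symmetric] pointwise ..
    \<comment> \<open>Each piece is the standard one after permuting coordinates by the inverse
      labelling, which preserves deficit, overlap and product measure.\<close>
    also have "\<dots> = (\<integral>\<^sup>+b. (\<Sum>\<tau>\<in>?T. local_hit \<delta> \<epsilon> (\<lambda>i\<in>?I. b (Hilbert_Choice.inv \<tau> i))) \<partial>?J)"
    proof (intro nn_integral_cong sum.cong refl)
      fix b \<tau> assume "\<tau> \<in> ?T"
      then have \<tau>: "\<tau> permutes ?I" by simp
      show "(if near \<tau> b then X b else 0) = local_hit \<delta> \<epsilon> (\<lambda>i\<in>?I. b (Hilbert_Choice.inv \<tau> i))"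
        unfolding lh Xperm[OF permutes_inv[OF \<tau>]] near_perm[OF permutes_inv[OF \<tau>]] permutes_inv_inv[OF \<tau>] ..
    qed
    also have "\<dots> = (\<Sum>\<tau>\<in>?T. \<integral>\<^sup>+b. local_hit \<delta> \<epsilon> (\<lambda>i\<in>?I. b (Hilbert_Choice.inv \<tau> i)) \<partial>?J)"
    proof (rule nn_integral_sum)
      fix \<tau> assume "\<tau> \<in> ?T"
      then have \<tau>: "Hilbert_Choice.inv \<tau> permutes ?I" by (simp add: permutes_inv)
      have "(\<lambda>b. \<lambda>i\<in>?I. b (Hilbert_Choice.inv \<tau> i)) \<in> measurable ?J ?J"
        using permutes_in_image[OF \<tau>] by (intro measurable_restrict measurable_component_singleton) blast
      then show "(\<lambda>b. local_hit \<delta> \<epsilon> (\<lambda>i\<in>?I. b (Hilbert_Choice.inv \<tau> i))) \<in> borel_measurable ?J"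
        by (rule measurable_compose[OF _ measurable_local_hit])
    qed
    also have "\<dots> = (\<Sum>\<tau>\<in>?T. \<integral>\<^sup>+b. local_hit \<delta> \<epsilon> b \<partial>?J)"
    proof (rule sum.cong)
      fix \<tau> assume "\<tau> \<in> ?T"
      then have \<tau>: "Hilbert_Choice.inv \<tau> permutes ?I" by (simp add: permutes_inv)
      have m: "(\<lambda>b. \<lambda>i\<in>?I. b (Hilbert_Choice.inv \<tau> i)) \<in> measurable ?J ?J"
        using permutes_in_image[OF \<tau>] by (intro measurable_restrict measurable_component_singleton) blast
      have "(\<integral>\<^sup>+b. local_hit \<delta> \<epsilon> b \<partial>?J)
        = (\<integral>\<^sup>+b. local_hit \<delta> \<epsilon> b \<partial>distr ?J ?J (\<lambda>b. \<lambda>i\<in>?I. b (Hilbert_Choice.inv \<tau> i)))"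
        by (subst distr_PiM_bij[OF sigma_finite_lborel _ permutes_imp_bij[OF \<tau>]]) auto
      also have "\<dots> = (\<integral>\<^sup>+b. local_hit \<delta> \<epsilon> (\<lambda>i\<in>?I. b (Hilbert_Choice.inv \<tau> i)) \<partial>?J)"
        using measurable_local_hit by (intro nn_integral_distr[OF m]) (simp only: measurable_distr_eq1)
      finally show "(\<integral>\<^sup>+b. local_hit \<delta> \<epsilon> (\<lambda>i\<in>?I. b (Hilbert_Choice.inv \<tau> i)) \<partial>?J) = (\<integral>\<^sup>+b. local_hit \<delta> \<epsilon> b \<partial>?J)" ..
    qed simp
    also have "\<dots> = ennreal (fact (m - 1)) * (\<integral>\<^sup>+b. local_hit \<delta> \<epsilon> b \<partial>?J)"
      using card_permutations[of ?I "m - 1"] by (simp add: ennreal_of_nat_eq_real_of_nat)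
    finally show ?thesis .
  qed
  then show ?thesis using \<epsilon>0 by blast
qed

definition hit :: "real \<Rightarrow> real" where
  "hit \<epsilon> = measure (PiM {..<m} (\<lambda>_. law)) {x \<in> space (PiM {..<m} (\<lambda>_. law)). gap m g x \<le> \<epsilon>}"

lemma density_overlap_nonneg: "0 \<le> density_overlap m p"
  unfolding density_overlap_def using p_nonneg
  by (intro integral_nonneg integrable_continuous_real prod_nonneg continuous_intros
      continuous_on_compose2[OF p_cont]) auto

lemma ell_vol_nonneg: "0 \<le> ell_vol"
  unfolding ell_vol_def uminus_hess_mat using pos_def_form_det_pos[OF pos_def_neg_hess] by simp

text \<open>With \<epsilon> equal to the square of \<open>s n\<close>, the change of variables in
  \<open>m - 1\<close> offsets produces the factor \<open>s n ^ (m - 1)\<close>, and the factorial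
  counts the labellings.\<close>

lemma hit_asymptotics:
  assumes s: "s \<longlonglongrightarrow> 0" "\<And>n. s n > 0"
  shows "(\<lambda>n. hit ((s n)\<^sup>2) / s n ^ (m - 1)) \<longlonglongrightarrow> fact (m - 1) * density_overlap m p * ell_vol"
proof -
  obtain c \<delta>0 where c: "c > 0" and \<delta>0: "\<delta>0 > 0" and lower:
    "\<And>v i. v 0 = 0 \<Longrightarrow> (\<forall>i<m. \<bar>v i\<bar> \<le> \<delta>0) \<Longrightarrow> i < m \<Longrightarrow> c * (v i)\<^sup>2 \<le> gap m g (\<lambda>i. vertex m i + v i)"
    by (rule gap_lower_bound) (rule that; assumption)
  define \<delta> where "\<delta> = min \<delta>0 (pi / (2 * m))"
  have \<delta>: "\<delta> > 0" "\<delta> < pi / m" "\<delta> \<le> \<delta>0"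
  proof -
    have "pi / (2 * m) < pi / m" using m_pos by (intro divide_strict_left_mono) auto
    then show "\<delta> > 0" "\<delta> < pi / m" "\<delta> \<le> \<delta>0" using \<delta>0 m_pos by (auto simp: \<delta>_def)
  qed
  let ?J = "PiM {1..<m} (\<lambda>_. lborel :: real measure)"
  define a where "a n = (\<integral>\<^sup>+w. local_hit \<delta> ((s n)\<^sup>2) (\<lambda>i\<in>{1..<m}. vertex m i + s n * w i) \<partial>?J)" for n
  have "a \<longlonglongrightarrow> ennreal (density_overlap m p) * ennreal ell_vol"
    unfolding a_def
  proof (rule local_hit_limit[OF c \<delta>(1) _ s])
    fix v i assume "v 0 = 0" "\<forall>i<m. \<bar>v i\<bar> \<le> \<delta>" "i < m"
    then show "c * (v i)\<^sup>2 \<le> gap m g (\<lambda>i. vertex m i + v i)"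
      using \<delta>(3) by (intro lower) force+
  qed
  also have "ennreal (density_overlap m p) * ennreal ell_vol = ennreal (density_overlap m p * ell_vol)"
    using density_overlap_nonneg ell_vol_nonneg by (simp add: ennreal_mult)
  finally have a: "(\<lambda>n. enn2real (a n)) \<longlonglongrightarrow> density_overlap m p * ell_vol"
    using density_overlap_nonneg ell_vol_nonneg by (intro tendsto_enn2real) auto
  obtain \<epsilon>0 where \<epsilon>0: "\<epsilon>0 > 0" and hit: "\<And>\<epsilon>. 0 \<le> \<epsilon> \<Longrightarrow> \<epsilon> < \<epsilon>0 \<Longrightarrow>
    emeasure (PiM {..<m} (\<lambda>_. law)) {x \<in> space (PiM {..<m} (\<lambda>_. law)). gap m g x \<le> \<epsilon>}
    = ennreal (fact (m - 1)) * (\<integral>\<^sup>+b. local_hit \<delta> \<epsilon> b \<partial>?J)"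
    using hit_eq_local_hit[OF \<delta>(1,2)] by blast
  have "(\<lambda>n. (s n)\<^sup>2) \<longlonglongrightarrow> 0\<^sup>2" by (intro tendsto_intros s)
  then have "\<forall>\<^sub>F n in sequentially. (s n)\<^sup>2 < \<epsilon>0"
    using order_tendstoD(2)[of _ 0 sequentially \<epsilon>0] \<epsilon>0 by simp
  then have "\<forall>\<^sub>F n in sequentially. fact (m - 1) * enn2real (a n) = hit ((s n)\<^sup>2) / s n ^ (m - 1)"
  proof eventually_elim
    case (elim n)
    have "hit ((s n)\<^sup>2) = enn2real (ennreal (fact (m - 1)) * (ennreal (s n ^ (m - 1)) * a n))"
      unfolding hit_def measure_def a_def local_hit_scaled[OF s(2), symmetric] using elim by (subst hit) auto
    also have "\<dots> = fact (m - 1) * (s n ^ (m - 1) * enn2real (a n))"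
      using s(2)[of n] by (simp add: enn2real_mult less_imp_le)
    finally show ?case using s(2)[of n] by simp
  qed
  from Lim_transform_eventually[OF _ this] show ?thesis
    using tendsto_mult_left[OF a, of "fact (m - 1)"] by (simp add: mult.assoc)
qed

text \<open>Admissible differences between two points of a hit, taken over all integer multiples so
  that the choice of real lifts does not matter.\<close>

definition near_set :: "real \<Rightarrow> real set" where
  "near_set \<rho> = {u. \<exists>k::int. \<bar>u - 2 * pi * of_int k / real m\<bar> \<le> \<rho>}"

lemma near_set_eq: "near_set \<rho> = (\<Union>k::int. {2 * pi * of_int k / real m - \<rho>..2 * pi * of_int k / real m + \<rho>})"
  by (auto simp: near_set_def abs_le_iff algebra_simps)

lemma near_set_measurable[measurable]: "near_set \<rho> \<in> sets borel"
  unfolding near_set_eq by measurable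

lemma wrap_near_set:
  assumes "u \<in> near_set \<rho>"
  shows "wrap u \<in> near_set \<rho>"
proof -
  obtain k :: int where k: "\<bar>u - 2 * pi * of_int k / real m\<bar> \<le> \<rho>" using assms by (auto simp: near_set_def)
  obtain l :: int where l: "u = wrap u + 2 * pi * of_int l" using wrap_diff by blast
  have "2 * pi * of_int (k - l * int m) / real m = 2 * pi * of_int k / real m - 2 * pi * of_int l"
    using m_pos by (simp add: field_simps)
  then have "\<bar>wrap u - 2 * pi * of_int (k - l * int m) / real m\<bar> \<le> \<rho>" using k l by simp
  then show ?thesis unfolding near_set_def by blast
qed

lemma circle_near_set:
  assumes \<rho>: "0 \<le> \<rho>" "\<rho> \<le> 2 * pi / m"
  shows "emeasure circle_angle (near_set \<rho>) \<le> ennreal (real (m + 3) * (2 * \<rho>))"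
proof -
  let ?I = "\<lambda>k::int. {2 * pi * of_int k / real m - \<rho>..2 * pi * of_int k / real m + \<rho>}"
  \<comment> \<open>Intervals centred up to one step outside the period can still reach into it;
    this accounts for the range from -1 to \<open>m + 1\<close> and hence for the
    \<open>m + 3\<close> intervals.\<close>
  have sub: "near_set \<rho> \<inter> {0..<2 * pi} \<subseteq> (\<Union>k\<in>{-1..int m + 1}. ?I k)"
  proof
    fix u assume u: "u \<in> near_set \<rho> \<inter> {0..<2 * pi}"
    then obtain k :: int where k: "u \<in> ?I k" by (auto simp: near_set_eq)
    have "2 * pi / m * (-1) \<le> 2 * pi / m * of_int k" using u k \<rho> by auto
    then have "(-1::real) \<le> of_int k" using m_pos by (subst (asm) mult_le_cancel_left_pos) auto
    moreover have "2 * pi / m * (real m + 1) = 2 * pi + 2 * pi / m" using m_pos by (simp add: field_simps)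
    then have "2 * pi / m * of_int k \<le> 2 * pi / m * (real m + 1)" using u k \<rho> by auto
    then have "of_int k \<le> real m + 1" using m_pos by (subst (asm) mult_le_cancel_left_pos) auto
    ultimately have "k \<in> {-1..int m + 1}" by simp
    then show "u \<in> (\<Union>k\<in>{-1..int m + 1}. ?I k)" using k by blast
  qed
  have "emeasure circle_angle (near_set \<rho>) = (\<integral>\<^sup>+x. indicator {0..<2 * pi} x * indicator (near_set \<rho>) x \<partial>lborel)"
    unfolding circle_angle_def by (subst emeasure_density) auto
  also have "\<dots> = (\<integral>\<^sup>+x. indicator (near_set \<rho> \<inter> {0..<2 * pi}) x \<partial>lborel)"
    by (intro nn_integral_cong) (auto simp: indicator_def)
  also have "\<dots> = emeasure lborel (near_set \<rho> \<inter> {0..<2 * pi})" by (rule nn_integral_indicator) simp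
  also have "\<dots> \<le> emeasure lborel (\<Union>k\<in>{-1..int m + 1}. ?I k)"
    using sub by (intro emeasure_mono) auto
  also have "\<dots> \<le> (\<Sum>k\<in>{-1..int m + 1}. emeasure lborel (?I k))"
    by (rule emeasure_subadditive_finite) auto
  also have "\<dots> = (\<Sum>k\<in>{-1..int m + 1}. ennreal (2 * \<rho>))"
    using \<rho> by (intro sum.cong) auto
  also have "\<dots> = ennreal (real (m + 3) * (2 * \<rho>))"
  proof -
    have "card {-1..int m + 1} = m + 3" by simp
    then show ?thesis
      using \<rho>(1) by (simp only: sum_constant ennreal_of_nat_eq_real_of_nat) (simp add: ennreal_mult)
  qed
  finally show ?thesis .
qed

text \<open>The density is bounded and the reference measure is rotation invariant, so the bound is
  uniform in the position \<open>x\<close> of the shared point.\<close>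

lemma law_near_set:
  obtains B where "B > 0"
    "\<And>\<rho> x. 0 \<le> \<rho> \<Longrightarrow> \<rho> \<le> 2 * pi / m \<Longrightarrow> emeasure law {z. z - x \<in> near_set \<rho>} \<le> ennreal (B * \<rho>)"
proof -
  obtain B where B: "B > 0" "\<And>x. p x \<le> B" using p_bounded by blast
  have "emeasure law {z. z - x \<in> near_set \<rho>} \<le> ennreal (B * (real (m + 3) * 2) * \<rho>)"
    if \<rho>: "0 \<le> \<rho>" "\<rho> \<le> 2 * pi / m" for \<rho> x
  proof -
    have N[measurable]: "{z. z - x \<in> near_set \<rho>} \<in> sets borel"
      using measurable_sets[of "\<lambda>z. z - x" borel borel "near_set \<rho>"] by (simp add: vimage_def)
    have "emeasure law {z. z - x \<in> near_set \<rho>} = (\<integral>\<^sup>+z. ennreal (p z) * indicator {z. z - x \<in> near_set \<rho>} z \<partial>circle_angle)"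
      unfolding law_def by (subst emeasure_density) (auto simp: measurable_cong_sets[OF sets_circle_angle refl])
    also have "\<dots> \<le> (\<integral>\<^sup>+z. ennreal B * indicator {z. z - x \<in> near_set \<rho>} z \<partial>circle_angle)"
      using B by (intro nn_integral_mono mult_right_mono ennreal_leI) auto
    also have "\<dots> = ennreal B * emeasure circle_angle {z. z - x \<in> near_set \<rho>}"
      by (rule nn_integral_cmult_indicator) simp
    finally have le: "emeasure law {z. z - x \<in> near_set \<rho>} \<le> ennreal B * emeasure circle_angle {z. z - x \<in> near_set \<rho>}" .
    have "emeasure circle_angle {z. z - x \<in> near_set \<rho>}
      \<le> emeasure circle_angle ((\<lambda>z. wrap (- x + z)) -` near_set \<rho> \<inter> space circle_angle)"
    proof (rule emeasure_mono)
      show "{z. z - x \<in> near_set \<rho>} \<subseteq> (\<lambda>z. wrap (- x + z)) -` near_set \<rho> \<inter> space circle_angle"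
        using wrap_near_set by auto
      show "(\<lambda>z. wrap (- x + z)) -` near_set \<rho> \<inter> space circle_angle \<in> sets circle_angle"
        by (rule measurable_sets[of _ _ borel]) (auto simp: measurable_cong_sets[OF sets_circle_angle refl])
    qed
    also have "\<dots> = emeasure (distr circle_angle borel (\<lambda>z. wrap (- x + z))) (near_set \<rho>)"
      by (subst emeasure_distr) (auto simp: measurable_cong_sets[OF sets_circle_angle refl])
    also have "\<dots> = emeasure circle_angle (near_set \<rho>)" by (simp only: circle_angle_rotate)
    also have "\<dots> \<le> ennreal (real (m + 3) * (2 * \<rho>))" by (rule circle_near_set[OF \<rho>])
    finally have "ennreal B * emeasure circle_angle {z. z - x \<in> near_set \<rho>} \<le> ennreal B * ennreal (real (m + 3) * (2 * \<rho>))"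
      by (rule mult_left_mono) simp
    also have "\<dots> = ennreal (B * (real (m + 3) * 2) * \<rho>)"
      using B(1) \<rho>(1) by (simp add: ennreal_mult[symmetric] mult.assoc)
    finally show ?thesis using le by (rule order.trans[rotated])
  qed
  then show thesis using that[of "B * (real (m + 3) * 2)"] B(1) by simp
qed

section \<open>Hits on arbitrary index sets, and hits with further points nearby\<close>

lemma emeasure_hit: "emeasure (PiM {..<m} (\<lambda>_. law)) {x \<in> space (PiM {..<m} (\<lambda>_. law)). gap m g x \<le> \<epsilon>} = ennreal (hit \<epsilon>)"
proof -
  interpret prob_space "PiM {..<m} (\<lambda>_. law)" by (intro prob_space_PiM prob_space_law)
  show ?thesis unfolding hit_def by (rule emeasure_eq_measure)
qed

lemma gap_reindex_measurable:
  assumes "e ` {..<m} \<subseteq> J"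
  shows "(\<lambda>x. gap m g (\<lambda>i. x (e i))) \<in> borel_measurable (PiM J (\<lambda>_. law))"
proof -
  have "(\<lambda>x. \<lambda>i\<in>{..<m}. x (e i)) \<in> measurable (PiM J (\<lambda>_. law)) (PiM {..<m} (\<lambda>_. borel))"
    using assms measurable_component_singleton[of _ J "\<lambda>_. law"]
    by (intro measurable_restrict) (auto simp: measurable_cong_sets[OF refl sets_law] image_subset_iff)
  then have "(\<lambda>x. gap m g (\<lambda>i\<in>{..<m}. x (e i))) \<in> borel_measurable (PiM J (\<lambda>_. law))"
    by (rule measurable_compose[OF _ measurable_gap])
  moreover have "gap m g (\<lambda>i\<in>{..<m}. x (e i)) = gap m g (\<lambda>i. x (e i))" for x
    by (rule gap_cong) simp
  ultimately show ?thesis by simp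
qed

lemma emeasure_hit_reindex:
  assumes e: "bij_betw e {..<m} \<alpha>"
  shows "emeasure (PiM \<alpha> (\<lambda>_. law)) {x \<in> space (PiM \<alpha> (\<lambda>_. law)). gap m g (\<lambda>i. x (e i)) \<le> \<epsilon>} = ennreal (hit \<epsilon>)"
proof -
  let ?P = "PiM \<alpha> (\<lambda>_. law)" and ?Q = "PiM {..<m} (\<lambda>_. law)"
  let ?h = "\<lambda>x. \<lambda>i\<in>{..<m}. x (e i)"
  interpret law: product_sigma_finite "\<lambda>_. law" by (rule product_sigma_finite_law)
  have h: "?h \<in> measurable ?P ?Q"
    using e by (intro measurable_restrict measurable_component_singleton) (auto simp: bij_betw_def)
  have S: "{x \<in> space ?Q. gap m g x \<le> \<epsilon>} \<in> sets ?Q"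
    using measurable_gap unfolding measurable_PiM_borel_cong[OF sets_law, symmetric]
    by (intro borel_measurable_le borel_measurable_const)
  have "ennreal (hit \<epsilon>) = emeasure (distr ?P ?Q ?h) {x \<in> space ?Q. gap m g x \<le> \<epsilon>}"
    unfolding emeasure_hit[symmetric] by (subst distr_PiM_bij[OF law.sigma_finite_measures _ e]) auto
  also have "\<dots> = emeasure ?P (?h -` {x \<in> space ?Q. gap m g x \<le> \<epsilon>} \<inter> space ?P)"
    by (rule emeasure_distr[OF h S])
  also have "?h -` {x \<in> space ?Q. gap m g x \<le> \<epsilon>} \<inter> space ?P = {x \<in> space ?P. gap m g (\<lambda>i. x (e i)) \<le> \<epsilon>}"
  proof -
    have "gap m g (?h x) = gap m g (\<lambda>i. x (e i))" for x by (rule gap_cong) simp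
    then show ?thesis using measurable_space[OF h] by auto
  qed
  finally show ?thesis by simp
qed

text \<open>For fixed coordinates in \<alpha> the point at \<open>i0\<close> is determined, and the
  coordinates in \<open>J\<close> are independent, each falling near it with probability at most
  \<eta>. The bound therefore multiplies, one factor per new index.\<close>

lemma emeasure_hit_near:
  assumes e: "bij_betw e {..<m} \<alpha>" and J: "finite J" "\<alpha> \<inter> J = {}" and i0: "i0 \<in> \<alpha>"
    and \<eta>: "\<And>x. emeasure law {z. z - x \<in> near_set \<rho>} \<le> ennreal \<eta>" "\<eta> \<ge> 0"
  shows "emeasure (PiM (\<alpha> \<union> J) (\<lambda>_. law)) {x \<in> space (PiM (\<alpha> \<union> J) (\<lambda>_. law)).
      gap m g (\<lambda>i. x (e i)) \<le> \<epsilon> \<and> (\<forall>j\<in>J. x j - x i0 \<in> near_set \<rho>)} \<le> ennreal (hit \<epsilon> * \<eta> ^ card J)"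
proof -
  let ?P = "PiM (\<alpha> \<union> J) (\<lambda>_. law)"
  interpret law: product_sigma_finite "\<lambda>_. law" by (rule product_sigma_finite_law)
  have fin: "finite \<alpha>" using e bij_betw_finite by blast
  have e\<alpha>: "e i \<in> \<alpha>" if "i < m" for i using e that by (auto simp: bij_betw_def)
  define f where "f x = (indicator {..\<epsilon>} (gap m g (\<lambda>i. x (e i))) * (\<Prod>j\<in>J. indicator (near_set \<rho>) (x j - x i0)) :: ennreal)" for x
  have cm: "(\<lambda>x. x j) \<in> borel_measurable ?P" if "j \<in> \<alpha> \<union> J" for j
    using measurable_component_singleton[OF that, of "\<lambda>_. law"] by (simp cong: measurable_cong_sets)
  have gm[measurable]: "(\<lambda>x. gap m g (\<lambda>i. x (e i))) \<in> borel_measurable ?P"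
    using e\<alpha> by (intro gap_reindex_measurable) auto
  have dm: "(\<lambda>x. x j - x i0) \<in> borel_measurable ?P" if "j \<in> J" for j
    using that i0 by (intro borel_measurable_diff cm) auto
  have fm: "f \<in> borel_measurable ?P"
    unfolding f_def[abs_def] by (intro borel_measurable_times_ennreal borel_measurable_prod_ennreal
      measurable_compose[OF gm] measurable_compose[OF dm]) auto
  let ?S = "{x \<in> space ?P. gap m g (\<lambda>i. x (e i)) \<le> \<epsilon> \<and> (\<forall>j\<in>J. x j - x i0 \<in> near_set \<rho>)}"
  have "?S = {x \<in> space ?P. gap m g (\<lambda>i. x (e i)) \<le> \<epsilon>} \<inter> {x \<in> space ?P. \<forall>j\<in>J. x j - x i0 \<in> near_set \<rho>}" by auto
  also have "\<dots> \<in> sets ?P"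
    using J(1) measurable_sets[OF dm near_set_measurable]
    by (intro sets.Int borel_measurable_le gm borel_measurable_const sets.sets_Collect_finite_All)
      (auto simp: vimage_def Int_def conj_commute)
  finally have S: "?S \<in> sets ?P" .
  have "emeasure ?P ?S = (\<integral>\<^sup>+x. indicator ?S x \<partial>?P)" using S by simp
  also have "\<dots> = (\<integral>\<^sup>+x. f x \<partial>?P)"
    using J(1) by (intro nn_integral_cong) (auto simp: f_def prod_indicator_eq[OF J(1), of "\<lambda>_. near_set \<rho>"] indicator_def)
  also have "\<dots> = (\<integral>\<^sup>+x. \<integral>\<^sup>+y. f (merge \<alpha> J (x, y)) \<partial>PiM J (\<lambda>_. law) \<partial>PiM \<alpha> (\<lambda>_. law))"
    by (rule law.product_nn_integral_fold[OF J(2) fin J(1) fm])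
  also have "\<dots> \<le> (\<integral>\<^sup>+x. ennreal (\<eta> ^ card J) * indicator {x \<in> space (PiM \<alpha> (\<lambda>_. law)). gap m g (\<lambda>i. x (e i)) \<le> \<epsilon>} x \<partial>PiM \<alpha> (\<lambda>_. law))"
  proof (rule nn_integral_mono)
    fix x assume x: "x \<in> space (PiM \<alpha> (\<lambda>_. law))"
    have f_merge: "f (merge \<alpha> J (x, y)) = indicator {..\<epsilon>} (gap m g (\<lambda>i. x (e i))) * (\<Prod>j\<in>J. indicator {z. z - x i0 \<in> near_set \<rho>} (y j))" for y
    proof -
      have "gap m g (\<lambda>i. merge \<alpha> J (x, y) (e i)) = gap m g (\<lambda>i. x (e i))"
        by (rule gap_cong) (simp add: e\<alpha> merge_def)
      moreover have "(\<Prod>j\<in>J. indicator (near_set \<rho>) (merge \<alpha> J (x, y) j - merge \<alpha> J (x, y) i0) :: ennreal)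
        = (\<Prod>j\<in>J. indicator {z. z - x i0 \<in> near_set \<rho>} (y j))"
        using J(2) i0 by (intro prod.cong) (auto simp: merge_def indicator_def)
      ultimately show ?thesis by (simp add: f_def)
    qed
    have N[measurable]: "{z. z - x i0 \<in> near_set \<rho>} \<in> sets borel"
      using measurable_sets[of "\<lambda>z. z - x i0" borel borel "near_set \<rho>"] by (simp add: vimage_def)
    have im: "(indicator {z. z - x i0 \<in> near_set \<rho>} :: real \<Rightarrow> ennreal) \<in> borel_measurable law"
      by (rule borel_measurable_indicator) simp
    have pm: "(\<lambda>y. \<Prod>j\<in>J. indicator {z. z - x i0 \<in> near_set \<rho>} (y j) :: ennreal) \<in> borel_measurable (PiM J (\<lambda>_. law))"
    proof (intro borel_measurable_prod_ennreal)
      fix j assume "j \<in> J"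
      then show "(\<lambda>y. indicator {z. z - x i0 \<in> near_set \<rho>} (y j) :: ennreal) \<in> borel_measurable (PiM J (\<lambda>_. law))"
        by (rule measurable_compose[OF measurable_component_singleton[of _ J "\<lambda>_. law"] im])
    qed
    have "(\<integral>\<^sup>+y. f (merge \<alpha> J (x, y)) \<partial>PiM J (\<lambda>_. law))
      = indicator {..\<epsilon>} (gap m g (\<lambda>i. x (e i))) * (\<Prod>j\<in>J. \<integral>\<^sup>+z. indicator {z. z - x i0 \<in> near_set \<rho>} z \<partial>law)"
      unfolding f_merge using pm im J(1)
      by (subst nn_integral_cmult, simp, subst law.product_nn_integral_prod) auto
    also have "(\<Prod>j\<in>J. \<integral>\<^sup>+z. indicator {z. z - x i0 \<in> near_set \<rho>} z \<partial>law) \<le> (\<Prod>j\<in>J. ennreal \<eta>)"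
    proof -
      have "(\<Prod>j\<in>J. a) \<le> (\<Prod>j\<in>J. b)" if "a \<le> b" for a b :: ennreal
        using J(1) by (induction J) (auto intro: mult_mono that)
      then show ?thesis using \<eta>(1)[of "x i0"] by simp
    qed
    also have "\<dots> = ennreal (\<eta> ^ card J)" using \<eta>(2) by (simp add: ennreal_power)
    finally show "(\<integral>\<^sup>+y. f (merge \<alpha> J (x, y)) \<partial>PiM J (\<lambda>_. law))
      \<le> ennreal (\<eta> ^ card J) * indicator {x \<in> space (PiM \<alpha> (\<lambda>_. law)). gap m g (\<lambda>i. x (e i)) \<le> \<epsilon>} x"
      using x by (auto simp: indicator_def mult_left_mono split: if_splits)
  qed
  also have "\<dots> = ennreal (\<eta> ^ card J) * ennreal (hit \<epsilon>)"
  proof -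
    have "{x \<in> space (PiM \<alpha> (\<lambda>_. law)). gap m g (\<lambda>i. x (e i)) \<le> \<epsilon>} \<in> sets (PiM \<alpha> (\<lambda>_. law))"
      using e\<alpha> by (intro borel_measurable_le gap_reindex_measurable borel_measurable_const) auto
    then show ?thesis by (simp add: nn_integral_cmult_indicator emeasure_hit_reindex[OF e])
  qed
  also have "\<dots> = ennreal (hit \<epsilon> * \<eta> ^ card J)"
    using \<eta>(2) by (simp add: ennreal_mult[symmetric] hit_def mult.commute)
  finally show ?thesis .
qed

text \<open>The deficit depends only on the set of points, so any enumeration of an index set may be
  used.\<close>

lemma gap_bij_eq:
  assumes "bij_betw h {..<m} \<alpha>" "bij_betw e {..<m} \<alpha>"
  shows "gap m g (\<lambda>i. x (h i)) = gap m g (\<lambda>i. x (e i))"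
proof -
  define \<sigma> where "\<sigma> = the_inv_into {..<m} e \<circ> h"
  have \<sigma>: "bij_betw \<sigma> {..<m} {..<m}"
    unfolding \<sigma>_def using assms by (intro bij_betw_trans[OF assms(1)] bij_betw_the_inv_into)
  have "e (\<sigma> i) = h i" if "i < m" for i
    using assms that unfolding \<sigma>_def by (auto simp: bij_betw_def intro!: f_the_inv_into_f)
  then have "gap m g (\<lambda>i. x (h i)) = gap m g (\<lambda>i. x (e (\<sigma> i)))"
    by (intro gap_cong) simp
  also have "\<dots> = gap m g (\<lambda>i. x (e i))"
    using angle_sum_permute[OF \<sigma>, of g "\<lambda>i. x (e i)"] by (simp add: gap_def)
  finally show ?thesis .
qed

end

text \<open>A set \<beta> is recovered from its traces inside and outside \<alpha>: at most
  \<open>2 ^ card \<alpha>\<close> choices for the former and \<open>n choose k\<close> for the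
  latter.\<close>

lemma card_subsets_diff_le:
  assumes "finite \<alpha>"
  shows "card {\<beta>. \<beta> \<subseteq> {1..n} \<and> card (\<beta> - \<alpha>) = k} \<le> 2 ^ card \<alpha> * n ^ k"
proof -
  have "card {\<beta>. \<beta> \<subseteq> {1..n} \<and> card (\<beta> - \<alpha>) = k} \<le> card (Pow \<alpha> \<times> {T. T \<subseteq> {1..n} \<and> card T = k})"
  proof (rule card_inj_on_le)
    show "inj_on (\<lambda>\<beta>. (\<beta> \<inter> \<alpha>, \<beta> - \<alpha>)) {\<beta>. \<beta> \<subseteq> {1..n} \<and> card (\<beta> - \<alpha>) = k}"
      by (rule inj_onI) blast
    show "finite (Pow \<alpha> \<times> {T. T \<subseteq> {1..n} \<and> card T = k})" using assms by simp
  qed auto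
  also have "\<dots> = 2 ^ card \<alpha> * (n choose k)"
    using assms n_subsets[of "{1..n}" k] by (simp add: card_cartesian_product card_Pow)
  also have "(n choose k) \<le> n ^ k"
    by (cases "k \<le> n") (auto simp: binomial_le_pow binomial_eq_0)
  finally show ?thesis by simp
qed

lemma sum_card_diff_le:
  fixes f :: "nat \<Rightarrow> real"
  assumes "finite \<alpha>" "B \<subseteq> {\<beta>. \<beta> \<subseteq> {1..n} \<and> card (\<beta> - \<alpha>) \<in> K}" "finite K" "\<And>k. 0 \<le> f k"
  shows "(\<Sum>\<beta>\<in>B. f (card (\<beta> - \<alpha>))) \<le> 2 ^ card \<alpha> * (\<Sum>k\<in>K. real n ^ k * f k)"
proof -
  let ?S = "\<lambda>k. {\<beta>. \<beta> \<subseteq> {1..n} \<and> card (\<beta> - \<alpha>) = k}"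
  have finS: "finite (?S k)" for k by simp
  have "(\<Sum>\<beta>\<in>B. f (card (\<beta> - \<alpha>))) \<le> (\<Sum>\<beta>\<in>(\<Union>k\<in>K. ?S k). f (card (\<beta> - \<alpha>)))"
    using assms finS by (intro sum_mono2) auto
  also have "\<dots> = (\<Sum>k\<in>K. \<Sum>\<beta>\<in>?S k. f (card (\<beta> - \<alpha>)))"
    using assms(3) finS by (intro sum.UNION_disjoint) auto
  also have "\<dots> = (\<Sum>k\<in>K. real (card (?S k)) * f k)" by (intro sum.cong) auto
  also have "\<dots> \<le> (\<Sum>k\<in>K. real (2 ^ card \<alpha> * n ^ k) * f k)"
    using card_subsets_diff_le[OF assms(1), of n] assms(4)
    by (intro sum_mono mult_right_mono) (auto simp del: of_nat_mult of_nat_power intro: of_nat_mono)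
  finally show ?thesis by (simp add: sum_distrib_left mult_ac)
qed

subsection \<open>Overlapping hits and the limit law\<close>

lemma real_choose_asymp: "(\<lambda>n. real (n choose m) / real n ^ m) \<longlonglongrightarrow> 1 / fact m"
proof -
  have "(\<lambda>n. \<Prod>i<m. (real n - real i) / real n) \<longlonglongrightarrow> (\<Prod>i<m. 1)"
  proof (intro tendsto_prod)
    fix i
    have "(\<lambda>n. 1 - real i * (1 / real n)) \<longlonglongrightarrow> 1 - real i * 0"
      by (intro tendsto_intros lim_1_over_n)
    moreover have "\<forall>\<^sub>F n in sequentially. 1 - real i * (1 / real n) = (real n - real i) / real n"
      using eventually_gt_at_top[of 0] by eventually_elim (simp add: field_simps)
    ultimately show "(\<lambda>n. (real n - real i) / real n) \<longlonglongrightarrow> 1"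
      using Lim_transform_eventually by fastforce
  qed
  then have "(\<lambda>n. (\<Prod>i<m. (real n - real i) / real n) / fact m) \<longlonglongrightarrow> (\<Prod>i<m. 1) / fact m"
    by (rule tendsto_divide[OF _ tendsto_const]) simp
  moreover have "(\<Prod>i<m. (real n - real i) / real n) / fact m = real (n choose m) / real n ^ m" for n
    by (simp add: binomial_gbinomial gbinomial_prod_rev prod_dividef atLeast0LessThan field_simps)
  ultimately show ?thesis by simp
qed

text \<open>Works with real random angles in place of points of the circle, so that the product
  measures are over the line.\<close>

locale polygon_points = polygon_sample + prob_space M for M :: "'a measure" +
  fixes \<theta> :: "nat \<Rightarrow> 'a \<Rightarrow> real"
  assumes indep: "indep_vars (\<lambda>_. borel) \<theta> {1..}"
    and law_\<theta>: "i \<ge> 1 \<Longrightarrow> distr M borel (\<theta> i) = law"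
begin

lemma \<theta>_measurable: "i \<ge> 1 \<Longrightarrow> \<theta> i \<in> borel_measurable M"
  using indep by (auto simp: indep_vars_def)

lemma joint_measurable: "J \<subseteq> {1..} \<Longrightarrow> (\<lambda>\<omega>. \<lambda>i\<in>J. \<theta> i \<omega>) \<in> measurable M (PiM J (\<lambda>_. law))"
  using \<theta>_measurable by (intro measurable_restrict) (auto simp: measurable_cong_sets[OF refl sets_law])

lemma joint_law:
  assumes "J \<subseteq> {1..}" "J \<noteq> {}"
  shows "distr M (PiM J (\<lambda>_. law)) (\<lambda>\<omega>. \<lambda>i\<in>J. \<theta> i \<omega>) = PiM J (\<lambda>_. law)"
proof -
  have "distr M (PiM J (\<lambda>_. borel)) (\<lambda>\<omega>. \<lambda>i\<in>J. \<theta> i \<omega>) = PiM J (\<lambda>i. distr M borel (\<theta> i))"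
    using indep_vars_subset[OF indep assms(1)] \<theta>_measurable assms
    by (subst indep_vars_iff_distr_eq_PiM'[symmetric]) auto
  also have "\<dots> = PiM J (\<lambda>_. law)" using assms(1) by (intro PiM_cong) (auto simp: law_\<theta>)
  finally have "distr M (PiM J (\<lambda>_. borel)) (\<lambda>\<omega>. \<lambda>i\<in>J. \<theta> i \<omega>) = PiM J (\<lambda>_. law)" .
  moreover have "distr M (PiM J (\<lambda>_. law)) (\<lambda>\<omega>. \<lambda>i\<in>J. \<theta> i \<omega>) = distr M (PiM J (\<lambda>_. borel)) (\<lambda>\<omega>. \<lambda>i\<in>J. \<theta> i \<omega>)"
    by (intro distr_cong sets_PiM_cong) auto
  ultimately show ?thesis by simp
qed

lemma emeasure_joint:
  assumes "J \<subseteq> {1..}" "J \<noteq> {}" "{x \<in> space (PiM J (\<lambda>_. law)). P x} \<in> sets (PiM J (\<lambda>_. law))"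
  shows "emeasure M {\<omega> \<in> space M. P (\<lambda>i\<in>J. \<theta> i \<omega>)} = emeasure (PiM J (\<lambda>_. law)) {x \<in> space (PiM J (\<lambda>_. law)). P x}"
proof -
  have "emeasure (PiM J (\<lambda>_. law)) {x \<in> space (PiM J (\<lambda>_. law)). P x}
    = emeasure (distr M (PiM J (\<lambda>_. law)) (\<lambda>\<omega>. \<lambda>i\<in>J. \<theta> i \<omega>)) {x \<in> space (PiM J (\<lambda>_. law)). P x}"
    by (simp only: joint_law[OF assms(1,2)])
  also have "\<dots> = emeasure M ((\<lambda>\<omega>. \<lambda>i\<in>J. \<theta> i \<omega>) -` {x \<in> space (PiM J (\<lambda>_. law)). P x} \<inter> space M)"
    by (rule emeasure_distr[OF joint_measurable[OF assms(1)] assms(3)])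
  also have "(\<lambda>\<omega>. \<lambda>i\<in>J. \<theta> i \<omega>) -` {x \<in> space (PiM J (\<lambda>_. law)). P x} \<inter> space M = {\<omega> \<in> space M. P (\<lambda>i\<in>J. \<theta> i \<omega>)}"
    using measurable_space[OF joint_measurable[OF assms(1)]] by auto
  finally show ?thesis by simp
qed

definition subsets :: "nat \<Rightarrow> nat set set" where
  "subsets n = {\<alpha>. \<alpha> \<subseteq> {1..n} \<and> card \<alpha> = m}"

definition event :: "real \<Rightarrow> nat set \<Rightarrow> 'a set" where
  "event \<epsilon> \<alpha> = {\<omega> \<in> space M. gap m g (\<lambda>i. \<theta> (enumerate \<alpha> i) \<omega>) \<le> \<epsilon>}"

lemma finite_subsets: "finite (subsets n)"
  by (simp add: subsets_def)

lemma card_subsets: "card (subsets n) = n choose m"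
  unfolding subsets_def by (subst n_subsets) auto

lemma subsetsD:
  assumes "\<alpha> \<in> subsets n"
  shows "finite \<alpha>" "\<alpha> \<subseteq> {1..}" "\<alpha> \<subseteq> {1..n}" "card \<alpha> = m" "\<alpha> \<noteq> {}" "bij_betw (enumerate \<alpha>) {..<m} \<alpha>"
proof -
  show f: "finite \<alpha>" using assms finite_subset[of \<alpha> "{1..n}"] by (auto simp: subsets_def)
  show c: "card \<alpha> = m" "\<alpha> \<subseteq> {1..}" "\<alpha> \<subseteq> {1..n}" using assms by (auto simp: subsets_def)
  show "\<alpha> \<noteq> {}" using c m_pos by auto
  show "bij_betw (enumerate \<alpha>) {..<m} \<alpha>" using finite_bij_enumerate[OF f] c by simp
qed

lemma gap_restrict:
  assumes "e ` {..<m} \<subseteq> J"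
  shows "gap m g (\<lambda>i. (\<lambda>i\<in>J. \<theta> i \<omega>) (e i)) = gap m g (\<lambda>i. \<theta> (e i) \<omega>)"
  using assms by (intro gap_cong) (auto simp: image_subset_iff)

lemma gap_event_sets:
  assumes "e ` {..<m} \<subseteq> J"
  shows "{x \<in> space (PiM J (\<lambda>_. law)). gap m g (\<lambda>i. x (e i)) \<le> \<epsilon>} \<in> sets (PiM J (\<lambda>_. law))"
  by (intro borel_measurable_le gap_reindex_measurable assms borel_measurable_const)

lemma emeasure_event:
  assumes \<alpha>: "\<alpha> \<in> subsets n"
  shows "emeasure M (event \<epsilon> \<alpha>) = ennreal (hit \<epsilon>)"
proof -
  note D = subsetsD[OF \<alpha>]
  have e: "enumerate \<alpha> ` {..<m} \<subseteq> \<alpha>" using D(6) by (simp add: bij_betw_def)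
  have "event \<epsilon> \<alpha> = {\<omega> \<in> space M. gap m g (\<lambda>i. (\<lambda>i\<in>\<alpha>. \<theta> i \<omega>) (enumerate \<alpha> i)) \<le> \<epsilon>}"
    unfolding gap_restrict[OF e] event_def ..
  then show ?thesis
    by (simp only: emeasure_joint[OF D(2,5) gap_event_sets[OF e]] emeasure_hit_reindex[OF D(6)])
qed

lemma event_sets:
  assumes \<alpha>: "\<alpha> \<in> subsets n"
  shows "event \<epsilon> \<alpha> \<in> events"
proof -
  note D = subsetsD[OF \<alpha>]
  have e: "enumerate \<alpha> ` {..<m} \<subseteq> \<alpha>" using D(6) by (simp add: bij_betw_def)
  have "(\<lambda>\<omega>. gap m g (\<lambda>i. (\<lambda>i\<in>\<alpha>. \<theta> i \<omega>) (enumerate \<alpha> i))) \<in> borel_measurable M"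
    by (rule measurable_compose[OF joint_measurable[OF D(2)] gap_reindex_measurable[OF e]])
  then show ?thesis unfolding event_def gap_restrict[OF e] by measurable
qed

lemma prob_event: "\<alpha> \<in> subsets n \<Longrightarrow> prob (event \<epsilon> \<alpha>) = hit \<epsilon>"
  using emeasure_event[of \<alpha> n \<epsilon>] unfolding emeasure_eq_measure
  by (subst (asm) ennreal_inj) (auto simp: hit_def)

text \<open>If both subsets are hits and share an index \<open>i0\<close>, every point of \<beta>
  outside \<alpha> lies within O(sqrt \<epsilon>) of a polygon position relative to
  \<open>i0\<close>. Those points are independent of the ones in \<alpha>, which gives one factor
  O(sqrt \<epsilon>) for each index of \<beta> outside \<alpha>.\<close>

lemma prob_event_pair:
  "\<exists>K>0. \<exists>\<epsilon>0>0. \<forall>\<epsilon> n \<alpha> \<beta>. 0 \<le> \<epsilon> \<and> \<epsilon> < \<epsilon>0 \<and> \<alpha> \<in> subsets n \<and> \<beta> \<in> subsets n \<and> \<alpha> \<inter> \<beta> \<noteq> {} \<longrightarrow>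
    prob (event \<epsilon> \<alpha> \<inter> event \<epsilon> \<beta>) \<le> hit \<epsilon> * (K * sqrt \<epsilon>) ^ card (\<beta> - \<alpha>)"
proof -
  obtain C \<epsilon>1 where C: "C > 0" "\<epsilon>1 > 0" and pairs: "\<forall>\<epsilon> x. 0 \<le> \<epsilon> \<and> \<epsilon> < \<epsilon>1 \<and> gap m g x \<le> \<epsilon> \<longrightarrow>
      (\<forall>i<m. \<forall>j<m. \<exists>k::int. \<bar>x j - x i - 2 * pi * of_int k / real m\<bar> \<le> C * sqrt \<epsilon>)"
    using gap_pairs by blast
  obtain B where B: "B > 0"
    "\<And>\<rho> x. 0 \<le> \<rho> \<Longrightarrow> \<rho> \<le> 2 * pi / m \<Longrightarrow> emeasure law {z. z - x \<in> near_set \<rho>} \<le> ennreal (B * \<rho>)"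
    by (rule law_near_set) (rule that; assumption)
  \<comment> \<open>The second bound keeps the radius \<open>C * sqrt \<epsilon>\<close> within the
    range \<open>2 * pi / m\<close> for which \<open>law_near_set\<close> holds.\<close>
  define \<epsilon>0 where "\<epsilon>0 = min \<epsilon>1 ((2 * pi / m / C)\<^sup>2)"
  have "\<epsilon>0 > 0" using C m_pos by (simp add: \<epsilon>0_def)
  have main: "prob (event \<epsilon> \<alpha> \<inter> event \<epsilon> \<beta>) \<le> hit \<epsilon> * (B * C * sqrt \<epsilon>) ^ card (\<beta> - \<alpha>)"
    if \<epsilon>: "0 \<le> \<epsilon>" "\<epsilon> < \<epsilon>0" and \<alpha>: "\<alpha> \<in> subsets n" and \<beta>: "\<beta> \<in> subsets n" and ne: "\<alpha> \<inter> \<beta> \<noteq> {}" for \<epsilon> n \<alpha> \<beta>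
  proof -
    note D = subsetsD[OF \<alpha>] and D' = subsetsD[OF \<beta>]
    obtain i0 where i0: "i0 \<in> \<alpha>" "i0 \<in> \<beta>" using ne by blast
    define \<rho> where "\<rho> = C * sqrt \<epsilon>"
    have \<rho>: "0 \<le> \<rho>" "\<rho> \<le> 2 * pi / m"
    proof -
      have "sqrt \<epsilon> \<le> sqrt ((2 * pi / m / C)\<^sup>2)" using \<epsilon>(2) by (intro real_sqrt_le_mono) (simp add: \<epsilon>0_def)
      also have "\<dots> = 2 * pi / m / C" using C m_pos by simp
      finally have "sqrt \<epsilon> * C \<le> 2 * pi / m" by (simp only: pos_le_divide_eq[OF C(1)])
      then show "\<rho> \<le> 2 * pi / m" by (simp add: \<rho>_def mult.commute)
      show "0 \<le> \<rho>" using C \<epsilon> by (simp add: \<rho>_def)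
    qed
    let ?J = "\<beta> - \<alpha>"
    let ?P = "PiM (\<alpha> \<union> ?J) (\<lambda>_. law)"
    define Q where "Q x \<longleftrightarrow> gap m g (\<lambda>i. x (enumerate \<alpha> i)) \<le> \<epsilon> \<and> (\<forall>j\<in>?J. x j - x i0 \<in> near_set \<rho>)" for x
    have e: "enumerate \<alpha> ` {..<m} \<subseteq> \<alpha> \<union> ?J" using D(6) by (auto simp: bij_betw_def)
    have Qs: "{x \<in> space ?P. Q x} \<in> sets ?P"
    proof -
      have cm: "(\<lambda>x. x j) \<in> borel_measurable ?P" if "j \<in> \<alpha> \<union> ?J" for j
        using measurable_component_singleton[OF that, of "\<lambda>_. law"] by (simp add: measurable_cong_sets[OF refl sets_law])
      have dm: "(\<lambda>x. x j - x i0) \<in> borel_measurable ?P" if "j \<in> ?J" for j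
        using that i0 by (intro borel_measurable_diff cm) auto
      have "{x \<in> space ?P. Q x} = {x \<in> space ?P. gap m g (\<lambda>i. x (enumerate \<alpha> i)) \<le> \<epsilon>} \<inter> {x \<in> space ?P. \<forall>j\<in>?J. x j - x i0 \<in> near_set \<rho>}"
        by (auto simp: Q_def)
      also have "\<dots> \<in> sets ?P"
        using D'(1) measurable_sets[OF dm near_set_measurable]
        by (intro sets.Int gap_event_sets e sets.sets_Collect_finite_All)
          (auto simp: vimage_def Int_def conj_commute)
      finally show ?thesis .
    qed
    have sub: "event \<epsilon> \<alpha> \<inter> event \<epsilon> \<beta> \<subseteq> {\<omega> \<in> space M. Q (\<lambda>i\<in>\<alpha> \<union> ?J. \<theta> i \<omega>)}"
    proof
      fix \<omega> assume \<omega>: "\<omega> \<in> event \<epsilon> \<alpha> \<inter> event \<epsilon> \<beta>"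
      have "\<theta> j \<omega> - \<theta> i0 \<omega> \<in> near_set \<rho>" if "j \<in> ?J" for j
      proof -
        obtain a b where ab: "a < m" "enumerate \<beta> a = i0" "b < m" "enumerate \<beta> b = j"
          using D'(6) i0(2) \<open>j \<in> ?J\<close> unfolding bij_betw_def by (metis (no_types, lifting) DiffD1 imageE lessThan_iff)
        have "gap m g (\<lambda>i. \<theta> (enumerate \<beta> i) \<omega>) \<le> \<epsilon>" using \<omega> by (simp add: event_def)
        then have "\<exists>k::int. \<bar>\<theta> (enumerate \<beta> b) \<omega> - \<theta> (enumerate \<beta> a) \<omega> - 2 * pi * of_int k / real m\<bar> \<le> C * sqrt \<epsilon>"
          using \<epsilon> ab by (intro pairs[rule_format]) (auto simp: \<epsilon>0_def)
        then show ?thesis using ab by (simp add: near_set_def \<rho>_def)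
      qed
      then show "\<omega> \<in> {\<omega> \<in> space M. Q (\<lambda>i\<in>\<alpha> \<union> ?J. \<theta> i \<omega>)}"
        using \<omega> i0 gap_restrict[OF e, of \<omega>] by (auto simp: Q_def event_def)
    qed
    have J: "\<alpha> \<union> ?J \<subseteq> {1..}" "\<alpha> \<union> ?J \<noteq> {}" using D D' by auto
    have Q_ev: "{\<omega> \<in> space M. Q (\<lambda>i\<in>\<alpha> \<union> ?J. \<theta> i \<omega>)} \<in> events"
    proof -
      have "(\<lambda>\<omega>. \<lambda>i\<in>\<alpha> \<union> ?J. \<theta> i \<omega>) -` {x \<in> space ?P. Q x} \<inter> space M \<in> events"
        by (rule measurable_sets[OF joint_measurable[OF J(1)] Qs])
      moreover have "(\<lambda>\<omega>. \<lambda>i\<in>\<alpha> \<union> ?J. \<theta> i \<omega>) -` {x \<in> space ?P. Q x} \<inter> space M = {\<omega> \<in> space M. Q (\<lambda>i\<in>\<alpha> \<union> ?J. \<theta> i \<omega>)}"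
        using measurable_space[OF joint_measurable[OF J(1)]] by auto
      ultimately show ?thesis by simp
    qed
    have "emeasure M (event \<epsilon> \<alpha> \<inter> event \<epsilon> \<beta>) \<le> emeasure M {\<omega> \<in> space M. Q (\<lambda>i\<in>\<alpha> \<union> ?J. \<theta> i \<omega>)}"
      by (rule emeasure_mono[OF sub Q_ev])
    also have "\<dots> = emeasure ?P {x \<in> space ?P. Q x}" by (rule emeasure_joint[OF J Qs])
    also have "\<dots> \<le> ennreal (hit \<epsilon> * (B * \<rho>) ^ card ?J)"
      unfolding Q_def using D' i0 B \<rho> by (intro emeasure_hit_near[OF D(6)]) auto
    finally have "prob (event \<epsilon> \<alpha> \<inter> event \<epsilon> \<beta>) \<le> hit \<epsilon> * (B * \<rho>) ^ card ?J"
      unfolding emeasure_eq_measure using B \<rho> by (subst (asm) ennreal_le_iff) (auto simp: hit_def)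
    then show ?thesis by (simp add: \<rho>_def mult.assoc)
  qed
  show ?thesis
    by (rule exI[of _ "B * C"], rule conjI, simp add: B(1) C(1), rule exI[of _ \<epsilon>0], rule conjI, fact)
      (intro allI impI main; elim conjE; assumption)
qed

text \<open>The product is a function of the angles with indices outside \<alpha>, hence independent
  of the event of \<alpha>. This is the independence hypothesis of the Poisson bound.\<close>

lemma independence_of_disjoint:
  assumes \<alpha>: "\<alpha> \<in> subsets n" and S: "S \<subseteq> {\<beta> \<in> subsets n. \<beta> \<inter> \<alpha> = {}}" and s: "s \<in> {0..1::real}"
  shows "(\<integral>\<omega>. indicator (event \<epsilon> \<alpha>) \<omega> * (\<Prod>\<beta>\<in>S. 1 - s * indicator (event \<epsilon> \<beta>) \<omega>) \<partial>M)
    = prob (event \<epsilon> \<alpha>) * (\<integral>\<omega>. (\<Prod>\<beta>\<in>S. 1 - s * indicator (event \<epsilon> \<beta>) \<omega>) \<partial>M)"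
proof -
  let ?B = "{1..n} - \<alpha>"
  note D = subsetsD[OF \<alpha>]
  define Z where "Z \<beta> x = (indicator {..\<epsilon>} (gap m g (\<lambda>i. x (enumerate \<beta> i))) :: real)" for \<beta> :: "nat set" and x :: "nat \<Rightarrow> real"
  have e: "enumerate \<beta> ` {..<m} \<subseteq> \<beta>" if "\<beta> \<in> subsets n" for \<beta>
    using subsetsD(6)[OF that] by (simp add: bij_betw_def)
  have SB: "\<beta> \<in> subsets n" "\<beta> \<subseteq> ?B" if "\<beta> \<in> S" for \<beta> using that S subsetsD(3) by blast+
  have Zm: "Z \<beta> \<in> borel_measurable (PiM J (\<lambda>_. borel))" if "\<beta> \<in> subsets n" "\<beta> \<subseteq> J" for \<beta> J
    unfolding Z_def measurable_PiM_borel_cong[OF sets_law, symmetric]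
    using e[OF that(1)] that(2) by (intro measurable_compose[OF gap_reindex_measurable]) auto
  have Z: "Z \<beta> (\<lambda>i\<in>J. \<theta> i \<omega>) = indicator (event \<epsilon> \<beta>) \<omega>" if "\<beta> \<in> subsets n" "\<beta> \<subseteq> J" "\<omega> \<in> space M" for \<beta> J \<omega>
    using gap_restrict[of "enumerate \<beta>" J \<omega>] e[OF that(1)] that by (auto simp: Z_def event_def indicator_def)
  define X1 where "X1 \<omega> = Z \<alpha> (\<lambda>i\<in>\<alpha>. \<theta> i \<omega>)" for \<omega>
  define X2 where "X2 \<omega> = (\<Prod>\<beta>\<in>S. 1 - s * Z \<beta> (\<lambda>i\<in>?B. \<theta> i \<omega>))" for \<omega>
  have "indep_var borel (Z \<alpha> \<circ> (\<lambda>\<omega>. \<lambda>i\<in>\<alpha>. \<theta> i \<omega>)) borel ((\<lambda>x. \<Prod>\<beta>\<in>S. 1 - s * Z \<beta> x) \<circ> (\<lambda>\<omega>. \<lambda>i\<in>?B. \<theta> i \<omega>))"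
  proof (rule indep_var_compose[OF indep_var_restrict[OF indep]])
    show "Z \<alpha> \<in> borel_measurable (PiM \<alpha> (\<lambda>_. borel))" using \<alpha> by (intro Zm) auto
    show "(\<lambda>x. \<Prod>\<beta>\<in>S. 1 - s * Z \<beta> x) \<in> borel_measurable (PiM ?B (\<lambda>_. borel))"
      using SB Zm by (intro borel_measurable_prod borel_measurable_diff borel_measurable_times borel_measurable_const) auto
  qed (use D(2) in auto)
  then have ind: "indep_var borel X1 borel X2" by (simp add: comp_def X1_def[abs_def] X2_def[abs_def])
  have Z01: "0 \<le> Z \<beta> x" "Z \<beta> x \<le> 1" for \<beta> x by (auto simp: Z_def indicator_def)
  have sZ: "0 \<le> s * Z \<beta> x" "s * Z \<beta> x \<le> 1" for \<beta> x
    using s Z01[of \<beta> x] by (auto intro: mult_le_one)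
  have X1i: "integrable M X1"
    using indep_var_rv1[OF ind] Z01 by (intro integrable_const_bound[where B = 1]) (auto simp: X1_def)
  have X2i: "integrable M X2"
    using indep_var_rv2[OF ind] sZ
    by (intro integrable_const_bound[where B = 1]) (auto simp: X2_def abs_prod intro!: prod_le_1)
  have X1: "X1 \<omega> = indicator (event \<epsilon> \<alpha>) \<omega>" if "\<omega> \<in> space M" for \<omega>
    unfolding X1_def using \<alpha> that by (intro Z) auto
  have X2: "X2 \<omega> = (\<Prod>\<beta>\<in>S. 1 - s * indicator (event \<epsilon> \<beta>) \<omega>)" if "\<omega> \<in> space M" for \<omega>
    unfolding X2_def using SB that by (intro prod.cong) (auto simp: Z)
  have "(\<integral>\<omega>. indicator (event \<epsilon> \<alpha>) \<omega> * (\<Prod>\<beta>\<in>S. 1 - s * indicator (event \<epsilon> \<beta>) \<omega>) \<partial>M) = (\<integral>\<omega>. X1 \<omega> * X2 \<omega> \<partial>M)"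
    by (intro Bochner_Integration.integral_cong) (auto simp: X1 X2)
  also have "\<dots> = (\<integral>\<omega>. X1 \<omega> \<partial>M) * (\<integral>\<omega>. X2 \<omega> \<partial>M)"
    by (rule indep_var_lebesgue_integral[OF ind X1i X2i])
  also have "(\<integral>\<omega>. X1 \<omega> \<partial>M) = (\<integral>\<omega>. indicator (event \<epsilon> \<alpha>) \<omega> \<partial>M)"
    by (intro Bochner_Integration.integral_cong) (auto simp: X1)
  also have "\<dots> = prob (event \<epsilon> \<alpha>)" using event_sets[OF \<alpha>] by simp
  also have "(\<integral>\<omega>. X2 \<omega> \<partial>M) = (\<integral>\<omega>. (\<Prod>\<beta>\<in>S. 1 - s * indicator (event \<epsilon> \<beta>) \<omega>) \<partial>M)"
    by (intro Bochner_Integration.integral_cong) (auto simp: X2)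
  finally show ?thesis .
qed

text \<open>Neighbours of \<alpha> are the subsets meeting it, grouped by the number
  \<open>k\<close> of new indices, with at most \<open>2 ^ m * n ^ k\<close> in each group. Meeting
  \<alpha> forces \<open>k < m\<close>; in the pair sum \<alpha> itself is left out, and a different
  set of the same size has at least one new index, so there \<open>k\<close> starts at 1.\<close>

lemma poisson_error:
  "\<exists>K>0. \<exists>\<epsilon>0>0. \<forall>\<epsilon> n. 0 \<le> \<epsilon> \<and> \<epsilon> < \<epsilon>0 \<longrightarrow>
    \<bar>prob (space M - (\<Union>\<alpha>\<in>subsets n. event \<epsilon> \<alpha>)) - exp (- (real (n choose m) * hit \<epsilon>))\<bar>
    \<le> real (n choose m) * hit \<epsilon> * (2 ^ m * (\<Sum>k<m. real n ^ k * hit \<epsilon>) + 2 ^ m * (\<Sum>k = 1..<m. (real n * (K * sqrt \<epsilon>)) ^ k))"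
proof -
  obtain K \<epsilon>0 where K: "K > 0" "\<epsilon>0 > 0" and pair:
    "\<forall>\<epsilon> n \<alpha> \<beta>. 0 \<le> \<epsilon> \<and> \<epsilon> < \<epsilon>0 \<and> \<alpha> \<in> subsets n \<and> \<beta> \<in> subsets n \<and> \<alpha> \<inter> \<beta> \<noteq> {} \<longrightarrow>
      prob (event \<epsilon> \<alpha> \<inter> event \<epsilon> \<beta>) \<le> hit \<epsilon> * (K * sqrt \<epsilon>) ^ card (\<beta> - \<alpha>)"
    using prob_event_pair by blast
  have "\<bar>prob (space M - (\<Union>\<alpha>\<in>subsets n. event \<epsilon> \<alpha>)) - exp (- (real (n choose m) * hit \<epsilon>))\<bar>
    \<le> real (n choose m) * hit \<epsilon> * (2 ^ m * (\<Sum>k<m. real n ^ k * hit \<epsilon>) + 2 ^ m * (\<Sum>k = 1..<m. (real n * (K * sqrt \<epsilon>)) ^ k))"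
    if \<epsilon>: "0 \<le> \<epsilon>" "\<epsilon> < \<epsilon>0" for \<epsilon> n
  proof -
    define N where "N \<alpha> = {\<beta> \<in> subsets n. \<beta> \<inter> \<alpha> \<noteq> {}}" for \<alpha>
    have h0: "hit \<epsilon> \<ge> 0" by (simp add: hit_def)
    have sum_hit: "(\<Sum>\<alpha>\<in>subsets n. prob (event \<epsilon> \<alpha>)) = real (n choose m) * hit \<epsilon>"
      by (simp add: prob_event card_subsets)
    have diff: "card (\<beta> - \<alpha>) < m" if "\<alpha> \<in> subsets n" "\<beta> \<in> N \<alpha>" for \<alpha> \<beta>
    proof -
      have "\<beta> - \<alpha> \<subset> \<beta>" using that by (auto simp: N_def)
      then show ?thesis using that subsetsD(1,4)[of \<beta> n] psubset_card_mono[of \<beta> "\<beta> - \<alpha>"] by (simp add: N_def)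
    qed
    have diff1: "1 \<le> card (\<beta> - \<alpha>)" if "\<alpha> \<in> subsets n" "\<beta> \<in> N \<alpha> - {\<alpha>}" for \<alpha> \<beta>
    proof -
      have "\<beta> \<in> subsets n" using that by (simp add: N_def)
      then have "\<not> \<beta> \<subseteq> \<alpha>"
        using that subsetsD(1,4)[OF that(1)] subsetsD(1,4)[of \<beta> n] card_subset_eq[of \<alpha> \<beta>] by auto
      then have "\<beta> - \<alpha> \<noteq> {}" by blast
      then show ?thesis using subsetsD(1)[OF \<open>\<beta> \<in> subsets n\<close>] by (simp add: Suc_le_eq card_gt_0_iff)
    qed
    have t1: "(\<Sum>\<beta>\<in>N \<alpha>. prob (event \<epsilon> \<alpha>) * prob (event \<epsilon> \<beta>)) \<le> hit \<epsilon> * (2 ^ m * (\<Sum>k<m. real n ^ k * hit \<epsilon>))"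
      if \<alpha>: "\<alpha> \<in> subsets n" for \<alpha>
    proof -
      have "(\<Sum>\<beta>\<in>N \<alpha>. prob (event \<epsilon> \<alpha>) * prob (event \<epsilon> \<beta>)) = (\<Sum>\<beta>\<in>N \<alpha>. hit \<epsilon> * hit \<epsilon>)"
        using \<alpha> by (intro sum.cong) (auto simp: N_def prob_event)
      also have "\<dots> = hit \<epsilon> * (\<Sum>\<beta>\<in>N \<alpha>. hit \<epsilon>)" by (simp add: sum_distrib_left)
      also have "(\<Sum>\<beta>\<in>N \<alpha>. hit \<epsilon>) \<le> 2 ^ card \<alpha> * (\<Sum>k\<in>{..<m}. real n ^ k * hit \<epsilon>)"
      proof (rule sum_card_diff_le[where f = "\<lambda>_. hit \<epsilon>"])
        show "N \<alpha> \<subseteq> {\<beta>. \<beta> \<subseteq> {1..n} \<and> card (\<beta> - \<alpha>) \<in> {..<m}}"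
        proof
          fix \<beta> assume b: "\<beta> \<in> N \<alpha>"
          then have "\<beta> \<subseteq> {1..n}" using subsetsD(3)[of \<beta> n] by (simp add: N_def)
          then show "\<beta> \<in> {\<beta>. \<beta> \<subseteq> {1..n} \<and> card (\<beta> - \<alpha>) \<in> {..<m}}"
            using diff[OF \<alpha> b] by simp
        qed
      qed (use subsetsD(1)[OF \<alpha>] h0 in auto)
      finally show ?thesis using h0 subsetsD(4)[OF \<alpha>] by (simp add: mult_left_mono)
    qed
    have t2: "(\<Sum>\<beta>\<in>N \<alpha> - {\<alpha>}. prob (event \<epsilon> \<alpha> \<inter> event \<epsilon> \<beta>)) \<le> hit \<epsilon> * (2 ^ m * (\<Sum>k = 1..<m. (real n * (K * sqrt \<epsilon>)) ^ k))"
      if \<alpha>: "\<alpha> \<in> subsets n" for \<alpha>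
    proof -
      have "(\<Sum>\<beta>\<in>N \<alpha> - {\<alpha>}. prob (event \<epsilon> \<alpha> \<inter> event \<epsilon> \<beta>)) \<le> (\<Sum>\<beta>\<in>N \<alpha> - {\<alpha>}. hit \<epsilon> * (K * sqrt \<epsilon>) ^ card (\<beta> - \<alpha>))"
        using \<alpha> \<epsilon> by (intro sum_mono pair[rule_format]) (auto simp: N_def)
      also have "\<dots> = hit \<epsilon> * (\<Sum>\<beta>\<in>N \<alpha> - {\<alpha>}. (K * sqrt \<epsilon>) ^ card (\<beta> - \<alpha>))" by (simp add: sum_distrib_left)
      also have "\<dots> \<le> hit \<epsilon> * (2 ^ card \<alpha> * (\<Sum>k\<in>{1..<m}. real n ^ k * (K * sqrt \<epsilon>) ^ k))"
      proof (intro mult_left_mono sum_card_diff_le)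
        show "N \<alpha> - {\<alpha>} \<subseteq> {\<beta>. \<beta> \<subseteq> {1..n} \<and> card (\<beta> - \<alpha>) \<in> {1..<m}}"
        proof
          fix \<beta> assume b: "\<beta> \<in> N \<alpha> - {\<alpha>}"
          then have "\<beta> \<subseteq> {1..n}" using subsetsD(3)[of \<beta> n] by (simp add: N_def)
          then show "\<beta> \<in> {\<beta>. \<beta> \<subseteq> {1..n} \<and> card (\<beta> - \<alpha>) \<in> {1..<m}}"
            using diff[OF \<alpha>, of \<beta>] diff1[OF \<alpha> b] b by simp
        qed
      qed (use subsetsD(1)[OF \<alpha>] h0 K \<epsilon> in auto)
      finally show ?thesis using subsetsD(4)[OF \<alpha>] by (simp add: power_mult_distrib)
    qed
    have "\<bar>prob (space M - (\<Union>\<alpha>\<in>subsets n. event \<epsilon> \<alpha>)) - exp (- (\<Sum>\<alpha>\<in>subsets n. prob (event \<epsilon> \<alpha>)))\<bar>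
      \<le> (\<Sum>\<alpha>\<in>subsets n. \<Sum>\<beta>\<in>N \<alpha>. prob (event \<epsilon> \<alpha>) * prob (event \<epsilon> \<beta>))
        + (\<Sum>\<alpha>\<in>subsets n. \<Sum>\<beta>\<in>N \<alpha> - {\<alpha>}. prob (event \<epsilon> \<alpha> \<inter> event \<epsilon> \<beta>))"
    proof (rule poisson_approx_none)
      show "\<alpha> \<in> N \<alpha> \<and> N \<alpha> \<subseteq> subsets n" if "\<alpha> \<in> subsets n" for \<alpha>
        using that subsetsD(5)[OF that] by (auto simp: N_def)
    qed (auto simp: finite_subsets N_def intro!: event_sets independence_of_disjoint)
    also have "\<dots> \<le> (\<Sum>\<alpha>\<in>subsets n. hit \<epsilon> * (2 ^ m * (\<Sum>k<m. real n ^ k * hit \<epsilon>)))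
        + (\<Sum>\<alpha>\<in>subsets n. hit \<epsilon> * (2 ^ m * (\<Sum>k = 1..<m. (real n * (K * sqrt \<epsilon>)) ^ k)))"
      by (intro add_mono sum_mono t1 t2)
    also have "\<dots> = real (n choose m) * hit \<epsilon> * (2 ^ m * (\<Sum>k<m. real n ^ k * hit \<epsilon>) + 2 ^ m * (\<Sum>k = 1..<m. (real n * (K * sqrt \<epsilon>)) ^ k))"
      by (simp add: card_subsets distrib_left)
    finally show ?thesis unfolding sum_hit .
  qed
  then show ?thesis using K by blast
qed

end

section \<open>Evaluation of the constant and passage to the limit\<close>

lemma sqrt_power_powr: "t > 0 \<Longrightarrow> sqrt t ^ k = t powr (real k / 2)"
  by (simp add: powr_half_sqrt[symmetric] powr_power)

context polygon_points
begin

text \<open>The unit ball in dimension \<open>m - 1\<close> has volume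
  \<open>pi powr ((m - 1) / 2) / Gamma ((m + 1) / 2)\<close>, the radius sqrt 2 completes the power
  of \<open>2 * pi\<close>, and the two factorials leave 1/m.\<close>

lemma ell_vol_limit_const:
  "fact (m - 1) * density_overlap m p * ell_vol / fact m = limit_const m g p / m"
proof -
  have r: "real (m - 1) = real m - 1" using m_pos by (simp add: of_nat_diff)
  have f: "(fact m :: real) = real m * fact (m - 1)" using m_pos by (simp add: fact_reduce)
  have e1: "(2 * pi) powr ((real m - 1) / 2) = sqrt 2 ^ (m - 1) * pi powr ((real m - 1) / 2)"
    by (simp add: powr_mult sqrt_power_powr r[unfolded One_nat_def])
  have e2: "(real m - 1) / 2 + 1 = (real m + 1) / 2" by (simp add: field_simps)
  show ?thesis
    unfolding ell_vol_def limit_const_def unit_ball_vol_def r f e1 e2 by (simp add: mult_ac)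
qed

lemma prob_hit_limit:
  assumes t: "t > 0"
  shows "(\<lambda>n. prob (\<Union>\<alpha>\<in>subsets n. event (t * real n powr (- (2 * real m / (real m - 1)))) \<alpha>))
    \<longlonglongrightarrow> 1 - exp (- (t powr ((real m - 1) / 2) * limit_const m g p / m))"
proof -
  define r where "r = real m / (real m - 1)"
  have m1: "real m - 1 > 0" using m_ge_2 by simp
  have r: "r > 1" "(real m - 1) * r = real m" using m1 by (auto simp: r_def)
  \<comment> \<open>The shift by one keeps the sample size positive for every \<open>n\<close>; it
    is undone at the very end.\<close>
  define N where "N n = real (Suc n)" for n
  define s where "s n = sqrt t * N n powr (- r)" for n
  define \<epsilon> where "\<epsilon> n = t * N n powr (- (2 * r))" for n
  define T where "T = t powr ((real m - 1) / 2)"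
  define L where "L = fact (m - 1) * density_overlap m p * ell_vol"
  have N: "N n > 0" for n by (simp add: N_def)
  have N_top: "filterlim N at_top sequentially"
    unfolding N_def using filterlim_real_sequentially by (subst filterlim_sequentially_Suc)
  have s_pos: "s n > 0" for n using t N[of n] by (simp add: s_def)
  have s2: "(s n)\<^sup>2 = \<epsilon> n" for n
    using t N[of n] by (simp add: s_def \<epsilon>_def power_mult_distrib powr_power)
  have sqrt_\<epsilon>: "sqrt (\<epsilon> n) = s n" for n using s_pos[of n] by (simp flip: s2)
  have powr0: "(\<lambda>n. N n powr a) \<longlonglongrightarrow> 0" if "a < 0" for a
    by (rule tendsto_neg_powr[OF that N_top])
  have s0: "s \<longlonglongrightarrow> 0"
    unfolding s_def[abs_def] using tendsto_mult_right_zero[OF powr0[of "- r"], of "sqrt t"] r by simp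
  \<comment> \<open>This identity fixes the exponent: \<open>s n ^ (m - 1)\<close> is the order of
    the probability of a hit and \<open>N n ^ m\<close> that of the number of subsets.\<close>
  have sN: "s n ^ (m - 1) * N n ^ m = T" for n
  proof -
    have "(N n powr (- r)) ^ (m - 1) = N n powr (- real m)"
      using N[of n] r(2) m_pos by (simp add: powr_power of_nat_diff)
    also have "\<dots> = 1 / N n ^ m" using N[of n] by (simp add: powr_minus powr_realpow divide_inverse)
    finally show ?thesis
      using N[of n] t m_pos unfolding s_def T_def power_mult_distrib by (simp add: sqrt_power_powr of_nat_diff)
  qed
  have "(\<lambda>n. hit ((s n)\<^sup>2) / s n ^ (m - 1) * T) \<longlonglongrightarrow> L * T"
    unfolding L_def by (intro tendsto_mult_right hit_asymptotics s0 s_pos)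
  moreover have "hit ((s n)\<^sup>2) / s n ^ (m - 1) * T = hit (\<epsilon> n) * N n ^ m" for n
    using s_pos[of n] by (simp add: s2 flip: sN[of n])
  ultimately have hitN: "(\<lambda>n. hit (\<epsilon> n) * N n ^ m) \<longlonglongrightarrow> L * T" by simp
  define lam where "lam n = real (Suc n choose m) * hit (\<epsilon> n)" for n
  have lam: "lam \<longlonglongrightarrow> L * T / fact m"
  proof -
    have "(\<lambda>n. real (Suc n choose m) / N n ^ m * (hit (\<epsilon> n) * N n ^ m)) \<longlonglongrightarrow> 1 / fact m * (L * T)"
      unfolding N_def by (intro tendsto_mult LIMSEQ_Suc[OF real_choose_asymp] hitN[unfolded N_def])
    moreover have "real (Suc n choose m) / N n ^ m * (hit (\<epsilon> n) * N n ^ m) = lam n" for n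
      using N[of n] by (simp add: lam_def)
    ultimately show ?thesis by simp
  qed
  obtain K \<epsilon>0 where K: "K > 0" "\<epsilon>0 > 0" and err: "\<forall>\<epsilon> n. 0 \<le> \<epsilon> \<and> \<epsilon> < \<epsilon>0 \<longrightarrow>
    \<bar>prob (space M - (\<Union>\<alpha>\<in>subsets n. event \<epsilon> \<alpha>)) - exp (- (real (n choose m) * hit \<epsilon>))\<bar>
    \<le> real (n choose m) * hit \<epsilon> * (2 ^ m * (\<Sum>k<m. real n ^ k * hit \<epsilon>) + 2 ^ m * (\<Sum>k = 1..<m. (real n * (K * sqrt \<epsilon>)) ^ k))"
    using poisson_error by blast
  define E where "E n = lam n * (2 ^ m * (\<Sum>k<m. N n ^ k * hit (\<epsilon> n)) + 2 ^ m * (\<Sum>k = 1..<m. (N n * (K * s n)) ^ k))" for n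
  have E: "E \<longlonglongrightarrow> 0"
  proof -
    have inv0: "(\<lambda>n. inverse (N n)) \<longlonglongrightarrow> 0" by (rule tendsto_inverse_0_at_top[OF N_top])
    \<comment> \<open>\<open>hit (\<epsilon> n)\<close> is of order \<open>N n ^ -m\<close>, so any
      smaller power of \<open>N n\<close> does not compensate it.\<close>
    have a: "(\<lambda>n. N n ^ k * hit (\<epsilon> n)) \<longlonglongrightarrow> 0" if "k < m" for k
    proof -
      have "(\<lambda>n. hit (\<epsilon> n) * N n ^ m * inverse (N n) ^ (m - k)) \<longlonglongrightarrow> L * T * 0 ^ (m - k)"
        by (intro tendsto_mult hitN tendsto_power inv0)
      moreover have "hit (\<epsilon> n) * N n ^ m * inverse (N n) ^ (m - k) = N n ^ k * hit (\<epsilon> n)" for n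
      proof -
        have "N n ^ m = N n ^ k * N n ^ (m - k)" using that by (simp flip: power_add)
        then show ?thesis using N[of n] by (simp add: power_inverse)
      qed
      ultimately show ?thesis using that by (simp add: power_0_left)
    qed
    \<comment> \<open>The exponent is \<open>1 - r\<close>, that is \<open>-1 / (m - 1)\<close>,
      which is negative.\<close>
    have Ns: "(\<lambda>n. N n * (K * s n)) \<longlonglongrightarrow> 0"
    proof -
      have "N n * (K * s n) = K * sqrt t * N n powr (1 - r)" for n
        using N[of n] by (simp add: s_def powr_diff powr_minus divide_inverse)
      then have "(\<lambda>n. N n * (K * s n)) = (\<lambda>n. K * sqrt t * N n powr (1 - r))" by (rule ext)
      then show ?thesis
        using tendsto_mult_right_zero[OF powr0[of "1 - r"], of "K * sqrt t"] r by (simp only: diff_less_0_iff_less)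
    qed
    have b: "(\<lambda>n. (N n * (K * s n)) ^ k) \<longlonglongrightarrow> 0" if "k \<ge> 1" for k
      using tendsto_power[OF Ns, of k] that by (simp add: power_0_left)
    have "E \<longlonglongrightarrow> L * T / fact m * (2 ^ m * (\<Sum>k<m. 0) + 2 ^ m * (\<Sum>k = 1..<m. 0))"
      unfolding E_def[abs_def] using a b by (intro tendsto_mult lam tendsto_add tendsto_const tendsto_sum) auto
    then show ?thesis by simp
  qed
  define q where "q n = prob (space M - (\<Union>\<alpha>\<in>subsets (Suc n). event (\<epsilon> n) \<alpha>))" for n
  have "\<epsilon> \<longlonglongrightarrow> 0" using tendsto_power[OF s0, of 2] by (simp add: s2)
  then have "\<forall>\<^sub>F n in sequentially. \<epsilon> n < \<epsilon>0" using K(2) by (rule order_tendstoD(2))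
  then have ev: "\<forall>\<^sub>F n in sequentially. norm (q n - exp (- lam n)) \<le> E n"
  proof eventually_elim
    case (elim n)
    have "0 \<le> \<epsilon> n" by (simp flip: s2)
    with elim err have "\<bar>prob (space M - (\<Union>\<alpha>\<in>subsets (Suc n). event (\<epsilon> n) \<alpha>)) - exp (- (real (Suc n choose m) * hit (\<epsilon> n)))\<bar>
      \<le> real (Suc n choose m) * hit (\<epsilon> n) * (2 ^ m * (\<Sum>k<m. real (Suc n) ^ k * hit (\<epsilon> n)) + 2 ^ m * (\<Sum>k = 1..<m. (real (Suc n) * (K * sqrt (\<epsilon> n))) ^ k))"
      by blast
    then show ?case unfolding q_def E_def lam_def N_def sqrt_\<epsilon> by simp
  qed
  have "(\<lambda>n. q n - exp (- lam n)) \<longlonglongrightarrow> 0" by (rule Lim_null_comparison[OF ev E])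
  moreover have "(\<lambda>n. exp (- lam n)) \<longlonglongrightarrow> exp (- (L * T / fact m))" by (intro tendsto_intros lam)
  ultimately have "(\<lambda>n. (q n - exp (- lam n)) + exp (- lam n)) \<longlonglongrightarrow> 0 + exp (- (L * T / fact m))"
    by (rule tendsto_add)
  then have "(\<lambda>n. 1 - q n) \<longlonglongrightarrow> 1 - exp (- (L * T / fact m))" by (intro tendsto_diff tendsto_const) simp
  moreover have "1 - q n = prob (\<Union>\<alpha>\<in>subsets (Suc n). event (t * real (Suc n) powr (- (2 * real m / (real m - 1)))) \<alpha>)" for n
  proof -
    have "(\<Union>\<alpha>\<in>subsets (Suc n). event (\<epsilon> n) \<alpha>) \<in> events"
      using finite_subsets event_sets by (intro sets.finite_UN) auto
    then have "1 - q n = prob (\<Union>\<alpha>\<in>subsets (Suc n). event (\<epsilon> n) \<alpha>)" unfolding q_def by (simp add: prob_compl)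
    then show ?thesis by (simp add: \<epsilon>_def N_def r_def)
  qed
  moreover have "L * T / fact m = t powr ((real m - 1) / 2) * limit_const m g p / m"
  proof -
    have "L * T / fact m = T * (L / fact m)" by simp
    then show ?thesis unfolding L_def ell_vol_limit_const T_def by simp
  qed
  ultimately have "(\<lambda>n. prob (\<Union>\<alpha>\<in>subsets (Suc n). event (t * real (Suc n) powr (- (2 * real m / (real m - 1)))) \<alpha>))
    \<longlonglongrightarrow> 1 - exp (- (t powr ((real m - 1) / 2) * limit_const m g p / m))" by simp
  then show ?thesis by (rule LIMSEQ_imp_Suc)
qed

text \<open>Increasing index tuples correspond to \<open>m\<close>-subsets, as the statistic is symmetric.\<close>

lemma max_stat_subsets:
  assumes U: "\<And>i. i \<ge> 1 \<Longrightarrow> U i \<omega> = cis (\<theta> i \<omega>)"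
  shows "{pair_sum m g (\<lambda>k. U (\<iota> k) \<omega>) | \<iota>. strict_mono_on {1..m} \<iota> \<and> \<iota> \<in> {1..m} \<rightarrow> {1..n}}
    = (\<lambda>\<alpha>. angle_sum m g (\<lambda>i. \<theta> (enumerate \<alpha> i) \<omega>)) ` subsets n" (is "?L = ?R")
proof
  show "?L \<subseteq> ?R"
  proof
    fix y assume "y \<in> ?L"
    then obtain \<iota> where \<iota>: "strict_mono_on {1..m} \<iota>" "\<iota> \<in> {1..m} \<rightarrow> {1..n}" and y: "y = pair_sum m g (\<lambda>k. U (\<iota> k) \<omega>)"
      by blast
    define \<alpha> where "\<alpha> = \<iota> ` {1..m}"
    have inj: "inj_on \<iota> {1..m}" using \<iota>(1) by (rule strict_mono_on_imp_inj_on)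
    have \<alpha>: "\<alpha> \<in> subsets n" using \<iota>(2) inj by (auto simp: subsets_def \<alpha>_def card_image)
    have "bij_betw Suc {..<m} {1..m}" by (rule bij_betw_byWitness[where f' = "\<lambda>i. i - 1"]) auto
    moreover have "bij_betw \<iota> {1..m} \<alpha>" using inj by (simp add: bij_betw_def \<alpha>_def)
    ultimately have "bij_betw (\<iota> \<circ> Suc) {..<m} \<alpha>" by (rule bij_betw_trans)
    then have b: "bij_betw (\<lambda>i. \<iota> (Suc i)) {..<m} \<alpha>" by (simp add: comp_def)
    have "y = angle_sum m g (\<lambda>i. \<theta> (\<iota> (Suc i)) \<omega>)"
      unfolding y using \<iota>(2) by (intro pair_sum_eq U) (auto simp: Pi_iff)
    also have "\<dots> = angle_sum m g (\<lambda>i. \<theta> (enumerate \<alpha> i) \<omega>)"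
      using gap_bij_eq[OF b subsetsD(6)[OF \<alpha>], of "\<lambda>i. \<theta> i \<omega>"] by (simp add: gap_def)
    finally show "y \<in> ?R" using \<alpha> by blast
  qed
  show "?R \<subseteq> ?L"
  proof
    fix y assume "y \<in> ?R"
    then obtain \<alpha> where \<alpha>: "\<alpha> \<in> subsets n" and y: "y = angle_sum m g (\<lambda>i. \<theta> (enumerate \<alpha> i) \<omega>)" by blast
    note D = subsetsD[OF \<alpha>]
    define \<iota> where "\<iota> k = enumerate \<alpha> (k - 1)" for k
    have in\<alpha>: "enumerate \<alpha> i \<in> \<alpha>" if "i < m" for i using D(6) that by (auto simp: bij_betw_def)
    have "strict_mono_on {1..m} \<iota>"
      using finite_enumerate_mono[OF _ D(1)] D(4) by (auto simp: strict_mono_on_def \<iota>_def)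
    moreover have "\<iota> \<in> {1..m} \<rightarrow> {1..n}" using in\<alpha> D(3) by (fastforce simp: \<iota>_def)
    moreover have "y = pair_sum m g (\<lambda>k. U (\<iota> k) \<omega>)"
    proof -
      have "1 \<le> enumerate \<alpha> i" if "i < m" for i using in\<alpha>[OF that] D(2) by auto
      then show ?thesis unfolding y by (intro pair_sum_eq[symmetric]) (simp add: \<iota>_def U)
    qed
    ultimately show "y \<in> ?L" by blast
  qed
qed

text \<open>For \<open>n \<ge> m\<close> the maximum is over a finite nonempty family, so it reaches
  a level exactly when one member does; dividing by the positive power of \<open>n\<close> turns the
  normalised threshold into \<epsilon>.\<close>

lemma max_stat_le_iff:
  assumes U: "\<And>i. i \<ge> 1 \<Longrightarrow> U i \<omega> = cis (\<theta> i \<omega>)" and n: "n \<ge> m" and \<omega>: "\<omega> \<in> space M"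
  shows "real n powr (2 * real m / (real m - 1))
      * (1 / 2 * (\<Sum>s = 1..m - 1. real m * g (2 * pi * real s / real m)) - max_stat m (pair_sum m g) U n \<omega>) \<le> t
    \<longleftrightarrow> \<omega> \<in> (\<Union>\<alpha>\<in>subsets n. event (t * real n powr (- (2 * real m / (real m - 1)))) \<alpha>)"
proof -
  define a where "a = 2 * real m / (real m - 1)"
  define C where "C = 1 / 2 * (\<Sum>s = 1..m - 1. real m * g (2 * pi * real s / real m))"
  have n0: "real n > 0" using n m_pos by simp
  have "subsets n \<noteq> {}" using card_subsets[of n] n by (metis card.empty zero_less_binomial_iff less_irrefl)
  moreover have "max_stat m (pair_sum m g) U n \<omega> = Max ((\<lambda>\<alpha>. angle_sum m g (\<lambda>i. \<theta> (enumerate \<alpha> i) \<omega>)) ` subsets n)"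
    unfolding max_stat_def by (rule arg_cong[where f = Max], rule max_stat_subsets) (rule U)
  ultimately have "C - t * real n powr (- a) \<le> max_stat m (pair_sum m g) U n \<omega>
    \<longleftrightarrow> (\<exists>\<alpha>\<in>subsets n. C - t * real n powr (- a) \<le> angle_sum m g (\<lambda>i. \<theta> (enumerate \<alpha> i) \<omega>))"
    using finite_subsets by (simp add: Max_ge_iff)
  also have "\<dots> \<longleftrightarrow> \<omega> \<in> (\<Union>\<alpha>\<in>subsets n. event (t * real n powr (- a)) \<alpha>)"
    using \<omega> by (auto simp: event_def gap_def C_def algebra_simps)
  finally show ?thesis
    using n0 unfolding a_def[symmetric] C_def[symmetric]
    by (simp add: powr_minus field_simps)
qed

end

section \<open>From points on the circle to their angles\<close>

lemma Arg2pi_measurable: "Arg2pi \<in> borel_measurable borel"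
  by (rule borel_measurableI_le) (use closed_Arg2pi2pi_le in \<open>auto intro: borel_closed\<close>)

lemma sets_arc_length: "sets arc_length = sets (restrict_space borel unit_circle)"
  by (simp add: arc_length_def)

lemma space_arc_length: "space arc_length = unit_circle"
  by (simp add: arc_length_def space_restrict_space)

lemma Arg2pi_measurable_arc_length: "Arg2pi \<in> borel_measurable arc_length"
  using measurable_restrict_space1[OF Arg2pi_measurable, of unit_circle]
  by (simp add: measurable_cong_sets[OF sets_arc_length refl])

lemma cis_measurable_restrict: "cis \<in> measurable (restrict_space lborel {0..<2 * pi}) (restrict_space borel unit_circle)"
proof (rule measurable_restrict_space2)
  show "cis \<in> space (restrict_space lborel {0..<2 * pi}) \<rightarrow> unit_circle" by (auto simp: unit_circle_def)
  have "cis \<in> borel_measurable borel" by (intro borel_measurable_continuous_onI continuous_intros)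
  then show "cis \<in> borel_measurable (restrict_space lborel {0..<2 * pi})"
    by (intro measurable_restrict_space1) simp
qed

text \<open>\<open>arc_length\<close> is the image of Lebesgue measure on one period under
  \<open>cis\<close>, and \<open>Arg2pi\<close> inverts \<open>cis\<close> there, so the density
  travels back to the line unchanged.\<close>

lemma (in polygon_sample) law_of_angle:
  assumes "prob_space M" and d: "distributed M arc_length X (\<lambda>z. ennreal (p (Arg2pi z)))"
  shows "distr M borel (\<lambda>\<omega>. Arg2pi (X \<omega>)) = law"
proof -
  let ?R = "restrict_space lborel {0..<2 * pi} :: real measure"
  have Xm: "X \<in> measurable M arc_length" and X: "distr M arc_length X = density arc_length (\<lambda>z. ennreal (p (Arg2pi z)))"
    using d by (auto simp: distributed_def)
  have fm: "(\<lambda>z. ennreal (p (Arg2pi z))) \<in> borel_measurable arc_length"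
    using measurable_compose[OF Arg2pi_measurable_arc_length p_measurable] by simp
  have pm: "(\<lambda>x. ennreal (p (Arg2pi (cis x)))) \<in> borel_measurable ?R"
    using measurable_compose[OF cis_measurable_restrict] fm by (simp add: measurable_cong_sets[OF sets_arc_length refl])
  have Am: "(\<lambda>x. Arg2pi (cis x)) \<in> borel_measurable ?R"
    using measurable_compose[OF cis_measurable_restrict] Arg2pi_measurable_arc_length
    by (simp add: measurable_cong_sets[OF sets_arc_length refl])
  have "distr M borel (\<lambda>\<omega>. Arg2pi (X \<omega>)) = distr (distr M arc_length X) borel Arg2pi"
    using Arg2pi_measurable_arc_length Xm by (simp add: distr_distr comp_def)
  also have "distr M arc_length X = distr (density ?R (\<lambda>x. ennreal (p (Arg2pi (cis x))))) (restrict_space borel unit_circle) cis"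
    unfolding X using fm cis_measurable_restrict
    by (subst arc_length_def, subst density_distr) (auto simp: measurable_cong_sets[OF sets_arc_length refl])
  also have "distr \<dots> borel Arg2pi = distr (density ?R (\<lambda>x. ennreal (p (Arg2pi (cis x))))) borel (\<lambda>x. Arg2pi (cis x))"
    using cis_measurable_restrict measurable_restrict_space1[OF Arg2pi_measurable, of unit_circle]
    by (subst distr_distr) (auto simp: comp_def)
  also have "\<dots> = law"
  proof (rule measure_eqI)
    fix A assume "A \<in> sets (distr (density ?R (\<lambda>x. ennreal (p (Arg2pi (cis x))))) borel (\<lambda>x. Arg2pi (cis x)))"
    then have A: "A \<in> sets borel" by simp
    have "emeasure (distr (density ?R (\<lambda>x. ennreal (p (Arg2pi (cis x))))) borel (\<lambda>x. Arg2pi (cis x))) A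
      = emeasure (density ?R (\<lambda>x. ennreal (p (Arg2pi (cis x))))) ((\<lambda>x. Arg2pi (cis x)) -` A \<inter> space ?R)"
      using A Am by (subst emeasure_distr) auto
    also have "\<dots> = (\<integral>\<^sup>+x. ennreal (p (Arg2pi (cis x))) * indicator ((\<lambda>x. Arg2pi (cis x)) -` A \<inter> space ?R) x \<partial>?R)"
      using pm measurable_sets[OF Am A] by (rule emeasure_density)
    also have "\<dots> = (\<integral>\<^sup>+x. ennreal (p x) * indicator A x \<partial>?R)"
      by (intro nn_integral_cong) (auto simp: space_restrict_space Arg2pi_cis indicator_def)
    also have "\<dots> = (\<integral>\<^sup>+x. ennreal (p x) * indicator A x * indicator {0..<2 * pi} x \<partial>lborel)"
      by (rule nn_integral_restrict_space) simp
    also have "\<dots> = (\<integral>\<^sup>+x. indicator {0..<2 * pi} x * ennreal (p x) * indicator A x \<partial>lborel)"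
      by (intro nn_integral_cong) (simp add: mult_ac)
    also have "\<dots> = emeasure law A"
      unfolding law_lborel using A by (subst emeasure_density) auto
    finally show "emeasure (distr (density ?R (\<lambda>x. ennreal (p (Arg2pi (cis x))))) borel (\<lambda>x. Arg2pi (cis x))) A = emeasure law A" .
  qed simp
  finally show ?thesis .
qed

theorem theorem6p2:
  fixes m :: nat
    and g p :: "real \<Rightarrow> real"
    and M :: "'a measure"
    and U :: "nat \<Rightarrow> 'a \<Rightarrow> complex"
    and t :: real
  assumes "m \<ge> 2"
    and "continuous_on {0..2 * pi} g"
    and "\<forall>s\<in>{1..m - 1}. \<exists>N. open N \<and> N \<subseteq> {0..2 * pi} \<and> 2 * pi * real s / real m \<in> N
           \<and> cont_diff_on 3 g N"
    and "\<forall>x\<in>{0..2 * pi}. g x = g (2 * pi - x)"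
    and "max_only_at_regular_polygons m (pair_sum m g)"
    and "continuous_on UNIV p"
    and "\<forall>x. p x \<ge> 0"
    and "\<forall>x. p (x + 2 * pi) = p x"
    and "(p has_integral 1) {0..2 * pi}"
    and "prob_space M"
    and "prob_space.indep_vars M (\<lambda>_. arc_length) U {1..}"
    and "\<forall>i\<ge>1. distributed M arc_length (U i) (\<lambda>z. ennreal (p (Arg2pi z)))"
    and "density_overlap m p > 0"
    and "Determinant.det (hess_mat m g) \<noteq> 0"
    and "t > 0"
  shows "(\<lambda>n. measure M {\<omega> \<in> space M.
            real n powr (2 * real m / (real m - 1))
              * (1 / 2 * (\<Sum>s = 1..m - 1. real m * g (2 * pi * real s / real m))
                 - max_stat m (pair_sum m g) U n \<omega>) \<le> t})
         \<longlonglongrightarrow> 1 - exp (- (t powr ((real m - 1) / 2) * limit_const m g p / real m))"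
proof -
  define \<theta> where "\<theta> i \<omega> = Arg2pi (U i \<omega>)" for i \<omega>
  interpret S: polygon_sample m g p
    by (intro polygon_sample.intro polygon_kernel.intro polygon_sample_axioms.intro assms
        assms(7)[rule_format] assms(8)[rule_format])
  interpret polygon_points m g p M \<theta>
  proof (intro polygon_points.intro polygon_points_axioms.intro S.polygon_sample_axioms)
    show "prob_space M" by fact
    then show "prob_space.indep_vars M (\<lambda>_. borel) \<theta> {1..}"
      unfolding \<theta>_def using assms(11) Arg2pi_measurable_arc_length by (rule prob_space.indep_vars_compose2)
    show "distr M borel (\<theta> i) = S.law" if "i \<ge> 1" for i
      unfolding \<theta>_def using assms(10,12) that by (intro S.law_of_angle) auto
  qed
  \<comment> \<open>Holds at every sample point, not just almost surely, because the space of
    \<open>arc_length\<close> is the unit circle.\<close>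
  have U: "U i \<omega> = cis (\<theta> i \<omega>)" if "i \<ge> 1" "\<omega> \<in> space M" for i \<omega>
  proof -
    have "U i \<in> measurable M arc_length" using assms(12) that(1) by (auto simp: distributed_def)
    then have "U i \<omega> \<in> unit_circle" using measurable_space[OF _ that(2)] space_arc_length by metis
    then show ?thesis by (simp add: \<theta>_def cis_Arg2pi unit_circle_def)
  qed
  \<comment> \<open>Only eventually, since the maximum is unspecified for
    \<open>n < m\<close>.\<close>
  have "\<forall>\<^sub>F n in sequentially.
      measure M (\<Union>\<alpha>\<in>subsets n. event (t * real n powr (- (2 * real m / (real m - 1)))) \<alpha>)
    = measure M {\<omega> \<in> space M.
            real n powr (2 * real m / (real m - 1))
              * (1 / 2 * (\<Sum>s = 1..m - 1. real m * g (2 * pi * real s / real m))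
                 - max_stat m (pair_sum m g) U n \<omega>) \<le> t}"
    using eventually_ge_at_top[of m]
  proof eventually_elim
    case (elim n)
    have "(\<Union>\<alpha>\<in>subsets n. event (t * real n powr (- (2 * real m / (real m - 1)))) \<alpha>) \<subseteq> space M"
      by (auto simp: event_def)
    then show ?case
      using max_stat_le_iff[of U, OF U elim] by (intro arg_cong[where f = "measure M"]) blast
  qed
  from Lim_transform_eventually[OF prob_hit_limit[OF assms(15)] this] show ?thesis .
qed

end
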